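(* Let $P=(h_0,h_1,u_0,u_1,l_0,l_1)\in\{M,V\}^6$ and $k\ge 2$, and put $n=2k$, $m=2k-1$. Identify $M=+1$, $V=-1$ and set $\rho=h_0h_1$, $\tau=u_0u_1$, $\delta_i=h_0h_1u_il_i$ for $i=0,1$. The exact labelled state set $F(P,k)$ is determined by exactly one of the following four mutually exclusive and exhaustive regimes. (1) Zero: if $\delta_0\ne -1$ or $\delta_1\neq -1$, then $F(P,k)=\varnothing$. (2) Pleat singleton: if $\delta_0=\delta_1=-1$ and $\tau=-1$, then $P$ is one of eight words and $F(P,k)$ is a singleton, namely $F(MMMVVM,k)=\{\Omega_+(k)\}$, $F(MMVMMV,k)=\{T_R(\Omega_+(k))\}$, $F(VVMVVM,k)=\{T_{CR}(\Omega_+(k))\}$, $F(VVVMMV,k)=\{T_C(\Omega_+(k))\}$, $F(MVMVMV,k)=\{\Omega_-(k)\}$, $F(VMMVMV,k)=\{T_H(\Omega_-(k))\}$, $F(VMVMVM,k)=\{T_C(\Omega_-(k))\}$, $F(MVVMVM,k)=\{T_{CH}(\Omega_-(k))\}$. (3) Constant row, $\rho=+1$: if $\delta_0=\delta_1=-1$, $\tau=+1$, $\rho=+1$, then $P$ is one of $MMMMVV$, $MMVVMM$, $VVMMVV$, $VVVVMM$, and $F(P,k)$ is respectively $F(MMMMVV,k)$, $T_R(F(MMMMVV,k))$, $T_{CR}(F(MMMMVV,k))$, $T_C(F(MMMMVV,k))$. Every state in $F(P,k)$ has a unique pivot pair $(\alpha,\beta)$, and the map from states to pivot pairs is a bijection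 from $F(P,k)$ onto the set of $(\alpha,\beta)\in\{1,\dots,m\}^2$ with: $\alpha=1$ or $\alpha=m$ or $\alpha=\beta$, when $P\in\{MMMMVV,VVVVMM\}$; $\beta=1$ or $\beta=m$ or $\alpha=\beta$, when $P\in\{MMVVMM,VVMMVV\}$. (4) Constant row, $\rho=-1$: if $\delta_0=\delta_1=-1$, $\tau=+1$, $\rho=-1$, then $P$ is one of $MVMMMM$, $VMMMMM$, $VMVVVV$, $MVVVVV$, and $F(P,k)$ is respectively $F(MVMMMM,k)$, $T_H(F(MVMMMM,k))$, $T_C(F(MVMMMM,k))$, $T_{CH}(F(MVMMMM,k))$. Every state in $F(P,k)$ has a unique pivot pair $(\alpha,\beta)$, and the map from states to pivot pairs is a bijection from $F(P,k)$ onto the set of $(\alpha,\beta)\in\{1,\dots,m\}^2$ with: $B_R(\alpha)=B_R(\beta)$, when $P\in\{MVMMMM,VMVVVV\}$; $B_L(\alpha)=B_L(\beta)$, when $P\in\{VMMMMM,MVVVVV\}$.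
   Context: Map and assignment. Let $k\ge2$, $n=2k$. The upper faces are $A_1,\dots,A_n$, the lower faces $B_1,\dots,B_n$. The creases are $H_c=(A_c,B_c)$ ($1\le c\le n$), $U_i=(A_i,A_{i+1})$ and $L_i=(B_i,B_{i+1})$ ($1\le i\le n-1$); the two faces of a crease are its wings. A word $P=(h_0,h_1,u_0,u_1,l_0,l_1)\in\{M,V\}^6$ (written as a six-letter string) assigns to $H_c$ the label $h_{(c-1)\bmod 2}$ and to $U_i,L_i$ the labels $u_{(i-1)\bmod2},l_{(i-1)\bmod2}$. The assignment is locally flat-foldable if for every $1\le c\le n-1$ an odd number of the four creases $H_c,H_{c+1},U_c,L_c$ (meeting at an interior vertex) are labelled $M$. States. $x\prec y$ means $x$ lies above (comes before) $y$ in a total order. A strict total order of all $4k$ labelled faces is order-valid for $P$ if: (i) Precedence: with $A_c$ in row $r=0$ and $B_c$ in row $r=1$, the face in row $r$, column $c$ is light-up iff $r+c-1$ is even and dark-up otherwise; across each $M$ crease the light-up wing precedes the dark-up wing, across each $V$ crease the dark-up wing precedes the light-up wing. (ii) Noncrossing: every $H_c$ has target class $S$; $U_i$ and $L_i$ have class $E$ for $i$ odd and $W$ for $i$ even; for any two distinct creases of the same target class with disjoint wing sets, with wing positions $a_0<a_1$ and $b_0<b_1$ in the order, neither $a_0<b_0<a_1<b_1$ nor $b_0<a_0<b_1<a_1$. $F(P,k)$ is the set of all order-valid strict total orders if $P$ is locally flat-foldable, and $F(P,k)=\varnothing$ otherwise. Faces are labelled; no symmetry quotient is taken. Symmetry maps.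 $\phi_R$ exchanges $A_c$ and $B_c$ for all $c$; $\phi_H(A_c)=A_{n+1-c}$, $\phi_H(B_c)=B_{n+1-c}$. For a total order $\Pi$ (a list), $\phi(\Pi)$ is elementwise relabelling and $\operatorname{rev}(\Pi)$ reversal. $T_C(\Pi)=\operatorname{rev}(\Pi)$, $T_R(\Pi)=\operatorname{rev}(\phi_R(\Pi))$, $T_H(\Pi)=\operatorname{rev}(\phi_H(\Pi))$, $T_{CR}(\Pi)=\phi_R(\Pi)$, $T_{CH}(\Pi)=\phi_H(\Pi)$; applied to sets elementwise. Pleat orders. $\Omega_+(k)=Q_1Q_2\cdots Q_k$ (concatenation) with $Q_q=(A_{2q-1},B_{2q-1},B_{2q},A_{2q})$; $\Omega_-(k)=(A_1,\dots,A_n,B_n,B_{n-1},\dots,B_1)$. Pivots. Write $O_i=2i-1$, $D_i=2i$ for $1\le i\le k$. For $1\le p\le 2k-1$ define the column word $W_p$ by $W_{2s-1}=(O_s,O_{s-1},\dots,O_1,D_1,\dots,D_{s-1},O_{s+1},\dots,O_k,D_k,\dots,D_{s+1},D_s)$ and $W_{2s}=(O_{s+1},\dots,O_k,D_k,\dots,D_{s+1},O_s,\dots,O_1,D_1,\dots,D_s)$, empty blocks omitted. The first and last entries of $W_p$ are the columns $p,p+1$ in some order. A total order of the faces has pivot pair $(\alpha,\beta)$ if its restriction to the upper faces has column sequence $W_\alpha$ or $\operatorname{rev}(W_\alpha)$ and its restriction to the lower faces has column sequence $W_\beta$ or $\operatorname{rev}(W_\beta)$. Block coordinates. $B_R(1)=0$,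 $B_R(p)=\lfloor p/2\rfloor$ for $p\ge2$; $B_L(p)=B_R(n-p)$ for $1\le p\le m$. *)

theory Defs
  imports Main
begin

text \<open>\<open>FaceA c\<close>, \<open>FaceB c\<close> are \<open>A\<^sub>c\<close>, \<open>B\<^sub>c\<close>; all indices start at 1, and
  the constructors carry arbitrary naturals, so ranges are imposed by \<open>faces\<close> and \<open>creases\<close>.\<close>

datatype label = M | V
datatype face = is_FaceA: FaceA (col: nat) | is_FaceB: FaceB (col: nat)
datatype crease = CrH nat | CrU nat | CrL nat
datatype target_class = Class_S | Class_E | Class_W

definition faces :: "nat \<Rightarrow> face set" where
  "faces k = FaceA ` {1..2*k} \<union> FaceB ` {1..2*k}"

definition creases :: "nat \<Rightarrow> crease set" where
  "creases k = CrH ` {1..2*k} \<union> CrU ` {1..2*k-1} \<union> CrL ` {1..2*k-1}"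

fun wings :: "crease \<Rightarrow> face set" where
  "wings (CrH c) = {FaceA c, FaceB c}"
| "wings (CrU i) = {FaceA i, FaceA (i+1)}"
| "wings (CrL i) = {FaceB i, FaceB (i+1)}"

fun target :: "crease \<Rightarrow> target_class" where
  "target (CrH c) = Class_S"
| "target (CrU i) = (if odd i then Class_E else Class_W)"
| "target (CrL i) = (if odd i then Class_E else Class_W)"

text \<open>The word \<open>(h\<^sub>0, h\<^sub>1, u\<^sub>0, u\<^sub>1, l\<^sub>0, l\<^sub>1)\<close>; the selectors are used with index 0 or 1.\<close>

type_synonym label_word = "label \<times> label \<times> label \<times> label \<times> label \<times> label"

fun word_h :: "label_word \<Rightarrow> nat \<Rightarrow> label" where
  "word_h (h0, h1, u0, u1, l0, l1) i = (if i = 0 then h0 else h1)"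

fun word_u :: "label_word \<Rightarrow> nat \<Rightarrow> label" where
  "word_u (h0, h1, u0, u1, l0, l1) i = (if i = 0 then u0 else u1)"

fun word_l :: "label_word \<Rightarrow> nat \<Rightarrow> label" where
  "word_l (h0, h1, u0, u1, l0, l1) i = (if i = 0 then l0 else l1)"

fun assigned :: "label_word \<Rightarrow> crease \<Rightarrow> label" where
  "assigned P (CrH c) = word_h P ((c - 1) mod 2)"
| "assigned P (CrU i) = word_u P ((i - 1) mod 2)"
| "assigned P (CrL i) = word_l P ((i - 1) mod 2)"

definition locally_flat_foldable :: "label_word \<Rightarrow> nat \<Rightarrow> bool" where
  "locally_flat_foldable P k \<longleftrightarrow>
     (\<forall>c\<in>{1..2*k-1}. odd (card {x \<in> {CrH c, CrH (c+1), CrU c, CrL c}. assigned P x = M}))"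

text \<open>A strict total order of the faces is the list of all faces, without repetition, from first
  (top) to last (bottom).\<close>

definition total_order_of_faces :: "nat \<Rightarrow> face list \<Rightarrow> bool" where
  "total_order_of_faces k xs \<longleftrightarrow> distinct xs \<and> set xs = faces k"

definition before :: "face list \<Rightarrow> face \<Rightarrow> face \<Rightarrow> bool" where
  "before xs x y \<longleftrightarrow> (\<exists>i j. i < j \<and> j < length xs \<and> xs ! i = x \<and> xs ! j = y)"

fun row :: "face \<Rightarrow> nat" where
  "row (FaceA c) = 0"
| "row (FaceB c) = 1"

definition light_up :: "face \<Rightarrow> bool" where
  "light_up f \<longleftrightarrow> even (row f + col f - 1)"

text \<open>The two wings of a crease always have opposite orientation, so \<open>f\<close> and \<open>g\<close> below are determined
  by \<open>x\<close>.\<close>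

definition precedence :: "label_word \<Rightarrow> nat \<Rightarrow> face list \<Rightarrow> bool" where
  "precedence P k xs \<longleftrightarrow>
     (\<forall>x\<in>creases k. \<forall>f\<in>wings x. \<forall>g\<in>wings x. light_up f \<and> \<not> light_up g \<longrightarrow>
        (case assigned P x of M \<Rightarrow> before xs f g | V \<Rightarrow> before xs g f))"

definition crosses :: "face list \<Rightarrow> crease \<Rightarrow> crease \<Rightarrow> bool" where
  "crosses xs x y \<longleftrightarrow>
     (\<exists>a0 a1 b0 b1. wings x = {a0, a1} \<and> wings y = {b0, b1} \<and>
        before xs a0 b0 \<and> before xs b0 a1 \<and> before xs a1 b1)"

definition noncrossing :: "nat \<Rightarrow> face list \<Rightarrow> bool" where
  "noncrossing k xs \<longleftrightarrow>
     (\<forall>x\<in>creases k. \<forall>y\<in>creases k.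
        x \<noteq> y \<and> target x = target y \<and> wings x \<inter> wings y = {} \<longrightarrow>
        \<not> crosses xs x y \<and> \<not> crosses xs y x)"

definition order_valid :: "label_word \<Rightarrow> nat \<Rightarrow> face list \<Rightarrow> bool" where
  "order_valid P k xs \<longleftrightarrow> total_order_of_faces k xs \<and> precedence P k xs \<and> noncrossing k xs"

definition F :: "label_word \<Rightarrow> nat \<Rightarrow> face list set" where
  "F P k = (if locally_flat_foldable P k then {xs. order_valid P k xs} else {})"

fun phi_R :: "face \<Rightarrow> face" where
  "phi_R (FaceA c) = FaceB c"
| "phi_R (FaceB c) = FaceA c"

fun phi_H :: "nat \<Rightarrow> face \<Rightarrow> face" where
  "phi_H k (FaceA c) = FaceA (2*k + 1 - c)"
| "phi_H k (FaceB c) = FaceB (2*k + 1 - c)"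

definition T_C :: "face list \<Rightarrow> face list" where
  "T_C xs = rev xs"

definition T_R :: "face list \<Rightarrow> face list" where
  "T_R xs = rev (map phi_R xs)"

definition T_H :: "nat \<Rightarrow> face list \<Rightarrow> face list" where
  "T_H k xs = rev (map (phi_H k) xs)"

definition T_CR :: "face list \<Rightarrow> face list" where
  "T_CR xs = map phi_R xs"

definition T_CH :: "nat \<Rightarrow> face list \<Rightarrow> face list" where
  "T_CH k xs = map (phi_H k) xs"

definition Omega_plus :: "nat \<Rightarrow> face list" where
  "Omega_plus k =
     concat (map (\<lambda>q. [FaceA (2*q-1), FaceB (2*q-1), FaceB (2*q), FaceA (2*q)]) [1..<k+1])"

definition Omega_minus :: "nat \<Rightarrow> face list" where
  "Omega_minus k = map FaceA [1..<2*k+1] @ rev (map FaceB [1..<2*k+1])"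

text \<open>\<open>odd_cols i j\<close> is \<open>O\<^sub>i, \<dots>, O\<^sub>j\<close> and \<open>even_cols i j\<close> is \<open>D\<^sub>i, \<dots>, D\<^sub>j\<close>, both empty for \<open>j < i\<close>.\<close>

definition odd_cols :: "nat \<Rightarrow> nat \<Rightarrow> nat list" where
  "odd_cols i j = map (\<lambda>t. 2*t - 1) [i..<j+1]"

definition even_cols :: "nat \<Rightarrow> nat \<Rightarrow> nat list" where
  "even_cols i j = map (\<lambda>t. 2*t) [i..<j+1]"

definition pivot_word :: "nat \<Rightarrow> nat \<Rightarrow> nat list" where
  "pivot_word k p =
     (if odd p then
        (let s = (p + 1) div 2 in
           rev (odd_cols 1 s) @ even_cols 1 (s-1) @ odd_cols (s+1) k @ rev (even_cols s k))
      else
        (let s = p div 2 in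
           odd_cols (s+1) k @ rev (even_cols (s+1) k) @ rev (odd_cols 1 s) @ even_cols 1 s))"

definition has_pivot_pair :: "nat \<Rightarrow> face list \<Rightarrow> nat \<times> nat \<Rightarrow> bool" where
  "has_pivot_pair k xs ab \<longleftrightarrow>
     fst ab \<in> {1..2*k-1} \<and> snd ab \<in> {1..2*k-1} \<and>
     map col (filter is_FaceA xs) \<in> {pivot_word k (fst ab), rev (pivot_word k (fst ab))} \<and>
     map col (filter is_FaceB xs) \<in> {pivot_word k (snd ab), rev (pivot_word k (snd ab))}"

definition pivot_pair :: "nat \<Rightarrow> face list \<Rightarrow> nat \<times> nat" where
  "pivot_pair k xs = (THE ab. has_pivot_pair k xs ab)"

definition B_R :: "nat \<Rightarrow> nat" where
  "B_R p = (if p = 1 then 0 else p div 2)"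

definition B_L :: "nat \<Rightarrow> nat \<Rightarrow> nat" where
  "B_L k p = B_R (2*k - p)"

fun label_sign :: "label \<Rightarrow> int" where
  "label_sign M = 1"
| "label_sign V = -1"

definition rho :: "label_word \<Rightarrow> int" where
  "rho P = label_sign (word_h P 0) * label_sign (word_h P 1)"

definition tau :: "label_word \<Rightarrow> int" where
  "tau P = label_sign (word_u P 0) * label_sign (word_u P 1)"

definition delta :: "nat \<Rightarrow> label_word \<Rightarrow> int" where
  "delta i P = label_sign (word_h P 0) * label_sign (word_h P 1) *
     label_sign (word_u P i) * label_sign (word_l P i)"

datatype regime = Zero | Pleat | Row_Plus | Row_Minus

fun in_regime :: "regime \<Rightarrow> label_word \<Rightarrow> bool" where
  "in_regime Zero P \<longleftrightarrow> delta 0 P \<noteq> -1 \<or> delta 1 P \<noteq> -1"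
| "in_regime Pleat P \<longleftrightarrow> delta 0 P = -1 \<and> delta 1 P = -1 \<and> tau P = -1"
| "in_regime Row_Plus P \<longleftrightarrow> delta 0 P = -1 \<and> delta 1 P = -1 \<and> tau P = 1 \<and> rho P = 1"
| "in_regime Row_Minus P \<longleftrightarrow> delta 0 P = -1 \<and> delta 1 P = -1 \<and> tau P = 1 \<and> rho P = -1"

end

theory Submission
  imports Defs
begin

text \<open>An order of the faces is encoded by an integer key on the faces, so that every constraint becomes a
  comparison of integers. Write \<open>O\<^sub>t\<close>, \<open>D\<^sub>t\<close> for the columns \<open>2t-1\<close>, \<open>2t\<close>. Reversal and the two face
  symmetries reduce everything to the words \<open>MMMMVV\<close>, \<open>MVMMMM\<close>, \<open>MMMVVM\<close>, \<open>MVMVMV\<close>; for the last two the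
  crease directions alone force a linear order. For the first two, each row taken by itself is a strip
  with all \<open>O\<close> columns before their neighbouring \<open>D\<close> columns, and induction on the number of columns shows
  that the only noncrossing orders of such a strip are the words \<open>W\<^sub>p\<close> (reversed in the lower row for
  \<open>MVMMMM\<close>).

  For \<open>MMMMVV\<close>, a column \<open>D\<close> above a column \<open>O\<close> in the upper row is also above it in the lower row, and
  these inversions determine \<open>\<alpha>\<close> unless there are none, that is unless \<open>\<alpha> \<in> {1, m}\<close>. For \<open>MVMMMM\<close>, if
  \<open>\<alpha> div 2 \<noteq> \<beta> div 2\<close> then three columns already violate the noncrossing condition of the \<open>H\<close> creases.
  Two \<open>H\<close> arcs with the same direction are nested or disjoint, so the comparison between an upper and a
  lower face can be read off the two row words; arcs of opposite direction occur only for \<open>MMMMVV\<close>, where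
  \<open>\<alpha> \<in> {1, m}\<close> or \<open>\<alpha> = \<beta>\<close> settles them. Hence the pivot pair determines the state. Existence is by explicit piecewise linear keys.\<close>

section \<open>Orders and integer keys\<close>

text \<open>Light and dark faces alternate along each row and between the rows, which is why the
  signs decide everything. For \<tau> = -1 every crease of a row continues the direction of the
  previous one and the row is a chain. For \<tau> = +1 the directions alternate, so a row is only a
  zigzag poset with many linear extensions; the class E and class W arcs have to cut these down to
  2k-1. The sign \<rho> says whether the H arcs at O and at D columns point in opposite directions
  (\<rho> = +1) or all the same way (\<rho> = -1), and the condition on the \<delta>'s then makes
  the lower row parallel or antiparallel to the upper one. Opposite arcs are the obstacle: the row
  words do not by themselves say which of two overlapping ones contains the other.

  A key matters only through its comparisons. Uniqueness is therefore agreement of comparisons, and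
  existence may use keys with large gaps.\<close>

lemma before_iff_key:
  fixes f :: "face \<Rightarrow> int"
  assumes "sorted_wrt (\<lambda>x y. f x < f y) xs"
  shows "before xs x y \<longleftrightarrow> x \<in> set xs \<and> y \<in> set xs \<and> f x < f y"
proof
  assume "before xs x y"
  then show "x \<in> set xs \<and> y \<in> set xs \<and> f x < f y"
    using sorted_wrt_nth_less[OF assms] by (fastforce simp: before_def)
next
  assume R: "x \<in> set xs \<and> y \<in> set xs \<and> f x < f y"
  then obtain i j where ij: "i < length xs" "j < length xs" "xs ! i = x" "xs ! j = y"
    by (metis in_set_conv_nth)
  have "i < j"
  proof (rule ccontr)
    assume "\<not> i < j"
    then consider "i = j" | "j < i" by linarith
    then show False using R ij sorted_wrt_nth_less[OF assms, of j i] by cases auto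
  qed
  then show "before xs x y" using ij by (auto simp: before_def)
qed

lemma ex_key:
  assumes "distinct xs"
  shows "\<exists>f::'a \<Rightarrow> int. sorted_wrt (\<lambda>x y. f x < f y) xs"
proof -
  define f where "f x = int (THE i. i < length xs \<and> xs ! i = x)" for x
  have "f (xs ! i) = int i" if "i < length xs" for i
    unfolding f_def using that assms by (auto simp: nth_eq_iff_index_eq)
  then have "sorted_wrt (\<lambda>x y. f x < f y) xs" by (auto simp: sorted_wrt_iff_nth_less)
  then show ?thesis by blast
qed

lemma sorted_key_inj:
  fixes f :: "'a \<Rightarrow> int"
  assumes "sorted_wrt (\<lambda>x y. f x < f y) xs"
  shows "distinct xs" "inj_on f (set xs)"
proof -
  have "sorted_wrt (<) (map f xs)" using assms by (simp add: sorted_wrt_map)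
  then have "distinct (map f xs)" by (simp add: strict_sorted_iff)
  then show "distinct xs" "inj_on f (set xs)" by (simp_all add: distinct_map)
qed

lemma ex_list_of_key:
  fixes f :: "'a \<Rightarrow> int"
  assumes "finite S" "inj_on f S"
  shows "\<exists>xs. set xs = S \<and> sorted_wrt (\<lambda>x y. f x < f y) xs"
proof -
  obtain ys where ys: "set ys = S" "distinct ys" using assms finite_distinct_list by blast
  have "distinct (map f (sort_key f ys))" using ys assms by (simp add: distinct_map)
  then have "sorted_wrt (<) (map f (sort_key f ys))" by (simp add: strict_sorted_iff)
  then show ?thesis using ys by (intro exI[of _ "sort_key f ys"]) (simp add: sorted_wrt_map)
qed

lemma sorted_key_unique:
  fixes f :: "'a \<Rightarrow> int"
  assumes "sorted_wrt (\<lambda>x y. f x < f y) xs" "sorted_wrt (\<lambda>x y. f x < f y) ys"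
    and "set xs = set ys"
  shows "xs = ys"
proof (rule map_inj_on)
  show "map f xs = map f ys"
    using assms by (intro strict_sorted_equal) (auto simp: sorted_wrt_map)
  show "inj_on f (set xs \<union> set ys)" using sorted_key_inj(2)[OF assms(1)] assms(3) by simp
qed

text \<open>The faces of the columns \<open>O\<^sub>t\<close> and \<open>D\<^sub>t\<close> (odd and even) in the rows \<open>A\<close> and \<open>B\<close>.\<close>

definition Ao :: "nat \<Rightarrow> face" where "Ao t = FaceA (2 * t - 1)"
definition Ae :: "nat \<Rightarrow> face" where "Ae t = FaceA (2 * t)"
definition Bo :: "nat \<Rightarrow> face" where "Bo t = FaceB (2 * t - 1)"
definition Be :: "nat \<Rightarrow> face" where "Be t = FaceB (2 * t)"

lemma columns_eq: "{1..2*k} = (\<lambda>t. 2*t - 1) ` {1..k} \<union> (\<lambda>t. 2*t) ` {1..k::nat}" (is "?L = ?R")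
proof
  show "?L \<subseteq> ?R"
  proof
    fix c assume c: "c \<in> ?L"
    show "c \<in> ?R"
    proof (cases "odd c")
      case True
      then obtain t where "c = 2 * t + 1" by (auto elim: oddE)
      with c show ?thesis by (intro UnI1 image_eqI[of _ _ "t+1"]) auto
    qed (use c in \<open>auto elim!: evenE\<close>)
  qed
qed auto

text \<open>The last crease index 2k-1 is odd: there are k odd but only k-1 even indices, hence the
  half-open range for all class W creases.\<close>

lemma crease_columns_eq:
  "{1..2*k-1} = (\<lambda>t. 2*t - 1) ` {1..k} \<union> (\<lambda>t. 2*t) ` {1..<k::nat}" (is "?L = ?R")
proof
  show "?L \<subseteq> ?R"
  proof
    fix c assume c: "c \<in> ?L"
    show "c \<in> ?R"
    proof (cases "odd c")
      case True
      then obtain t where "c = 2 * t + 1" by (auto elim: oddE)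
      with c show ?thesis by (intro UnI1 image_eqI[of _ _ "t+1"]) auto
    qed (use c in \<open>auto elim!: evenE\<close>)
  qed
qed auto

lemma faces_eq: "faces k = Ao ` {1..k} \<union> Ae ` {1..k} \<union> Bo ` {1..k} \<union> Be ` {1..k}"
  unfolding faces_def columns_eq image_Un image_image Ao_def Ae_def Bo_def Be_def by blast

lemma finite_faces [simp]: "finite (faces k)" by (simp add: faces_def)

lemma face_neq [simp]:
  "Ao t = Ao u \<longleftrightarrow> 2*t - 1 = 2*u - 1" "Ae t = Ae u \<longleftrightarrow> t = u"
  "Bo t = Bo u \<longleftrightarrow> 2*t - 1 = 2*u - 1" "Be t = Be u \<longleftrightarrow> t = u"
  "Ao t \<noteq> Bo u" "Ao t \<noteq> Be u" "Ae t \<noteq> Bo u" "Ae t \<noteq> Be u"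
  "Bo t \<noteq> Ao u" "Be t \<noteq> Ao u" "Bo t \<noteq> Ae u" "Be t \<noteq> Ae u"
  by (auto simp: Ao_def Ae_def Bo_def Be_def)

lemma face_in_faces:
  "t \<in> {1..k} \<Longrightarrow> Ao t \<in> faces k" "t \<in> {1..k} \<Longrightarrow> Ae t \<in> faces k"
  "t \<in> {1..k} \<Longrightarrow> Bo t \<in> faces k" "t \<in> {1..k} \<Longrightarrow> Be t \<in> faces k"
  by (auto simp: faces_eq)

text \<open>On each of these six families the label, the target class and the form of the wings are
  constant.\<close>

lemma all_creases:
  "(\<forall>x\<in>creases k. Q x) \<longleftrightarrow>
     (\<forall>t\<in>{1..k}. Q (CrH (2*t-1))) \<and> (\<forall>t\<in>{1..k}. Q (CrH (2*t))) \<and>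
     (\<forall>t\<in>{1..k}. Q (CrU (2*t-1))) \<and> (\<forall>t\<in>{1..<k}. Q (CrU (2*t))) \<and>
     (\<forall>t\<in>{1..k}. Q (CrL (2*t-1))) \<and> (\<forall>t\<in>{1..<k}. Q (CrL (2*t)))"
  unfolding creases_def columns_eq crease_columns_eq ball_Un ball_simps image_Un image_image
  by (auto)

text \<open>At t = 0 truncation makes \<open>2*t-1\<close> equal to \<open>2*t\<close>, so the odd
  creases inside a row are guarded by \<open>1 \<le> t\<close>.\<close>

lemma wings_seq:
  "wings (CrH (2*t-1)) = {Ao t, Bo t}" "wings (CrH (2*t)) = {Ae t, Be t}"
  "1 \<le> t \<Longrightarrow> wings (CrU (2*t-1)) = {Ao t, Ae t}" "wings (CrU (2*t)) = {Ao (Suc t), Ae t}"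
  "1 \<le> t \<Longrightarrow> wings (CrL (2*t-1)) = {Bo t, Be t}" "wings (CrL (2*t)) = {Bo (Suc t), Be t}"
  by (auto simp: Ao_def Ae_def Bo_def Be_def)

lemma light_up_seq:
  "light_up (Ao t)" "\<not> light_up (Bo (Suc t))" "\<not> light_up (Ae (Suc t))" "light_up (Be t)"
  "1 \<le> t \<Longrightarrow> \<not> light_up (Bo t)" "1 \<le> t \<Longrightarrow> \<not> light_up (Ae t)"
  by (auto simp: light_up_def Ao_def Ae_def Bo_def Be_def)

text \<open>\<open>x\<close> is the key of the light-up wing and \<open>y\<close> that of the
  dark-up wing; a label becomes the direction of an inequality.\<close>

definition precede :: "label \<Rightarrow> int \<Rightarrow> int \<Rightarrow> bool" where
  "precede l x y \<longleftrightarrow> (if l = M then x < y else y < x)"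

text \<open>The wings of an arc may come in either order, hence the minima and maxima.\<close>

definition cross :: "int \<Rightarrow> int \<Rightarrow> int \<Rightarrow> int \<Rightarrow> bool" where
  "cross p q r s \<longleftrightarrow> min p q < min r s \<and> min r s < max p q \<and> max p q < max r s"

text \<open>\<open>cross\<close> is one-sided, the first arc starting first, so two different
  families have to be compared in both orders. The case t = u within one family is harmless, since
  an arc does not cross itself.\<close>

definition arcs_noncrossing ::
  "nat set \<Rightarrow> (nat \<Rightarrow> int) \<Rightarrow> (nat \<Rightarrow> int) \<Rightarrow> (nat \<Rightarrow> int) \<Rightarrow> (nat \<Rightarrow> int) \<Rightarrow> bool" where
  "arcs_noncrossing I x x' y y' \<longleftrightarrow> (\<forall>t\<in>I. \<forall>u\<in>I. \<not> cross (x t) (x' t) (y u) (y' u))"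

text \<open>From here on \<open>a\<close>, \<open>a'\<close>, \<open>b\<close>, \<open>b'\<close> are the keys of \<open>Ao\<close>, \<open>Ae\<close>, \<open>Bo\<close>, \<open>Be\<close>.\<close>

definition keys_precedence ::
  "label_word \<Rightarrow> nat \<Rightarrow> (nat \<Rightarrow> int) \<Rightarrow> (nat \<Rightarrow> int) \<Rightarrow> (nat \<Rightarrow> int) \<Rightarrow> (nat \<Rightarrow> int) \<Rightarrow> bool" where
  "keys_precedence P k a a' b b' \<longleftrightarrow>
     (\<forall>t\<in>{1..k}. precede (word_h P 0) (a t) (b t) \<and> precede (word_h P 1) (b' t) (a' t) \<and>
        precede (word_u P 0) (a t) (a' t) \<and> precede (word_l P 0) (b' t) (b t)) \<and>
     (\<forall>t\<in>{1..<k}. precede (word_u P 1) (a (Suc t)) (a' t) \<and>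
        precede (word_l P 1) (b' t) (b (Suc t)))"

text \<open>Class S (H arcs at O and at D columns), then class E (arcs O_t D_t of both rows), then
  class W (arcs O_(t+1) D_t, hence \<open>Suc\<close> and the range below k).\<close>

definition keys_noncrossing ::
  "nat \<Rightarrow> (nat \<Rightarrow> int) \<Rightarrow> (nat \<Rightarrow> int) \<Rightarrow> (nat \<Rightarrow> int) \<Rightarrow> (nat \<Rightarrow> int) \<Rightarrow> bool" where
  "keys_noncrossing k a a' b b' \<longleftrightarrow>
     arcs_noncrossing {1..k} a b a b \<and> arcs_noncrossing {1..k} a b a' b' \<and>
     arcs_noncrossing {1..k} a' b' a b \<and> arcs_noncrossing {1..k} a' b' a' b' \<and>
     arcs_noncrossing {1..k} a a' a a' \<and> arcs_noncrossing {1..k} a a' b b' \<and>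
     arcs_noncrossing {1..k} b b' a a' \<and> arcs_noncrossing {1..k} b b' b b' \<and>
     arcs_noncrossing {1..<k} (a \<circ> Suc) a' (a \<circ> Suc) a' \<and>
     arcs_noncrossing {1..<k} (a \<circ> Suc) a' (b \<circ> Suc) b' \<and>
     arcs_noncrossing {1..<k} (b \<circ> Suc) b' (a \<circ> Suc) a' \<and>
     arcs_noncrossing {1..<k} (b \<circ> Suc) b' (b \<circ> Suc) b'"

lemma crosses_iff_cross:
  fixes f :: "face \<Rightarrow> int"
  assumes "sorted_wrt (\<lambda>x y. f x < f y) xs"
    and "wings x = {p, q}" "wings y = {r, s}" "{p, q, r, s} \<subseteq> set xs"
  shows "crosses xs x y \<longleftrightarrow> cross (f p) (f q) (f r) (f s)"
proof -
  have "crosses xs x y \<longleftrightarrow>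
     (f p < f r \<and> f r < f q \<and> f q < f s) \<or> (f q < f r \<and> f r < f p \<and> f p < f s) \<or>
     (f p < f s \<and> f s < f q \<and> f q < f r) \<or> (f q < f s \<and> f s < f p \<and> f p < f r)"
    unfolding crosses_def assms(2,3) doubleton_eq_iff before_iff_key[OF assms(1)]
    using assms(4) by auto
  then show ?thesis unfolding cross_def by linarith
qed

text \<open>A crossing puts its four wings at four different keys, so its creases are distinct and
  have disjoint wings. Quantifying over both creases covers the two orders.\<close>

lemma noncrossing_iff:
  assumes "distinct xs"
  shows "noncrossing k xs \<longleftrightarrow>
    (\<forall>x\<in>creases k. \<forall>y\<in>creases k. target x = target y \<longrightarrow> \<not> crosses xs x y)"
proof -
  obtain f :: "face \<Rightarrow> int" where f: "sorted_wrt (\<lambda>x y. f x < f y) xs"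
    using ex_key assms by blast
  have "x \<noteq> y \<and> wings x \<inter> wings y = {}" if c: "crosses xs x y" for x y
  proof -
    obtain a0 a1 b0 b1 where w: "wings x = {a0, a1}" "wings y = {b0, b1}"
      "f a0 < f b0" "f b0 < f a1" "f a1 < f b1"
      using c unfolding crosses_def before_iff_key[OF f] by blast
    then have "a0 \<noteq> b0" "a0 \<noteq> b1" "a1 \<noteq> b0" "a1 \<noteq> b1" by auto
    with w show ?thesis by auto
  qed
  then show ?thesis unfolding noncrossing_def by metis
qed

lemma crease_precedence_iff:
  fixes f :: "face \<Rightarrow> int"
  assumes "sorted_wrt (\<lambda>x y. f x < f y) xs"
    and "wings x = {p, q}" "light_up p" "\<not> light_up q" "p \<in> set xs" "q \<in> set xs"
  shows "(\<forall>g\<in>wings x. \<forall>h\<in>wings x. light_up g \<and> \<not> light_up h \<longrightarrow>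
            (case assigned P x of M \<Rightarrow> before xs g h | V \<Rightarrow> before xs h g)) \<longleftrightarrow>
         precede (assigned P x) (f p) (f q)"
  unfolding assms(2) precede_def using assms(3-)
  by (cases "assigned P x") (simp_all add: before_iff_key[OF assms(1)])

lemma order_valid_iff_keys:
  fixes f :: "face \<Rightarrow> int"
  assumes f: "sorted_wrt (\<lambda>x y. f x < f y) xs" and xs: "set xs = faces k"
  shows "order_valid P k xs \<longleftrightarrow>
    keys_precedence P k (f \<circ> Ao) (f \<circ> Ae) (f \<circ> Bo) (f \<circ> Be) \<and>
    keys_noncrossing k (f \<circ> Ao) (f \<circ> Ae) (f \<circ> Bo) (f \<circ> Be)"
proof -
  have fc: "t \<in> {1..k} \<Longrightarrow> Ao t \<in> set xs" "t \<in> {1..k} \<Longrightarrow> Ae t \<in> set xs"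
    "t \<in> {1..k} \<Longrightarrow> Bo t \<in> set xs" "t \<in> {1..k} \<Longrightarrow> Be t \<in> set xs"
    "t \<in> {1..<k} \<Longrightarrow> Ao t \<in> set xs" "t \<in> {1..<k} \<Longrightarrow> Ae t \<in> set xs"
    "t \<in> {1..<k} \<Longrightarrow> Bo t \<in> set xs" "t \<in> {1..<k} \<Longrightarrow> Be t \<in> set xs"
    "t \<in> {1..<k} \<Longrightarrow> Ao (Suc t) \<in> set xs" "t \<in> {1..<k} \<Longrightarrow> Bo (Suc t) \<in> set xs" for t
    unfolding xs by (simp_all add: face_in_faces)
  have par: "1 \<le> t \<Longrightarrow> assigned P (CrH (2*t-1)) = word_h P 0"
    "1 \<le> t \<Longrightarrow> assigned P (CrU (2*t-1)) = word_u P 0"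
    "1 \<le> t \<Longrightarrow> assigned P (CrL (2*t-1)) = word_l P 0"
    "1 \<le> t \<Longrightarrow> assigned P (CrH (2*t)) = word_h P 1"
    "1 \<le> t \<Longrightarrow> assigned P (CrU (2*t)) = word_u P 1"
    "1 \<le> t \<Longrightarrow> assigned P (CrL (2*t)) = word_l P 1" for t
    by (cases t; simp)+
  have swap: "{x, y} = {y, x}" for x y :: face by auto
  have d: "distinct xs" using sorted_key_inj f by blast
  note cp = crease_precedence_iff[OF f]
  let ?ok = "\<lambda>x. \<forall>g\<in>wings x. \<forall>h\<in>wings x. light_up g \<and> \<not> light_up h \<longrightarrow>
    (case assigned P x of M \<Rightarrow> before xs g h | V \<Rightarrow> before xs h g)"
  have H0: "(\<forall>t\<in>{1..k}. ?ok (CrH (2*t-1))) \<longleftrightarrow>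
     (\<forall>t\<in>{1..k}. precede (word_h P 0) (f (Ao t)) (f (Bo t)))"
    by (rule ball_cong[OF refl], subst cp[OF wings_seq(1)])
      (use par fc in \<open>auto simp: light_up_seq simp del: assigned.simps\<close>)
  have H1: "(\<forall>t\<in>{1..k}. ?ok (CrH (2*t))) \<longleftrightarrow>
     (\<forall>t\<in>{1..k}. precede (word_h P 1) (f (Be t)) (f (Ae t)))"
    by (rule ball_cong[OF refl], subst cp[OF wings_seq(2)[unfolded swap[of "Ae _"]]])
      (use par fc in \<open>auto simp: light_up_seq simp del: assigned.simps\<close>)
  have U0: "(\<forall>t\<in>{1..k}. ?ok (CrU (2*t-1))) \<longleftrightarrow>
     (\<forall>t\<in>{1..k}. precede (word_u P 0) (f (Ao t)) (f (Ae t)))"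
    by (rule ball_cong[OF refl], subst cp[OF wings_seq(3)])
      (use par fc in \<open>auto simp: light_up_seq simp del: assigned.simps\<close>)
  have U1: "(\<forall>t\<in>{1..<k}. ?ok (CrU (2*t))) \<longleftrightarrow>
     (\<forall>t\<in>{1..<k}. precede (word_u P 1) (f (Ao (Suc t))) (f (Ae t)))"
    by (rule ball_cong[OF refl], subst cp[OF wings_seq(4)])
      (use par fc in \<open>auto simp: light_up_seq simp del: assigned.simps\<close>)
  have L0: "(\<forall>t\<in>{1..k}. ?ok (CrL (2*t-1))) \<longleftrightarrow>
     (\<forall>t\<in>{1..k}. precede (word_l P 0) (f (Be t)) (f (Bo t)))"
    by (rule ball_cong[OF refl], subst cp[OF wings_seq(5)[unfolded swap[of "Bo _"]]])
      (use par fc in \<open>auto simp: light_up_seq simp del: assigned.simps\<close>)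
  have L1: "(\<forall>t\<in>{1..<k}. ?ok (CrL (2*t))) \<longleftrightarrow>
     (\<forall>t\<in>{1..<k}. precede (word_l P 1) (f (Be t)) (f (Bo (Suc t))))"
    by (rule ball_cong[OF refl], subst cp[OF wings_seq(6)[unfolded swap[of "Bo _"]]])
      (use par fc in \<open>auto simp: light_up_seq simp del: assigned.simps\<close>)
  have "precedence P k xs \<longleftrightarrow> keys_precedence P k (f \<circ> Ao) (f \<circ> Ae) (f \<circ> Bo) (f \<circ> Be)"
    unfolding precedence_def all_creases H0 H1 U0 U1 L0 L1 keys_precedence_def comp_def by blast
  moreover have "noncrossing k xs \<longleftrightarrow> keys_noncrossing k (f \<circ> Ao) (f \<circ> Ae) (f \<circ> Bo) (f \<circ> Be)"
  proof -
    \<comment> \<open>One fixed order of the two wings of every crease: the odd column first on U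
      and L, the upper face first on H. This produces exactly the arcs listed in
      \<open>keys_noncrossing\<close>.\<close>
    define w1 where "w1 = rec_crease FaceA (\<lambda>i. if odd i then FaceA i else FaceA (i + 1))
      (\<lambda>i. if odd i then FaceB i else FaceB (i + 1))"
    define w2 where "w2 = rec_crease FaceB (\<lambda>i. if odd i then FaceA (i + 1) else FaceA i)
      (\<lambda>i. if odd i then FaceB (i + 1) else FaceB i)"
    have w: "wings x = {w1 x, w2 x}" for x
      by (cases x) (auto simp: w1_def w2_def)
    have "wings x \<subseteq> set xs" if "x \<in> creases k" for x
      using that unfolding xs by (auto simp: creases_def faces_def)
    then have "crosses xs x y \<longleftrightarrow> cross (f (w1 x)) (f (w2 x)) (f (w1 y)) (f (w2 y))"
      if "x \<in> creases k" "y \<in> creases k" for x y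
      using that w by (intro crosses_iff_cross[OF f]) auto
    then have eq: "noncrossing k xs \<longleftrightarrow> (\<forall>x\<in>creases k. \<forall>y\<in>creases k. target x = target y \<longrightarrow>
        \<not> cross (f (w1 x)) (f (w2 x)) (f (w1 y)) (f (w2 y)))"
      unfolding noncrossing_iff[OF d] by blast
    have tg: "target (CrU (2*t)) = Class_W" "target (CrL (2*t)) = Class_W"
      "t \<in> {1..k} \<Longrightarrow> target (CrU (2*t-1)) = Class_E"
      "t \<in> {1..k} \<Longrightarrow> target (CrL (2*t-1)) = Class_E" for t
      by auto
    have w1: "w1 (CrH (2*t-1)) = Ao t" "w1 (CrH (2*t)) = Ae t"
      "t \<in> {1..k} \<Longrightarrow> w1 (CrU (2*t-1)) = Ao t" "w1 (CrU (2*t)) = Ao (Suc t)"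
      "t \<in> {1..k} \<Longrightarrow> w1 (CrL (2*t-1)) = Bo t" "w1 (CrL (2*t)) = Bo (Suc t)" for t
      by (auto simp: w1_def Ao_def Ae_def Bo_def Be_def)
    have w2: "w2 (CrH (2*t-1)) = Bo t" "w2 (CrH (2*t)) = Be t"
      "t \<in> {1..k} \<Longrightarrow> w2 (CrU (2*t-1)) = Ae t" "w2 (CrU (2*t)) = Ae t"
      "t \<in> {1..k} \<Longrightarrow> w2 (CrL (2*t-1)) = Be t" "w2 (CrL (2*t)) = Be t" for t
      by (auto simp: w2_def Ao_def Ae_def Bo_def Be_def)
    show ?thesis
      unfolding eq all_creases keys_noncrossing_def arcs_noncrossing_def comp_def
      by (simp add: tg w1 w2 ball_conj_distrib
           del: One_nat_def atLeastAtMost_iff atLeastLessThan_iff target.simps(2,3) cong: ball_cong)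
        (simp only: conj_ac)
  qed
  ultimately show ?thesis using d xs by (simp add: order_valid_def total_order_of_faces_def)
qed

section \<open>Noncrossing orders of a single row\<close>

text \<open>The pivot word \<open>W\<^sub>p\<close> lists the columns by increasing rank, where \<open>O\<^sub>t\<close> has rank \<open>rank_o k p t\<close> and
  \<open>D\<^sub>t\<close> has rank \<open>rank_e k p t\<close>; the multiples of \<open>k\<close> only keep the blocks of \<open>W\<^sub>p\<close> apart.\<close>

definition rank_o :: "nat \<Rightarrow> nat \<Rightarrow> nat \<Rightarrow> int" where
  "rank_o k p t = (if t \<le> (p + 1) div 2 then - int t else if odd p then int t else int t - 8 * int k)"

definition rank_e :: "nat \<Rightarrow> nat \<Rightarrow> nat \<Rightarrow> int" where
  "rank_e k p t =
     (if odd p then (if t < (p + 1) div 2 then int t else 4 * int k - int t)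
      else if t \<le> (p + 1) div 2 then int t else - 2 * int k - int t)"

lemma rank_odd:
  assumes "1 \<le> s"
  shows "rank_o k (2*s-1) t = (if t \<le> s then - int t else int t)"
    "rank_e k (2*s-1) t = (if t < s then int t else 4 * int k - int t)"
  using assms by (auto simp: rank_o_def rank_e_def)

lemma rank_even:
  "rank_o k (2*s) t = (if t \<le> s then - int t else int t - 8 * int k)"
  "rank_e k (2*s) t = (if t \<le> s then int t else - 2 * int k - int t)"
  by (auto simp: rank_o_def rank_e_def)

text \<open>Implications are what induction and explicit keys deliver;
  \<open>row_pattern_iff\<close> later turns them into equivalences. \<open>x\<close> belongs to the
  O columns and \<open>y\<close> to the D columns of an arbitrary row, so negated keys are covered
  as well.\<close>

definition row_pattern :: "nat \<Rightarrow> nat \<Rightarrow> (nat \<Rightarrow> int) \<Rightarrow> (nat \<Rightarrow> int) \<Rightarrow> bool" where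
  "row_pattern k p x y \<longleftrightarrow> (\<forall>t\<in>{1..k}. \<forall>u\<in>{1..k}.
     (rank_o k p t < rank_o k p u \<longrightarrow> x t < x u) \<and>
     (rank_o k p t < rank_e k p u \<longrightarrow> x t < y u) \<and>
     (rank_e k p t < rank_o k p u \<longrightarrow> y t < x u) \<and>
     (rank_e k p t < rank_e k p u \<longrightarrow> y t < y u))"

definition row_distinct :: "nat \<Rightarrow> (nat \<Rightarrow> int) \<Rightarrow> (nat \<Rightarrow> int) \<Rightarrow> bool" where
  "row_distinct k x y \<longleftrightarrow> inj_on x {1..k} \<and> inj_on y {1..k} \<and> (\<forall>t\<in>{1..k}. \<forall>u\<in>{1..k}. x t \<noteq> y u)"

text \<open>The constraints of one row with O above D; the two arc families are its class E and
  class W creases.\<close>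

definition row_valid :: "nat \<Rightarrow> (nat \<Rightarrow> int) \<Rightarrow> (nat \<Rightarrow> int) \<Rightarrow> bool" where
  "row_valid k x y \<longleftrightarrow> (\<forall>t\<in>{1..k}. x t < y t) \<and> (\<forall>t\<in>{1..<k}. x (Suc t) < y t) \<and>
     arcs_noncrossing {1..k} x y x y \<and> arcs_noncrossing {1..<k} (x \<circ> Suc) y (x \<circ> Suc) y"

lemma cross_ordered: "p < q \<Longrightarrow> r < s \<Longrightarrow> cross p q r s \<longleftrightarrow> p < r \<and> r < q \<and> q < s"
  by (auto simp: cross_def)

text \<open>For p \<le> 2k-2 the columns O_k and D_k are neighbours in W_p, and the word for k+1
  arises by inserting O_(k+1) D_(k+1) between them.\<close>

lemma row_pattern_Suc:
  assumes pat: "row_pattern k p x y" and p: "1 \<le> p" "p \<le> 2*k - 2"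
    and o: "x k < x (Suc k)" "x (Suc k) < y (Suc k)" "y (Suc k) < y k"
  shows "row_pattern (Suc k) p x y"
proof -
  have k: "k \<in> {1..k}" using p by auto
  have IH: "rank_o k p t < rank_o k p u \<Longrightarrow> x t < x u" "rank_o k p t < rank_e k p u \<Longrightarrow> x t < y u"
     "rank_e k p t < rank_o k p u \<Longrightarrow> y t < x u" "rank_e k p t < rank_e k p u \<Longrightarrow> y t < y u"
    if "t \<in> {1..k}" "u \<in> {1..k}" for t u
    using pat that by (auto simp: row_pattern_def)
  define s where "s = (p + 1) div 2"
  have s: "1 \<le> s" "s < k" using p by (auto simp: s_def)
  note rk = rank_o_def rank_e_def s_def[symmetric]
  \<comment> \<open>The ranks contain multiples of k and change with it, but their order on the old
    columns does not.\<close>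
  have old: "rank_o (Suc k) p t < rank_o (Suc k) p u \<longleftrightarrow> rank_o k p t < rank_o k p u"
     "rank_o (Suc k) p t < rank_e (Suc k) p u \<longleftrightarrow> rank_o k p t < rank_e k p u"
     "rank_e (Suc k) p t < rank_o (Suc k) p u \<longleftrightarrow> rank_e k p t < rank_o k p u"
     "rank_e (Suc k) p t < rank_e (Suc k) p u \<longleftrightarrow> rank_e k p t < rank_e k p u"
    if "t \<in> {1..k}" "u \<in> {1..k}" for t u
    using that s unfolding rk by (cases "odd p"; cases "t < s"; cases "t = s"; cases "u < s"; cases "u = s"; simp)+
  \<comment> \<open>The new pair sits directly after O_k and directly before D_k, so every
    comparison with it is reduced to one with O_k or D_k.\<close>
  have new: "rank_o (Suc k) p t < rank_o (Suc k) p (Suc k) \<Longrightarrow> t = k \<or> rank_o k p t < rank_o k p k"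
    "rank_o (Suc k) p t < rank_e (Suc k) p (Suc k) \<Longrightarrow> t = k \<or> rank_o k p t < rank_o k p k"
    "rank_e (Suc k) p t < rank_o (Suc k) p (Suc k) \<Longrightarrow> rank_e k p t < rank_o k p k"
    "rank_e (Suc k) p t < rank_e (Suc k) p (Suc k) \<Longrightarrow> rank_e k p t < rank_o k p k"
    "rank_o (Suc k) p (Suc k) < rank_o (Suc k) p t \<Longrightarrow> rank_e k p k < rank_o k p t"
    "rank_e (Suc k) p (Suc k) < rank_o (Suc k) p t \<Longrightarrow> rank_e k p k < rank_o k p t"
    "rank_o (Suc k) p (Suc k) < rank_e (Suc k) p t \<Longrightarrow> t = k \<or> rank_e k p k < rank_e k p t"
    "rank_e (Suc k) p (Suc k) < rank_e (Suc k) p t \<Longrightarrow> t = k \<or> rank_e k p k < rank_e k p t"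
    if "t \<in> {1..k}" for t
    using that s unfolding rk by (cases "odd p"; cases "t < s"; cases "t = s"; cases "t = k"; force)+
  have new': "\<not> rank_e (Suc k) p (Suc k) < rank_o (Suc k) p (Suc k)"
    using s unfolding rk by (cases "odd p") auto
  have nt: "(rank_o (Suc k) p t < rank_o (Suc k) p (Suc k) \<longrightarrow> x t < x (Suc k)) \<and>
     (rank_o (Suc k) p t < rank_e (Suc k) p (Suc k) \<longrightarrow> x t < y (Suc k)) \<and>
     (rank_e (Suc k) p t < rank_o (Suc k) p (Suc k) \<longrightarrow> y t < x (Suc k)) \<and>
     (rank_e (Suc k) p t < rank_e (Suc k) p (Suc k) \<longrightarrow> y t < y (Suc k)) \<and>
     (rank_o (Suc k) p (Suc k) < rank_o (Suc k) p t \<longrightarrow> x (Suc k) < x t) \<and>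
     (rank_e (Suc k) p (Suc k) < rank_o (Suc k) p t \<longrightarrow> y (Suc k) < x t) \<and>
     (rank_o (Suc k) p (Suc k) < rank_e (Suc k) p t \<longrightarrow> x (Suc k) < y t) \<and>
     (rank_e (Suc k) p (Suc k) < rank_e (Suc k) p t \<longrightarrow> y (Suc k) < y t)" if "t \<in> {1..k}" for t
  proof -
    have a: "t = k \<or> rank_o k p t < rank_o k p k \<Longrightarrow> x t \<le> x k"
      using IH(1)[OF that k] by auto
    have b: "rank_e k p t < rank_o k p k \<Longrightarrow> y t \<le> x k"
      using IH(3)[OF that k] by auto
    have c: "rank_e k p k < rank_o k p t \<Longrightarrow> y k \<le> x t"
      using IH(3)[OF k that] by auto
    have d: "t = k \<or> rank_e k p k < rank_e k p t \<Longrightarrow> y k \<le> y t"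
      using IH(4)[OF k that] by auto
    show ?thesis
      by (intro conjI impI; drule new[OF that]; (drule a | drule b | drule c | drule d); use o in linarith)
  qed
  show ?thesis unfolding row_pattern_def
  proof (intro ballI)
    fix t u assume "t \<in> {1..Suc k}" "u \<in> {1..Suc k}"
    then consider "t \<in> {1..k}" "u \<in> {1..k}" | "t = Suc k" "u \<in> {1..k}"
      | "t \<in> {1..k}" "u = Suc k" | "t = Suc k" "u = Suc k"
      by force
    then show "(rank_o (Suc k) p t < rank_o (Suc k) p u \<longrightarrow> x t < x u) \<and>
      (rank_o (Suc k) p t < rank_e (Suc k) p u \<longrightarrow> x t < y u) \<and>
      (rank_e (Suc k) p t < rank_o (Suc k) p u \<longrightarrow> y t < x u) \<and>
      (rank_e (Suc k) p t < rank_e (Suc k) p u \<longrightarrow> y t < y u)"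
    proof cases
      case 1
      then show ?thesis using IH[of t u] old[of t u] by blast
    next
      case 2
      then show ?thesis using nt[of u] by blast
    next
      case 3
      then show ?thesis using nt[of t] by blast
    next
      case 4
      then show ?thesis using new' o(2) by simp
    qed
  qed
qed

text \<open>Unless \<open>O\<^sub>k\<close>, \<open>D\<^sub>k\<close> are the outermost columns (\<open>p = 2k-1\<close>), the arcs force \<open>O\<^bsub>k+1\<^esub>\<close>, \<open>D\<^bsub>k+1\<^esub>\<close> to lie
  between them, which keeps \<open>p\<close>; in the outermost case there are three extensions,
  \<open>p = 2k-1, 2k, 2k+1\<close>.\<close>

lemma row_valid_imp_pattern:
  assumes "1 \<le> k" "row_distinct k x y" "row_valid k x y"
  shows "\<exists>p\<in>{1..2*k-1}. row_pattern k p x y"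
  using assms
proof (induction k rule: nat_induct_at_least)
  case base
  then show ?case
    by (intro bexI[of _ 1]) (auto simp: row_pattern_def rank_o_def rank_e_def row_valid_def)
next
  case (Suc k)
  have "{1..k} \<subseteq> {1..Suc k}" "{1..<k} \<subseteq> {1..<Suc k}" by auto
  then have "row_distinct k x y" "row_valid k x y" using Suc.prems
    unfolding row_distinct_def row_valid_def arcs_noncrossing_def by (blast intro: inj_on_subset)+
  then obtain p where p: "1 \<le> p" "p \<le> 2*k-1" "row_pattern k p x y" using Suc.IH by auto
  have E: "\<not> (x t < x u \<and> x u < y t \<and> y t < y u)" if "t \<in> {1..Suc k}" "u \<in> {1..Suc k}" for t u
  proof -
    have "x t < y t" "x u < y u" "\<not> cross (x t) (y t) (x u) (y u)"
      using Suc.prems that by (auto simp: row_valid_def arcs_noncrossing_def)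
    then show ?thesis by (simp add: cross_ordered)
  qed
  have W: "\<not> (x (Suc t) < x (Suc u) \<and> x (Suc u) < y t \<and> y t < y u)" if "t \<in> {1..k}" "u \<in> {1..k}" for t u
  proof -
    have "x (Suc t) < y t" "x (Suc u) < y u" "\<not> cross (x (Suc t)) (y t) (x (Suc u)) (y u)"
      using Suc.prems that by (auto simp: row_valid_def arcs_noncrossing_def)
    then show ?thesis by (simp add: cross_ordered)
  qed
  have ord: "x k < y k" "x (Suc k) < y (Suc k)" "x (Suc k) < y k"
    using Suc.prems Suc.hyps by (auto simp: row_valid_def)
  have ne: "x k \<noteq> x (Suc k)" "y k \<noteq> y (Suc k)" "x k \<noteq> y (Suc k)"
     "t \<in> {1..k} \<Longrightarrow> y t \<noteq> x (Suc k)"  "t \<in> {1..k} \<Longrightarrow> x t \<noteq> x (Suc k)" for t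
  proof -
    have "inj_on x {1..Suc k}" "inj_on y {1..Suc k}"
      "\<And>t u. t \<in> {1..Suc k} \<Longrightarrow> u \<in> {1..Suc k} \<Longrightarrow> x t \<noteq> y u"
      using Suc.prems(1) by (auto simp: row_distinct_def)
    note d = this(1,2)[THEN inj_on_eq_iff] this(3)
    show "x k \<noteq> x (Suc k)" "y k \<noteq> y (Suc k)" "x k \<noteq> y (Suc k)"
      using d(1)[of k "Suc k"] d(2)[of k "Suc k"] d(3)[of k "Suc k"] Suc.hyps by auto
    show "t \<in> {1..k} \<Longrightarrow> y t \<noteq> x (Suc k)"  "t \<in> {1..k} \<Longrightarrow> x t \<noteq> x (Suc k)"
      using d(1)[of t "Suc k"] d(3)[of "Suc k" t] by auto
  qed
  have IH: "rank_o k p t < rank_o k p u \<Longrightarrow> x t < x u" "rank_o k p t < rank_e k p u \<Longrightarrow> x t < y u"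
     "rank_e k p t < rank_o k p u \<Longrightarrow> y t < x u" "rank_e k p t < rank_e k p u \<Longrightarrow> y t < y u"
    if "t \<in> {1..k}" "u \<in> {1..k}" for t u
    using p that by (auto simp: row_pattern_def)
  show ?case
  proof (cases "p \<le> 2*k-2")
    case True
    with p(1) have k: "k - 1 \<in> {1..k}" "k \<in> {1..k}" by auto
    \<comment> \<open>D_k precedes D_(k-1) here. If O_(k+1) came before O_k, the class W arcs
      O_(k+1) D_k and O_k D_(k-1) would cross; with O_k first, the class E arcs of k and k+1 must
      nest.\<close>
    have "rank_e k p k < rank_e k p (k-1)"
    proof -
      have "1 \<le> (p + 1) div 2" "(p + 1) div 2 \<le> k - 1" using p True by linarith+
      then show ?thesis using k unfolding rank_e_def by (cases "odd p"; cases "(p + 1) div 2 = k - 1") auto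
    qed
    then have "y k < y (k-1)" using IH k by blast
    then have "x k < x (Suc k)" using W[of k "k-1"] k ord ne by fastforce
    moreover have "y (Suc k) < y k" using E[of k "Suc k"] calculation ord ne Suc.hyps by fastforce
    ultimately have "row_pattern (Suc k) p x y" using row_pattern_Suc p True ord by blast
    then show ?thesis using p by (intro bexI[of _ p]) auto
  next
    case False
    then have p2k: "p = 2 * k - 1" using p by linarith
    note rk = rank_odd[OF Suc.hyps, of k, folded p2k]
    have k: "k \<in> {1..k}" using Suc.hyps by auto
    have lo: "x k \<le> x t" "x k < y t" "y t \<le> y k" "x t < y k" if "t \<in> {1..k}" for t
      using IH[OF k that] IH[OF that k] that unfolding rk by (cases "t = k"; force)+
    \<comment> \<open>\<open>a\<close> gives p = 2k, \<open>b\<close> gives p = 2k+1,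
      \<open>c\<close> keeps p = 2k-1. With O_(k+1) before O_k, a D_(k+1) between O_k and D_k would
      make two class E arcs cross.\<close>
    consider (a) "x (Suc k) < x k" "y (Suc k) < x k" | (b) "x (Suc k) < x k" "y k < y (Suc k)"
      | (c) "x k < x (Suc k)"
      using E[of "Suc k" k] ord ne Suc.hyps by fastforce
    then show ?thesis
    proof cases
      case a
      have "row_pattern (Suc k) (2*k) x y" unfolding row_pattern_def
      proof (intro ballI)
        fix t u assume "t \<in> {1..Suc k}" "u \<in> {1..Suc k}"
        then consider "t \<in> {1..k}" "u \<in> {1..k}" | "t = Suc k" "u \<in> {1..k}" | "t \<in> {1..k}" "u = Suc k" | "t = Suc k" "u = Suc k"
          by force
        then show "(rank_o (Suc k) (2*k) t < rank_o (Suc k) (2*k) u \<longrightarrow> x t < x u) \<and>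
         (rank_o (Suc k) (2*k) t < rank_e (Suc k) (2*k) u \<longrightarrow> x t < y u) \<and>
         (rank_e (Suc k) (2*k) t < rank_o (Suc k) (2*k) u \<longrightarrow> y t < x u) \<and>
         (rank_e (Suc k) (2*k) t < rank_e (Suc k) (2*k) u \<longrightarrow> y t < y u)"
          using IH[of t u] lo[of t] lo[of u] a ord unfolding rank_even rk
          by cases (auto split: if_splits)
      qed
      then show ?thesis using Suc.hyps by (intro bexI[of _ "2*k"]) auto
    next
      case b
      have one: "1 \<le> Suc k" by simp
      have "row_pattern (Suc k) (2*Suc k-1) x y" unfolding row_pattern_def
      proof (intro ballI)
        fix t u assume "t \<in> {1..Suc k}" "u \<in> {1..Suc k}"
        then consider "t \<in> {1..k}" "u \<in> {1..k}" | "t = Suc k" "u \<in> {1..k}" | "t \<in> {1..k}" "u = Suc k" | "t = Suc k" "u = Suc k"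
          by force
        then show "(rank_o (Suc k) (2*Suc k-1) t < rank_o (Suc k) (2*Suc k-1) u \<longrightarrow> x t < x u) \<and>
         (rank_o (Suc k) (2*Suc k-1) t < rank_e (Suc k) (2*Suc k-1) u \<longrightarrow> x t < y u) \<and>
         (rank_e (Suc k) (2*Suc k-1) t < rank_o (Suc k) (2*Suc k-1) u \<longrightarrow> y t < x u) \<and>
         (rank_e (Suc k) (2*Suc k-1) t < rank_e (Suc k) (2*Suc k-1) u \<longrightarrow> y t < y u)"
          using IH[of t u] lo[of t] lo[of u] b ord unfolding rank_odd[OF one] rk
          by cases (auto split: if_splits)
      qed
      then show ?thesis using Suc.hyps by (intro bexI[of _ "2*Suc k-1"]) auto
    next
      case c
      have Y: "y (Suc k) < y k" using E[of k "Suc k"] ord ne Suc.hyps c by fastforce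
      \<comment> \<open>Among the columns O_t, D_t with t < k the last is D_(k-1); if O_(k+1) came
        before it, the class W arcs O_k D_(k-1) and O_(k+1) D_k would cross.\<close>
      have X: "t = k \<or> y t < x (Suc k) \<and> x t < x (Suc k)" if "t \<in> {1..k}" for t
      proof (cases "t = k")
        case False
        then have t: "t \<in> {1..k}" "t \<in> {1..<k}" "k - 1 \<in> {1..k}" "Suc (k - 1) = k" using that by auto
        then have "t \<noteq> k - 1 \<Longrightarrow> int t < int k - 1" by auto
        with t have "y t \<le> y (k - 1)" using IH[of t "k-1"] unfolding rk
          by (cases "t = k - 1") (auto simp: of_nat_diff)
        moreover have "y (k - 1) < y k" "x t < y t"
          using IH[of "k-1" k] IH[of t t] t unfolding rk by auto
        moreover have "\<not> x (Suc k) < y (k - 1)"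
          using W[of "k-1" k] t c ord calculation k by auto
        ultimately show ?thesis using ne(4)[OF t(3)] by auto
      qed auto
      have "row_pattern (Suc k) (2*k-1) x y" unfolding row_pattern_def
      proof (intro ballI)
        fix t u assume "t \<in> {1..Suc k}" "u \<in> {1..Suc k}"
        then consider "t \<in> {1..k}" "u \<in> {1..k}" | "t = Suc k" "u \<in> {1..k}" | "t \<in> {1..k}" "u = Suc k" | "t = Suc k" "u = Suc k"
          by force
        then show "(rank_o (Suc k) (2*k-1) t < rank_o (Suc k) (2*k-1) u \<longrightarrow> x t < x u) \<and>
         (rank_o (Suc k) (2*k-1) t < rank_e (Suc k) (2*k-1) u \<longrightarrow> x t < y u) \<and>
         (rank_e (Suc k) (2*k-1) t < rank_o (Suc k) (2*k-1) u \<longrightarrow> y t < x u) \<and>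
         (rank_e (Suc k) (2*k-1) t < rank_e (Suc k) (2*k-1) u \<longrightarrow> y t < y u)"
          using IH[of t u] lo[of t] lo[of u] X[of t] X[of u] c Y ord unfolding rank_odd[OF Suc.hyps] rk
          by cases (auto split: if_splits)
      qed
      then show ?thesis using Suc.hyps by (intro bexI[of _ "2*k-1"]) auto
    qed
  qed
qed

lemma rank_distinct:
  assumes "1 \<le> p" "p \<le> 2*k-1" "t \<in> {1..k}" "u \<in> {1..k}"
  shows "rank_o k p t = rank_o k p u \<longleftrightarrow> t = u" "rank_e k p t = rank_e k p u \<longleftrightarrow> t = u"
    "rank_o k p t \<noteq> rank_e k p u"
proof -
  define s where "s = (p + 1) div 2"
  have s: "1 \<le> s" "s \<le> k" using assms by (auto simp: s_def)
  note rk = rank_o_def rank_e_def s_def[symmetric]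
  have "rank_o k p t = rank_o k p u \<Longrightarrow> t = u" "rank_e k p t = rank_e k p u \<Longrightarrow> t = u"
    "rank_o k p t = rank_e k p u \<Longrightarrow> False"
    using s assms(3,4) unfolding rk by (auto split: if_splits)
  then show "rank_o k p t = rank_o k p u \<longleftrightarrow> t = u" "rank_e k p t = rank_e k p u \<longleftrightarrow> t = u"
    "rank_o k p t \<noteq> rank_e k p u"
    by blast+
qed

lemma row_pattern_iff:
  assumes p: "p \<in> {1..2*k-1}" and pat: "row_pattern k p x y" and tu: "t \<in> {1..k}" "u \<in> {1..k}"
  shows "x t < x u \<longleftrightarrow> rank_o k p t < rank_o k p u" "x t < y u \<longleftrightarrow> rank_o k p t < rank_e k p u"
    "y t < x u \<longleftrightarrow> rank_e k p t < rank_o k p u" "y t < y u \<longleftrightarrow> rank_e k p t < rank_e k p u"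
    "x t \<le> x u \<longleftrightarrow> rank_o k p t \<le> rank_o k p u" "x t \<le> y u \<longleftrightarrow> rank_o k p t \<le> rank_e k p u"
    "y t \<le> x u \<longleftrightarrow> rank_e k p t \<le> rank_o k p u" "y t \<le> y u \<longleftrightarrow> rank_e k p t \<le> rank_e k p u"
proof -
  have p': "1 \<le> p" "p \<le> 2*k-1" using p by auto
  note rd = rank_distinct[OF p']
  have IH: "rank_o k p t < rank_o k p u \<Longrightarrow> x t < x u" "rank_o k p t < rank_e k p u \<Longrightarrow> x t < y u"
     "rank_e k p t < rank_o k p u \<Longrightarrow> y t < x u" "rank_e k p t < rank_e k p u \<Longrightarrow> y t < y u"
    if "t \<in> {1..k}" "u \<in> {1..k}" for t u
    using pat that by (auto simp: row_pattern_def)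
  note I = IH[OF tu] IH[OF tu(2) tu(1)] and R = rd[OF tu] rd(3)[OF tu(2) tu(1)]
  show "x t < x u \<longleftrightarrow> rank_o k p t < rank_o k p u"
    using I(1,5) R(1) by (cases "t = u"; cases "rank_o k p t < rank_o k p u") auto
  show "x t < y u \<longleftrightarrow> rank_o k p t < rank_e k p u"
    using I(2,7) R(3) by linarith
  show "y t < x u \<longleftrightarrow> rank_e k p t < rank_o k p u"
    using I(3,6) R(4) by linarith
  show "y t < y u \<longleftrightarrow> rank_e k p t < rank_e k p u"
    using I(4,8) R(2) by (cases "t = u"; cases "rank_e k p t < rank_e k p u") auto
  show "x t \<le> x u \<longleftrightarrow> rank_o k p t \<le> rank_o k p u"
    using I(1,5) R(1) by (cases "t = u"; cases "rank_o k p t < rank_o k p u") auto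
  show "x t \<le> y u \<longleftrightarrow> rank_o k p t \<le> rank_e k p u"
    using I(2,7) R(3) by linarith
  show "y t \<le> x u \<longleftrightarrow> rank_e k p t \<le> rank_o k p u"
    using I(3,6) R(4) by linarith
  show "y t \<le> y u \<longleftrightarrow> rank_e k p t \<le> rank_e k p u"
    using I(4,8) R(2) by (cases "t = u"; cases "rank_e k p t < rank_e k p u") auto
qed

section \<open>Which pivot pairs occur\<close>

definition keys_distinct ::
  "nat \<Rightarrow> (nat \<Rightarrow> int) \<Rightarrow> (nat \<Rightarrow> int) \<Rightarrow> (nat \<Rightarrow> int) \<Rightarrow> (nat \<Rightarrow> int) \<Rightarrow> bool" where
  "keys_distinct k a a' b b' \<longleftrightarrow> row_distinct k a a' \<and> row_distinct k b b' \<and>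
     (\<forall>t\<in>{1..k}. \<forall>u\<in>{1..k}. a t \<noteq> b u \<and> a t \<noteq> b' u \<and> a' t \<noteq> b u \<and> a' t \<noteq> b' u)"

definition valid_keys ::
  "label_word \<Rightarrow> nat \<Rightarrow> (nat \<Rightarrow> int) \<Rightarrow> (nat \<Rightarrow> int) \<Rightarrow> (nat \<Rightarrow> int) \<Rightarrow> (nat \<Rightarrow> int) \<Rightarrow> bool" where
  "valid_keys P k a a' b b' \<longleftrightarrow> keys_distinct k a a' b b' \<and> keys_precedence P k a a' b b' \<and>
     keys_noncrossing k a a' b b'"

lemma keys_precedence_plus:
  "keys_precedence (M,M,M,M,V,V) k a a' b b' \<longleftrightarrow>
     (\<forall>t\<in>{1..k}. a t < b t \<and> b' t < a' t \<and> a t < a' t \<and> b t < b' t) \<and>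
     (\<forall>t\<in>{1..<k}. a (Suc t) < a' t \<and> b (Suc t) < b' t)"
  by (simp add: keys_precedence_def precede_def)

lemma keys_precedence_minus:
  "keys_precedence (M,V,M,M,M,M) k a a' b b' \<longleftrightarrow>
     (\<forall>t\<in>{1..k}. a t < b t \<and> a' t < b' t \<and> a t < a' t \<and> b' t < b t) \<and>
     (\<forall>t\<in>{1..<k}. a (Suc t) < a' t \<and> b' t < b (Suc t))"
  by (simp add: keys_precedence_def precede_def)

lemma arcs_noncrossingD:
  assumes "arcs_noncrossing I x x' y y'" "t \<in> I" "u \<in> I" "x t < x' t" "y u < y' u"
    "x t < y u" "x' t < y' u"
  shows "x' t \<le> y u"
  using assms cross_ordered[of "x t" "x' t" "y u" "y' u"] by (auto simp: arcs_noncrossing_def)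

text \<open>Reversal exchanges which of two crossing arcs starts first, so the two arcs change
  places.\<close>

lemma cross_neg: "cross (- p) (- q) (- r) (- s) \<longleftrightarrow> cross r s p q"
  unfolding cross_def by linarith

lemma arcs_noncrossing_neg_iff:
  "arcs_noncrossing I (\<lambda>t. - x t) (\<lambda>t. - x' t) (\<lambda>t. - y t) (\<lambda>t. - y' t) \<longleftrightarrow>
    arcs_noncrossing I y y' x x'"
  unfolding arcs_noncrossing_def cross_neg by blast

lemma plus_patterns:
  assumes "1 \<le> k" "valid_keys (M,M,M,M,V,V) k a a' b b'"
  shows "\<exists>\<alpha>\<in>{1..2*k-1}. row_pattern k \<alpha> a a'" "\<exists>\<beta>\<in>{1..2*k-1}. row_pattern k \<beta> b b'"
proof -
  show "\<exists>\<alpha>\<in>{1..2*k-1}. row_pattern k \<alpha> a a'"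
    by (rule row_valid_imp_pattern) (use assms in \<open>auto simp: valid_keys_def keys_distinct_def keys_precedence_plus
       keys_noncrossing_def row_valid_def\<close>)
  show "\<exists>\<beta>\<in>{1..2*k-1}. row_pattern k \<beta> b b'"
    by (rule row_valid_imp_pattern) (use assms in \<open>auto simp: valid_keys_def keys_distinct_def keys_precedence_plus
       keys_noncrossing_def row_valid_def\<close>)
qed

text \<open>The lower row has D above O. Negated keys bring it into the form of
  \<open>row_valid\<close>, so \<beta> refers to the reversed lower word.\<close>

lemma minus_patterns:
  assumes "1 \<le> k" "valid_keys (M,V,M,M,M,M) k a a' b b'"
  shows "\<exists>\<alpha>\<in>{1..2*k-1}. row_pattern k \<alpha> a a'"
    "\<exists>\<beta>\<in>{1..2*k-1}. row_pattern k \<beta> (\<lambda>t. - b t) (\<lambda>t. - b' t)"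
proof -
  show "\<exists>\<alpha>\<in>{1..2*k-1}. row_pattern k \<alpha> a a'"
    by (rule row_valid_imp_pattern) (use assms in \<open>auto simp: valid_keys_def keys_distinct_def keys_precedence_minus
       keys_noncrossing_def row_valid_def\<close>)
  have "row_distinct k b b'"
    using assms(2) by (simp add: valid_keys_def keys_distinct_def)
  then have "row_distinct k (\<lambda>t. - b t) (\<lambda>t. - b' t)"
    unfolding row_distinct_def inj_on_def neg_equal_iff_equal .
  moreover have "row_valid k (\<lambda>t. - b t) (\<lambda>t. - b' t)"
  proof -
    have nc: "arcs_noncrossing {1..k} b b' b b'" "arcs_noncrossing {1..<k} (b \<circ> Suc) b' (b \<circ> Suc) b'"
      and lt: "\<forall>t\<in>{1..k}. b' t < b t" "\<forall>t\<in>{1..<k}. b' t < b (Suc t)"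
      using assms(2) by (simp_all add: valid_keys_def keys_precedence_minus keys_noncrossing_def)
    show ?thesis
      unfolding row_valid_def neg_less_iff_less comp_def
      using lt nc unfolding arcs_noncrossing_neg_iff comp_def by blast
  qed
  ultimately show "\<exists>\<beta>\<in>{1..2*k-1}. row_pattern k \<beta> (\<lambda>t. - b t) (\<lambda>t. - b' t)"
    using assms(1) by (intro row_valid_imp_pattern)
qed

text \<open>An even column above an odd one in the upper row stays so in the lower row, by
  \<^prop>\<open>b' t < a' t\<close> and \<^prop>\<open>a u < b u\<close>; the pairs of this kind determine the pivot.\<close>

lemma plus_pivot_condition:
  assumes k: "k \<ge> 2" and v: "valid_keys (M,M,M,M,V,V) k a a' b b'"
    and \<alpha>: "\<alpha> \<in> {1..2*k-1}" "row_pattern k \<alpha> a a'"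
    and \<beta>: "\<beta> \<in> {1..2*k-1}" "row_pattern k \<beta> b b'"
  shows "\<alpha> = 1 \<or> \<alpha> = 2*k-1 \<or> \<alpha> = \<beta>"
proof (rule ccontr)
  assume c: "\<not> ?thesis"
  have tr: "rank_e k \<beta> t < rank_o k \<beta> u"
    if "t \<in> {1..k}" "u \<in> {1..k}" "rank_e k \<alpha> t < rank_o k \<alpha> u" for t u
  proof -
    have "a' t < a u" using row_pattern_iff(3)[OF \<alpha> that(1,2)] that(3) by simp
    moreover have "b' t < a' t" "a u < b u"
      using v that by (auto simp: valid_keys_def keys_precedence_plus)
    ultimately show ?thesis using row_pattern_iff(3)[OF \<beta> that(1,2)] by simp
  qed
  define s where "s = (\<alpha> + 1) div 2"
  define r where "r = (\<beta> + 1) div 2"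
  note rk = rank_o_def rank_e_def s_def[symmetric] r_def[symmetric]
  show False
  proof (cases "odd \<alpha>")
    case True
    then have e: "\<alpha> = 2 * s - 1" unfolding s_def by presburger
    then have s: "2 \<le> s" "s < k" using c \<alpha>(1) by auto
    \<comment> \<open>D_(s-1) before O_(s+1) occurs in W_(2s-1) and in no other pivot word;
      excluding \<alpha> = 1 and \<alpha> = 2k-1 gives 2 \<le> s < k, so that both columns
      exist.\<close>
    have "rank_e k \<alpha> (s-1) < rank_o k \<alpha> (s+1)" using True s unfolding rk by auto
    moreover have "s - 1 \<in> {1..k}" "s + 1 \<in> {1..k}" using s by auto
    ultimately have *: "rank_e k \<beta> (s-1) < rank_o k \<beta> (s+1)" using tr by blast
    show False
    proof (cases "odd \<beta>")
      case True
      then have "\<beta> = 2 * r - 1" unfolding r_def by presburger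
      moreover have "r = s" using * True s \<beta>(1) unfolding rk by (auto split: if_splits)
      ultimately show False using e c by simp
    next
      case False
      then show False using * s \<beta>(1) unfolding rk by (auto split: if_splits)
    qed
  next
    case False
    then have e: "\<alpha> = 2 * s" unfolding s_def by presburger
    then have s: "1 \<le> s" "s < k" using c \<alpha>(1) by auto
    \<comment> \<open>Likewise D_(s+1) before O_s occurs only in W_(2s).\<close>
    have "rank_e k \<alpha> (s+1) < rank_o k \<alpha> s" using False s unfolding rk by auto
    then have *: "rank_e k \<beta> (s+1) < rank_o k \<beta> s" using tr[of "s+1" "s"] s by auto
    show False
    proof (cases "odd \<beta>")
      case True
      then show False using * s \<beta>(1) unfolding rk by (auto split: if_splits)
    next
      case False
      then have "\<beta> = 2 * r" unfolding r_def by presburger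
      moreover have "r = s" using * False s \<beta>(1) unfolding rk by (auto split: if_splits)
      ultimately show False using e c by simp
    qed
  qed
qed

text \<open>With \<open>s = p div 2\<close>, the columns beyond \<open>D\<^sub>s\<close> occur in \<open>W\<^sub>p\<close> as \<open>O\<^bsub>s+1\<^esub>..O\<^sub>k D\<^sub>k..D\<^bsub>s+1\<^esub>\<close>, those before
  \<open>D\<^bsub>s+1\<^esub>\<close> as \<open>O\<^bsub>s+1\<^esub>..O\<^sub>1 D\<^sub>1..D\<^sub>s\<close>.\<close>

lemma rank_first_column:
  assumes "p \<in> {1..2*k-1}" "s = p div 2"
  shows "s < k"
    "s < t \<Longrightarrow> t < u \<Longrightarrow> u \<le> k \<Longrightarrow> rank_o k p t < rank_o k p u"
    "s < t \<Longrightarrow> t \<le> k \<Longrightarrow> s < u \<Longrightarrow> u \<le> k \<Longrightarrow> rank_o k p t < rank_e k p u"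
    "u < t \<Longrightarrow> t \<le> s + 1 \<Longrightarrow> 1 \<le> u \<Longrightarrow> rank_o k p t < rank_o k p u"
    "1 \<le> t \<Longrightarrow> t \<le> s + 1 \<Longrightarrow> 1 \<le> u \<Longrightarrow> u \<le> s \<Longrightarrow> rank_o k p t < rank_e k p u"
proof -
  have s: "s < k" using assms by auto
  show "s < k" by fact
  have e: "(p + 1) div 2 = (if odd p then s + 1 else s)" using assms(2) by presburger
  show "s < t \<Longrightarrow> t < u \<Longrightarrow> u \<le> k \<Longrightarrow> rank_o k p t < rank_o k p u"
    "s < t \<Longrightarrow> t \<le> k \<Longrightarrow> s < u \<Longrightarrow> u \<le> k \<Longrightarrow> rank_o k p t < rank_e k p u"
    "u < t \<Longrightarrow> t \<le> s + 1 \<Longrightarrow> 1 \<le> u \<Longrightarrow> rank_o k p t < rank_o k p u"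
    "1 \<le> t \<Longrightarrow> t \<le> s + 1 \<Longrightarrow> 1 \<le> u \<Longrightarrow> u \<le> s \<Longrightarrow> rank_o k p t < rank_e k p u"
    using s unfolding rank_o_def rank_e_def e by (cases "odd p"; cases "t = s + 1"; force)+
qed

text \<open>With r = \<alpha> div 2 and s = \<beta> div 2, the first columns of W_\<alpha> and
  W_\<beta> are O_(r+1) and O_(s+1). The lower row is reversed, so the H arc of O_(r+1) both starts
  and ends before that of O_(s+1), and the two must be disjoint. But
  \<open>a (s+1) < a' q < b' q < b (r+1)\<close> for a suitable column D_q.\<close>

lemma minus_pivot_condition:
  assumes v: "valid_keys (M,V,M,M,M,M) k a a' b b'"
    and \<alpha>: "\<alpha> \<in> {1..2*k-1}" "row_pattern k \<alpha> a a'"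
    and \<beta>: "\<beta> \<in> {1..2*k-1}" "row_pattern k \<beta> (\<lambda>t. - b t) (\<lambda>t. - b' t)"
  shows "\<alpha> div 2 = \<beta> div 2"
proof (rule ccontr)
  assume c: "\<not> ?thesis"
  define r s where rs: "r = \<alpha> div 2" "s = \<beta> div 2"
  \<comment> \<open>D_q has to follow O_(s+1) in W_\<alpha> and O_(r+1) in W_\<beta>. This holds if
    q lies between the two block boundaries: r < q \<le> s in the first case, s < q \<le> r in the
    second.\<close>
  define q where "q = (if r < s then s else s + 1)"
  have q: "q \<in> {1..k}" and r1: "r + 1 \<in> {1..k}" and s1: "s + 1 \<in> {1..k}" "r \<noteq> s"
    using rank_first_column(1)[OF \<alpha>(1) rs(1)] rank_first_column(1)[OF \<beta>(1) rs(2)] c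
    by (auto simp: q_def rs)
  have "rank_o k \<alpha> (r+1) < rank_o k \<alpha> (s+1) \<and> rank_o k \<alpha> (s+1) < rank_e k \<alpha> q \<and>
    rank_o k \<beta> (s+1) < rank_o k \<beta> (r+1) \<and> rank_o k \<beta> (r+1) < rank_e k \<beta> q"
  proof (cases "r < s")
    case True
    then show ?thesis
      using rank_first_column(2)[OF \<alpha>(1) rs(1), of "r+1" "s+1"]
        rank_first_column(3)[OF \<alpha>(1) rs(1), of "s+1" s]
        rank_first_column(4)[OF \<beta>(1) rs(2), of "r+1" "s+1"]
        rank_first_column(5)[OF \<beta>(1) rs(2), of "r+1" s] s1 r1
      by (simp add: q_def)
  next
    case False
    with s1 have "s < r" by simp
    then show ?thesis
      using rank_first_column(4)[OF \<alpha>(1) rs(1), of "s+1" "r+1"]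
        rank_first_column(5)[OF \<alpha>(1) rs(1), of "s+1" "s+1"]
        rank_first_column(2)[OF \<beta>(1) rs(2), of "s+1" "r+1"]
        rank_first_column(3)[OF \<beta>(1) rs(2), of "r+1" "s+1"] s1 r1
      by (simp add: q_def)
  qed
  then have "a (r+1) < a (s+1)" "a (s+1) < a' q" "b (r+1) < b (s+1)" "b' q < b (r+1)"
    using row_pattern_iff[OF \<alpha> r1 s1(1)] row_pattern_iff[OF \<alpha> s1(1) q]
      row_pattern_iff[OF \<beta> s1(1) r1] row_pattern_iff[OF \<beta> r1 q] by auto
  moreover have "a' q < b' q" "a (r+1) < b (r+1)" "a (s+1) < b (s+1)"
    using v q r1 s1 unfolding valid_keys_def keys_precedence_minus by blast+
  moreover have "arcs_noncrossing {1..k} a b a b"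
    using v by (simp add: valid_keys_def keys_noncrossing_def)
  ultimately show False using arcs_noncrossingD[of "{1..k}" a b a b "r+1" "s+1"] r1 s1(1) by simp
qed

section \<open>The pivot pair determines the order\<close>

text \<open>The arc of O_t runs from \<open>a t\<close> to \<open>b t\<close>, that of D_u from
  \<open>b' u\<close> to \<open>a' u\<close>. Of two arcs with equal direction one starts before the
  other ends unless it lies entirely behind it, and then it is later in both row words. For opposite
  arcs \<open>b t < b' u\<close> settles everything; otherwise \<alpha> = 1 or \<alpha> = 2k-1
  forces them to be nested, and \<alpha> = \<beta> forces them to be disjoint.\<close>

lemma plus_compare:
  assumes k: "k \<ge> 2" and v: "valid_keys (M,M,M,M,V,V) k a a' b b'"
    and \<alpha>: "\<alpha> \<in> {1..2*k-1}" "row_pattern k \<alpha> a a'"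
    and \<beta>: "\<beta> \<in> {1..2*k-1}" "row_pattern k \<beta> b b'"
    and tu: "t \<in> {1..k}" "u \<in> {1..k}"
  shows "a t < b u \<longleftrightarrow> rank_o k \<alpha> t \<le> rank_o k \<alpha> u \<or> rank_o k \<beta> t \<le> rank_o k \<beta> u"
    "b' t < a' u \<longleftrightarrow> rank_e k \<alpha> t \<le> rank_e k \<alpha> u \<or> rank_e k \<beta> t \<le> rank_e k \<beta> u"
    "a t < b' u \<longleftrightarrow> rank_o k \<beta> t < rank_e k \<beta> u \<or> \<alpha> = 1 \<and> t < u \<or> \<alpha> \<noteq> 1 \<and> \<alpha> = 2*k-1 \<and> u < t"
    "b t < a' u \<longleftrightarrow> rank_o k \<beta> t < rank_e k \<beta> u \<or> \<alpha> = 1 \<and> u < t \<or> \<alpha> \<noteq> 1 \<and> \<alpha> = 2*k-1 \<and> t < u"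
proof -
  have ord: "a t < b t" "b' t < a' t" "a t < a' t" "b t < b' t"
    "a u < b u" "b' u < a' u" "a u < a' u" "b u < b' u"
    using v tu by (auto simp: valid_keys_def keys_precedence_plus)
  have nc: "arcs_noncrossing {1..k} a b a b" "arcs_noncrossing {1..k} a' b' a' b'"
    "arcs_noncrossing {1..k} a b a' b'" "arcs_noncrossing {1..k} a' b' a b"
    using v by (simp_all add: valid_keys_def keys_noncrossing_def)
  have ne: "a t \<noteq> b u" "a' u \<noteq> b' t" "b t \<noteq> a' u" "b' u \<noteq> a t" "a' t \<noteq> b' u" "b' u \<noteq> b t" "a' u \<noteq> a t"
  proof -
    have "keys_distinct k a a' b b'" using v by (simp add: valid_keys_def)
    then show "a t \<noteq> b u" "a' u \<noteq> b' t" "b t \<noteq> a' u" "b' u \<noteq> a t" "a' t \<noteq> b' u" "b' u \<noteq> b t" "a' u \<noteq> a t"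
      using tu unfolding keys_distinct_def row_distinct_def by metis+
  qed
  note A = row_pattern_iff[OF \<alpha> tu] and A' = row_pattern_iff[OF \<alpha> tu(2,1)]
  note B = row_pattern_iff[OF \<beta> tu] and B' = row_pattern_iff[OF \<beta> tu(2,1)]
  have "a t \<le> a u \<or> b t \<le> b u \<longleftrightarrow> a t < b u"
    using ord arcs_noncrossingD[OF nc(1) tu(2,1)] ne(1) by linarith
  then show "a t < b u \<longleftrightarrow> rank_o k \<alpha> t \<le> rank_o k \<alpha> u \<or> rank_o k \<beta> t \<le> rank_o k \<beta> u"
    using A B by simp
  have "\<not> cross (a' u) (b' u) (a' t) (b' t)"
    using nc(2) tu by (auto simp: arcs_noncrossing_def)
  then have "a' t \<le> a' u \<or> b' t \<le> b' u \<longleftrightarrow> b' t < a' u"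
    using ord ne(2) unfolding cross_def by linarith
  then show "b' t < a' u \<longleftrightarrow> rank_e k \<alpha> t \<le> rank_e k \<alpha> u \<or> rank_e k \<beta> t \<le> rank_e k \<beta> u"
    using A B by simp
  have split: "b t < b' u \<Longrightarrow> a t < b' u \<and> b t < a' u" using ord by linarith
  have "\<not> cross (a' u) (b' u) (a t) (b t)" "\<not> cross (a t) (b t) (a' u) (b' u)"
    using nc(3,4) tu by (auto simp: arcs_noncrossing_def)
  \<comment> \<open>Overlapping opposite arcs are nested: either \<open>a t < b' u\<close> and
    \<open>a' u < b t\<close>, or \<open>b' u < a t\<close> and \<open>b t < a' u\<close>.\<close>
  then have nest: "b' u < b t \<Longrightarrow> a t < a' u \<Longrightarrow> a t < b' u \<longleftrightarrow> \<not> b t < a' u"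
    using ord ne unfolding cross_def by linarith
  have diff: "b' u < b t \<Longrightarrow> t \<noteq> u" using ord by auto
  \<comment> \<open>W_1 is O_1..O_k D_k..D_1. For t < u the chain
    \<open>a t < a u < b u < b' u\<close> decides, for u < t the chain
    \<open>b t < b' t < a' t < a' u\<close>.\<close>
  have outer: "b' u < b t \<Longrightarrow> a t < a' u \<and> (a t < b' u \<longleftrightarrow> t < u)" if "\<alpha> = 1"
  proof -
    assume i: "b' u < b t"
    have r: "rank_o k \<alpha> t < rank_e k \<alpha> u" "rank_o k \<alpha> t < rank_o k \<alpha> u \<longleftrightarrow> t < u"
      "rank_e k \<alpha> t < rank_e k \<alpha> u \<longleftrightarrow> u < t"
      using that tu by (auto simp: rank_o_def rank_e_def)
    then have s: "a t < a' u" "a t < a u \<longleftrightarrow> t < u" "a' t < a' u \<longleftrightarrow> u < t" using A by simp_all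
    show "a t < a' u \<and> (a t < b' u \<longleftrightarrow> t < u)"
    proof (cases "t < u")
      case True
      then show ?thesis using s ord by linarith
    next
      case False
      with diff[OF i] s have "a' t < a' u" by simp
      then have "b t < a' u" using ord by linarith
      then show ?thesis using nest i s False by auto
    qed
  qed
  \<comment> \<open>W_(2k-1) is O_k..O_1 D_1..D_k: the same two chains with the cases t < u and u <
    t exchanged.\<close>
  have inner: "b' u < b t \<Longrightarrow> a t < a' u \<and> (a t < b' u \<longleftrightarrow> u < t)" if "\<alpha> = 2*k-1"
  proof -
    assume i: "b' u < b t"
    have "odd \<alpha>" "(\<alpha> + 1) div 2 = k" using that k by auto
    then have r: "rank_o k \<alpha> t < rank_e k \<alpha> u" "rank_o k \<alpha> t < rank_o k \<alpha> u \<longleftrightarrow> u < t"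
      "rank_e k \<alpha> t < rank_e k \<alpha> u \<longleftrightarrow> t < u"
      using tu unfolding rank_o_def rank_e_def by auto
    then have s: "a t < a' u" "a t < a u \<longleftrightarrow> u < t" "a' t < a' u \<longleftrightarrow> t < u" using A by auto
    show "a t < a' u \<and> (a t < b' u \<longleftrightarrow> u < t)"
    proof (cases "u < t")
      case True
      then show ?thesis using s ord by linarith
    next
      case False
      with diff[OF i] s have "a' t < a' u" by simp
      then have "b t < a' u" using ord by linarith
      then show ?thesis using nest i s False by auto
    qed
  qed
  \<comment> \<open>With equal words, D_u before O_t in the lower row gives the same in the upper
    row, and the whole arc of D_u precedes that of O_t.\<close>
  have diag: "b' u < b t \<Longrightarrow> a' u < a t" if "\<alpha> = \<beta>"
    using A' B' that ord by auto
  have cond: "\<alpha> = 1 \<or> \<alpha> = 2*k-1 \<or> \<alpha> = \<beta>"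
    by (rule plus_pivot_condition[OF k v \<alpha> \<beta>])
  have k1: "2*k-1 \<noteq> 1" using k by simp
  have "(a t < b' u \<longleftrightarrow> b t < b' u \<or> \<alpha> = 1 \<and> t < u \<or> \<alpha> \<noteq> 1 \<and> \<alpha> = 2*k-1 \<and> u < t) \<and>
    (b t < a' u \<longleftrightarrow> b t < b' u \<or> \<alpha> = 1 \<and> u < t \<or> \<alpha> \<noteq> 1 \<and> \<alpha> = 2*k-1 \<and> t < u)"
  proof (cases "b t < b' u")
    case True
    then show ?thesis using split by simp
  next
    case False
    with ne(6) have i: "b' u < b t" by simp
    consider "\<alpha> = 1" | "\<alpha> = 2*k-1" | "\<alpha> \<noteq> 1" "\<alpha> \<noteq> 2*k-1" "\<alpha> = \<beta>" using cond by blast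
    then show ?thesis
    proof cases
      case 1
      then show ?thesis using outer[OF 1 i] nest[OF i] diff[OF i] i False k1 by auto
    next
      case 2
      then show ?thesis using inner[OF 2 i] nest[OF i] diff[OF i] i False k1 by auto
    next
      case 3
      then show ?thesis using diag[OF 3(3) i] i False ord by auto
    qed
  qed
  then show "a t < b' u \<longleftrightarrow> rank_o k \<beta> t < rank_e k \<beta> u \<or> \<alpha> = 1 \<and> t < u \<or> \<alpha> \<noteq> 1 \<and> \<alpha> = 2*k-1 \<and> u < t"
    "b t < a' u \<longleftrightarrow> rank_o k \<beta> t < rank_e k \<beta> u \<or> \<alpha> = 1 \<and> u < t \<or> \<alpha> \<noteq> 1 \<and> \<alpha> = 2*k-1 \<and> t < u"
    using B(2) by simp_all
qed

text \<open>All H arcs start in the upper row, so one principle serves the four cases: the arc at t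
  starts before the arc at u ends unless the latter lies entirely above it, and then the arc at u
  comes first at both ends.\<close>

lemma minus_compare:
  assumes v: "valid_keys (M,V,M,M,M,M) k a a' b b'"
    and \<alpha>: "\<alpha> \<in> {1..2*k-1}" "row_pattern k \<alpha> a a'"
    and \<beta>: "\<beta> \<in> {1..2*k-1}" "row_pattern k \<beta> (\<lambda>t. - b t) (\<lambda>t. - b' t)"
    and tu: "t \<in> {1..k}" "u \<in> {1..k}"
  shows "a t < b u \<longleftrightarrow> rank_o k \<alpha> t \<le> rank_o k \<alpha> u \<or> rank_o k \<beta> u \<le> rank_o k \<beta> t"
    "a t < b' u \<longleftrightarrow> rank_o k \<alpha> t \<le> rank_e k \<alpha> u \<or> rank_e k \<beta> u \<le> rank_o k \<beta> t"
    "a' t < b u \<longleftrightarrow> rank_e k \<alpha> t \<le> rank_o k \<alpha> u \<or> rank_o k \<beta> u \<le> rank_e k \<beta> t"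
    "a' t < b' u \<longleftrightarrow> rank_e k \<alpha> t \<le> rank_e k \<alpha> u \<or> rank_e k \<beta> u \<le> rank_e k \<beta> t"
proof -
  have ord: "a t < b t" "a' t < b' t" "a u < b u" "a' u < b' u"
    using v tu by (auto simp: valid_keys_def keys_precedence_minus)
  have nc: "arcs_noncrossing {1..k} a b a b" "arcs_noncrossing {1..k} a' b' a' b'"
    "arcs_noncrossing {1..k} a b a' b'" "arcs_noncrossing {1..k} a' b' a b"
    using v by (simp_all add: valid_keys_def keys_noncrossing_def)
  have ne: "a t \<noteq> b u" "a' t \<noteq> b' u" "a' t \<noteq> b u" "a t \<noteq> b' u"
  proof -
    have "keys_distinct k a a' b b'" using v by (simp add: valid_keys_def)
    then show "a t \<noteq> b u" "a' t \<noteq> b' u" "a' t \<noteq> b u" "a t \<noteq> b' u"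
      using tu unfolding keys_distinct_def by metis+
  qed
  \<comment> \<open>\<open>x\<close> and \<open>y'\<close> are the ends of the arc at t,
    \<open>x'\<close> and \<open>y\<close> those of the arc at u.\<close>
  have eq: "x t < y u \<longleftrightarrow> x t \<le> x' u \<or> y' t \<le> y u"
    if "arcs_noncrossing {1..k} x' y x y'" "x t < y' t" "x' u < y u" "x t \<noteq> y u" for x x' y y' :: "nat \<Rightarrow> int"
    using that(2-4) arcs_noncrossingD[OF that(1) tu(2,1)] by linarith
  note A = row_pattern_iff[OF \<alpha> tu] and B = row_pattern_iff[OF \<beta> tu(2,1), unfolded neg_le_iff_le neg_less_iff_less]
  show "a t < b u \<longleftrightarrow> rank_o k \<alpha> t \<le> rank_o k \<alpha> u \<or> rank_o k \<beta> u \<le> rank_o k \<beta> t"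
    using eq[OF nc(1)] ord ne A(5) B(5) by simp
  show "a t < b' u \<longleftrightarrow> rank_o k \<alpha> t \<le> rank_e k \<alpha> u \<or> rank_e k \<beta> u \<le> rank_o k \<beta> t"
    using eq[OF nc(4)] ord ne A(6) B(7) by simp
  show "a' t < b u \<longleftrightarrow> rank_e k \<alpha> t \<le> rank_o k \<alpha> u \<or> rank_o k \<beta> u \<le> rank_e k \<beta> t"
    using eq[OF nc(3)] ord ne A(7) B(6) by simp
  show "a' t < b' u \<longleftrightarrow> rank_e k \<alpha> t \<le> rank_e k \<alpha> u \<or> rank_e k \<beta> u \<le> rank_e k \<beta> t"
    using eq[OF nc(2)] ord ne A(8) B(8) by simp
qed

section \<open>Passing between lists, face keys and the four key sequences\<close>

lemma keys_distinct_of_inj: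
  fixes f :: "face \<Rightarrow> int"
  assumes "inj_on f (faces k)"
  shows "keys_distinct k (f \<circ> Ao) (f \<circ> Ae) (f \<circ> Bo) (f \<circ> Be)"
proof -
  have o: "Ao t = Ao u \<longleftrightarrow> t = u" "Bo t = Bo u \<longleftrightarrow> t = u" "Ao t \<noteq> Ae u" "Bo t \<noteq> Be u"
    if "t \<in> {1..k}" "u \<in> {1..k}" for t u
    using that unfolding Ao_def Bo_def Ae_def Be_def face.inject atLeastAtMost_iff by presburger+
  note eq = inj_on_eq_iff[OF assms] and mem = face_in_faces
  show ?thesis
    unfolding keys_distinct_def row_distinct_def inj_on_def comp_def
    by (intro conjI ballI impI) (simp_all only: eq mem o face_neq not_False_eq_True)
qed

lemma inj_of_keys_distinct:
  fixes f :: "face \<Rightarrow> int"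
  assumes "keys_distinct k (f \<circ> Ao) (f \<circ> Ae) (f \<circ> Bo) (f \<circ> Be)"
  shows "inj_on f (faces k)"
proof -
  note d = assms[unfolded keys_distinct_def row_distinct_def comp_def]
  have o: "f (Ao t) = f (Ao u) \<longleftrightarrow> t = u" "f (Ae t) = f (Ae u) \<longleftrightarrow> t = u"
    "f (Bo t) = f (Bo u) \<longleftrightarrow> t = u" "f (Be t) = f (Be u) \<longleftrightarrow> t = u"
    if "t \<in> {1..k}" "u \<in> {1..k}" for t u
    using d that by (metis (no_types, lifting) inj_on_def)+
  have n: "f (Ao t) \<noteq> f (Ae u)" "f (Ao t) \<noteq> f (Bo u)" "f (Ao t) \<noteq> f (Be u)"
    "f (Ae t) \<noteq> f (Bo u)" "f (Ae t) \<noteq> f (Be u)" "f (Bo t) \<noteq> f (Be u)"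
    if "t \<in> {1..k}" "u \<in> {1..k}" for t u
    using d that by metis+
  show ?thesis
    unfolding inj_on_def faces_eq ball_Un ball_simps(9)
    by (intro conjI ballI impI) (simp_all only: o n n[symmetric] simp_thms)
qed

lemma order_valid_keys:
  assumes "order_valid P k xs"
  shows "\<exists>f::face \<Rightarrow> int. sorted_wrt (\<lambda>x y. f x < f y) xs \<and> set xs = faces k \<and>
    valid_keys P k (f \<circ> Ao) (f \<circ> Ae) (f \<circ> Bo) (f \<circ> Be)"
proof -
  have xs: "distinct xs" "set xs = faces k"
    using assms by (auto simp: order_valid_def total_order_of_faces_def)
  then obtain f :: "face \<Rightarrow> int" where f: "sorted_wrt (\<lambda>x y. f x < f y) xs" using ex_key by blast
  moreover have "keys_distinct k (f \<circ> Ao) (f \<circ> Ae) (f \<circ> Bo) (f \<circ> Be)"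
    using sorted_key_inj(2)[OF f] xs by (simp add: keys_distinct_of_inj)
  ultimately show ?thesis
    using assms xs order_valid_iff_keys[OF f xs(2), of P] unfolding valid_keys_def by blast
qed

lemma valid_keys_order:
  fixes f :: "face \<Rightarrow> int"
  assumes "valid_keys P k (f \<circ> Ao) (f \<circ> Ae) (f \<circ> Bo) (f \<circ> Be)"
  shows "\<exists>xs. sorted_wrt (\<lambda>x y. f x < f y) xs \<and> set xs = faces k \<and> order_valid P k xs"
proof -
  have "inj_on f (faces k)" using assms inj_of_keys_distinct by (auto simp: valid_keys_def)
  then obtain xs where "sorted_wrt (\<lambda>x y. f x < f y) xs" "set xs = faces k"
    using ex_list_of_key[OF finite_faces] by blast
  then show ?thesis using order_valid_iff_keys[of f xs k P] assms by (simp add: valid_keys_def) blast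
qed

lemma sorted_same_comparisons:
  fixes f g :: "face \<Rightarrow> int"
  assumes "sorted_wrt (\<lambda>x y. f x < f y) xs" "sorted_wrt (\<lambda>x y. g x < g y) ys"
    and "set xs = S" "set ys = S" "\<And>x y. x \<in> S \<Longrightarrow> y \<in> S \<Longrightarrow> g x < g y \<Longrightarrow> f x < f y"
  shows "xs = ys"
proof (rule sorted_key_unique[OF assms(1)])
  show "sorted_wrt (\<lambda>x y. f x < f y) ys"
    by (rule sorted_wrt_mono_rel[OF _ assms(2)]) (use assms in auto)
qed (use assms in simp)

text \<open>Ten families, one for each unordered pair of the kinds \<open>Ao\<close>,
  \<open>Ae\<close>, \<open>Bo\<close>, \<open>Be\<close>; a pair in the other order is settled by
  the injectivity of \<open>f\<close>.\<close>

lemma same_comparisons: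
  fixes f g :: "face \<Rightarrow> int"
  assumes f: "keys_distinct k (f \<circ> Ao) (f \<circ> Ae) (f \<circ> Bo) (f \<circ> Be)"
    and rows: "\<And>t u. t \<in> {1..k} \<Longrightarrow> u \<in> {1..k} \<Longrightarrow> f (Ao t) < f (Ao u) \<longleftrightarrow> g (Ao t) < g (Ao u)"
      "\<And>t u. t \<in> {1..k} \<Longrightarrow> u \<in> {1..k} \<Longrightarrow> f (Ao t) < f (Ae u) \<longleftrightarrow> g (Ao t) < g (Ae u)"
      "\<And>t u. t \<in> {1..k} \<Longrightarrow> u \<in> {1..k} \<Longrightarrow> f (Ae t) < f (Ae u) \<longleftrightarrow> g (Ae t) < g (Ae u)"
      "\<And>t u. t \<in> {1..k} \<Longrightarrow> u \<in> {1..k} \<Longrightarrow> f (Bo t) < f (Bo u) \<longleftrightarrow> g (Bo t) < g (Bo u)"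
      "\<And>t u. t \<in> {1..k} \<Longrightarrow> u \<in> {1..k} \<Longrightarrow> f (Bo t) < f (Be u) \<longleftrightarrow> g (Bo t) < g (Be u)"
      "\<And>t u. t \<in> {1..k} \<Longrightarrow> u \<in> {1..k} \<Longrightarrow> f (Be t) < f (Be u) \<longleftrightarrow> g (Be t) < g (Be u)"
    and mixed: "\<And>t u. t \<in> {1..k} \<Longrightarrow> u \<in> {1..k} \<Longrightarrow> f (Ao t) < f (Bo u) \<longleftrightarrow> g (Ao t) < g (Bo u)"
      "\<And>t u. t \<in> {1..k} \<Longrightarrow> u \<in> {1..k} \<Longrightarrow> f (Ao t) < f (Be u) \<longleftrightarrow> g (Ao t) < g (Be u)"
      "\<And>t u. t \<in> {1..k} \<Longrightarrow> u \<in> {1..k} \<Longrightarrow> f (Ae t) < f (Bo u) \<longleftrightarrow> g (Ae t) < g (Bo u)"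
      "\<And>t u. t \<in> {1..k} \<Longrightarrow> u \<in> {1..k} \<Longrightarrow> f (Ae t) < f (Be u) \<longleftrightarrow> g (Ae t) < g (Be u)"
    and xy: "x \<in> faces k" "y \<in> faces k" "g x < g y"
  shows "f x < f y"
proof -
  have inj: "inj_on f (faces k)" using f by (rule inj_of_keys_distinct)
  have "(f x < f y \<longleftrightarrow> g x < g y) \<or> (f y < f x \<longleftrightarrow> g y < g x)"
  proof -
    have "\<forall>x\<in>faces k. \<forall>y\<in>faces k. (f x < f y \<longleftrightarrow> g x < g y) \<or> (f y < f x \<longleftrightarrow> g y < g x)"
      unfolding faces_eq ball_Un ball_simps(9)
      by (intro conjI ballI) (simp_all add: rows mixed)
    then show ?thesis using xy by blast
  qed
  moreover have "f x \<noteq> f y" using inj xy by (metis inj_on_eq_iff less_irrefl)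
  ultimately show ?thesis using xy(3) by auto
qed

lemma plus_unique:
  fixes f g :: "face \<Rightarrow> int"
  assumes k: "k \<ge> 2"
    and f: "valid_keys (M,M,M,M,V,V) k (f \<circ> Ao) (f \<circ> Ae) (f \<circ> Bo) (f \<circ> Be)"
     "row_pattern k \<alpha> (f \<circ> Ao) (f \<circ> Ae)" "row_pattern k \<beta> (f \<circ> Bo) (f \<circ> Be)"
    and g: "valid_keys (M,M,M,M,V,V) k (g \<circ> Ao) (g \<circ> Ae) (g \<circ> Bo) (g \<circ> Be)"
     "row_pattern k \<alpha> (g \<circ> Ao) (g \<circ> Ae)" "row_pattern k \<beta> (g \<circ> Bo) (g \<circ> Be)"
    and p: "\<alpha> \<in> {1..2*k-1}" "\<beta> \<in> {1..2*k-1}"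
    and xy: "x \<in> faces k" "y \<in> faces k" "g x < g y"
  shows "f x < f y"
proof -
  have d: "keys_distinct k (f \<circ> Ao) (f \<circ> Ae) (f \<circ> Bo) (f \<circ> Be)"
    "keys_distinct k (g \<circ> Ao) (g \<circ> Ae) (g \<circ> Bo) (g \<circ> Be)"
    using f g by (simp_all add: valid_keys_def)
  have ne: "f (Ae t) \<noteq> f (Bo u)" "f (Ae t) \<noteq> f (Be u)" "g (Ae t) \<noteq> g (Bo u)" "g (Ae t) \<noteq> g (Be u)"
    if "t \<in> {1..k}" "u \<in> {1..k}" for t u
    using d that unfolding keys_distinct_def comp_def by metis+
  note F = plus_compare[OF k f(1) p(1) f(2) p(2) f(3), unfolded comp_def]
  note G = plus_compare[OF k g(1) p(1) g(2) p(2) g(3), unfolded comp_def]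
  note FR = row_pattern_iff[OF p(1) f(2), unfolded comp_def] row_pattern_iff[OF p(2) f(3), unfolded comp_def]
  note GR = row_pattern_iff[OF p(1) g(2), unfolded comp_def] row_pattern_iff[OF p(2) g(3), unfolded comp_def]
  \<comment> \<open>\<open>plus_compare\<close> puts the lower face first against \<open>Ae\<close>,
    \<open>same_comparisons\<close> puts \<open>Ae\<close> first; as the keys differ, one comparison
    is the negation of the other.\<close>
  have rev: "f (Bo t) < f (Ae u) \<longleftrightarrow> g (Bo t) < g (Ae u)" "f (Be t) < f (Ae u) \<longleftrightarrow> g (Be t) < g (Ae u)"
    if "t \<in> {1..k}" "u \<in> {1..k}" for t u
    unfolding F[OF that] G[OF that] by (rule refl)+
  have mixed: "f (Ao t) < f (Bo u) \<longleftrightarrow> g (Ao t) < g (Bo u)" "f (Ao t) < f (Be u) \<longleftrightarrow> g (Ao t) < g (Be u)"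
    "f (Ae t) < f (Bo u) \<longleftrightarrow> g (Ae t) < g (Bo u)" "f (Ae t) < f (Be u) \<longleftrightarrow> g (Ae t) < g (Be u)"
    if "t \<in> {1..k}" "u \<in> {1..k}" for t u
  proof -
    show "f (Ao t) < f (Bo u) \<longleftrightarrow> g (Ao t) < g (Bo u)" "f (Ao t) < f (Be u) \<longleftrightarrow> g (Ao t) < g (Be u)"
      unfolding F[OF that] G[OF that] by (rule refl)+
    show "f (Ae t) < f (Bo u) \<longleftrightarrow> g (Ae t) < g (Bo u)" "f (Ae t) < f (Be u) \<longleftrightarrow> g (Ae t) < g (Be u)"
      using rev[OF that(2,1)] ne[OF that] by linarith+
  qed
  show ?thesis
    by (rule same_comparisons[OF d(1) _ _ _ _ _ _ mixed xy]) (simp_all add: FR GR del: One_nat_def atLeastAtMost_iff)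
qed

lemma minus_unique:
  fixes f g :: "face \<Rightarrow> int"
  assumes f: "valid_keys (M,V,M,M,M,M) k (f \<circ> Ao) (f \<circ> Ae) (f \<circ> Bo) (f \<circ> Be)"
     "row_pattern k \<alpha> (f \<circ> Ao) (f \<circ> Ae)" "row_pattern k \<beta> (\<lambda>t. - (f \<circ> Bo) t) (\<lambda>t. - (f \<circ> Be) t)"
    and g: "valid_keys (M,V,M,M,M,M) k (g \<circ> Ao) (g \<circ> Ae) (g \<circ> Bo) (g \<circ> Be)"
     "row_pattern k \<alpha> (g \<circ> Ao) (g \<circ> Ae)" "row_pattern k \<beta> (\<lambda>t. - (g \<circ> Bo) t) (\<lambda>t. - (g \<circ> Be) t)"
    and p: "\<alpha> \<in> {1..2*k-1}" "\<beta> \<in> {1..2*k-1}"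
    and xy: "x \<in> faces k" "y \<in> faces k" "g x < g y"
  shows "f x < f y"
proof -
  have d: "keys_distinct k (f \<circ> Ao) (f \<circ> Ae) (f \<circ> Bo) (f \<circ> Be)"
    using f by (simp_all add: valid_keys_def)
  note F = minus_compare[OF f(1) p(1) f(2) p(2) f(3), unfolded comp_def]
  note G = minus_compare[OF g(1) p(1) g(2) p(2) g(3), unfolded comp_def]
  note FR = row_pattern_iff[OF p(1) f(2), unfolded comp_def]
    row_pattern_iff[OF p(2) f(3), unfolded comp_def neg_less_iff_less neg_le_iff_le]
  note GR = row_pattern_iff[OF p(1) g(2), unfolded comp_def]
    row_pattern_iff[OF p(2) g(3), unfolded comp_def neg_less_iff_less neg_le_iff_le]
  show ?thesis
    by (rule same_comparisons[OF d _ _ _ _ _ _ _ _ _ _ xy])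
      (simp_all add: F G FR GR del: One_nat_def atLeastAtMost_iff)
qed

section \<open>Explicit keys for every admissible pivot pair\<close>

lemma rank_odd_Suc:
  "rank_o k (2*s+1) t = (if t \<le> s + 1 then - int t else int t)"
  "rank_e k (2*s+1) t = (if t \<le> s then int t else 4 * int k - int t)"
  using rank_odd[of "Suc s" k t] by auto

text \<open>Each key below realises one layout, given in its comment from top to bottom: \<open>A O\<^sub>1..O\<^sub>s\<close> is the block
  of upper faces of these columns, and \<open>AB O\<^sub>1..O\<^sub>s\<close> lists for each column the upper face directly followed
  by the lower one. In the diagonal cases for \<open>MMMMVV\<close> this is \<open>W\<^sub>p\<close> with \<open>AB\<close> at the \<open>O\<close> columns and \<open>BA\<close> at
  the \<open>D\<close> columns, for \<open>MVMMMM\<close> it is the upper row \<open>W\<^sub>p\<close> followed by the lower row reversed.\<close>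

text \<open>\<open>A O\<^sub>1..O\<^sub>s | B O\<^sub>s..O\<^sub>1 D\<^sub>1..D\<^bsub>s-1\<^esub> | AB O\<^bsub>s+1\<^esub>..O\<^sub>k | BA D\<^sub>k..D\<^sub>s | A D\<^bsub>s-1\<^esub>..D\<^sub>1\<close>\<close>

lemma plus_keys_outer_odd:
  fixes k s :: nat
  assumes s: "1 \<le> s" "s \<le> k"
  defines "N \<equiv> int k"
  defines "a \<equiv> \<lambda>t. if t \<le> s then int t - 10*N else 2*N + 2*int t"
    and "a' \<equiv> \<lambda>t. 20*N - 2*int t"
    and "b \<equiv> \<lambda>t. if t \<le> s then - int t else 2*N + 2*int t + 1"
    and "b' \<equiv> \<lambda>t. if t < s then int t else 20*N - 2*int t - 1"
  shows "valid_keys (M,M,M,M,V,V) k a a' b b' \<and> row_pattern k (1) a a' \<and> row_pattern k (2*s-1) b b'"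
proof -
  note defs = a_def a'_def b_def b'_def N_def
  \<comment> \<open>In the interleaved blocks the coefficient 2 leaves it to parity to tell upper
    from lower keys; the other blocks are kept apart by sign or by the multiples of
    \<open>N\<close>, as all indices lie in 1..N.\<close>
  have "keys_distinct k a a' b b'"
    unfolding keys_distinct_def row_distinct_def inj_on_def
    by (intro conjI ballI; auto simp: defs split: if_splits; presburger)
  moreover have "keys_precedence (M,M,M,M,V,V) k a a' b b'"
    unfolding keys_precedence_plus using s by (auto simp: defs split: if_splits)
  moreover have "keys_noncrossing k a a' b b'"
    unfolding keys_noncrossing_def
    by (intro conjI; unfold arcs_noncrossing_def cross_def, intro ballI) (use s in \<open>auto simp: defs min_def max_def split: if_splits\<close>)
  moreover have "row_pattern k (1) a a'"
    unfolding row_pattern_def by (intro conjI ballI) (auto simp: rank_o_def rank_e_def defs split: if_splits)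
  moreover have "row_pattern k (2*s-1) b b'"
    unfolding row_pattern_def rank_odd[OF s(1)] by (intro conjI ballI) (auto simp: defs split: if_splits)
  ultimately show ?thesis by (simp add: valid_keys_def)
qed

text \<open>\<open>A O\<^sub>1..O\<^sub>s | AB O\<^bsub>s+1\<^esub>..O\<^sub>k | BA D\<^sub>k..D\<^bsub>s+1\<^esub> | B O\<^sub>s..O\<^sub>1 D\<^sub>1..D\<^sub>s | A D\<^sub>s..D\<^sub>1\<close>\<close>

lemma plus_keys_outer_even:
  fixes k s :: nat
  assumes s: "1 \<le> s" "s < k"
  defines "N \<equiv> int k"
  defines "a \<equiv> \<lambda>t. 2*int t - 20*N"
    and "a' \<equiv> \<lambda>t. if t \<le> s then 20*N - int t else - 10*N - 2*int t"
    and "b \<equiv> \<lambda>t. if t \<le> s then - int t else 2*int t + 1 - 20*N"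
    and "b' \<equiv> \<lambda>t. if t \<le> s then int t else - 10*N - 2*int t - 1"
  shows "valid_keys (M,M,M,M,V,V) k a a' b b' \<and> row_pattern k (1) a a' \<and> row_pattern k (2*s) b b'"
proof -
  note defs = a_def a'_def b_def b'_def N_def
  have "keys_distinct k a a' b b'"
    unfolding keys_distinct_def row_distinct_def inj_on_def
    by (intro conjI ballI; auto simp: defs split: if_splits; presburger)
  moreover have "keys_precedence (M,M,M,M,V,V) k a a' b b'"
    unfolding keys_precedence_plus using s by (auto simp: defs split: if_splits)
  moreover have "keys_noncrossing k a a' b b'"
    unfolding keys_noncrossing_def
    by (intro conjI; unfold arcs_noncrossing_def cross_def, intro ballI) (use s in \<open>auto simp: defs min_def max_def split: if_splits\<close>)
  moreover have "row_pattern k (1) a a'"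
    unfolding row_pattern_def by (intro conjI ballI) (auto simp: rank_o_def rank_e_def defs split: if_splits)
  moreover have "row_pattern k (2*s) b b'"
    unfolding row_pattern_def rank_even by (intro conjI ballI) (auto simp: defs split: if_splits)
  ultimately show ?thesis by (simp add: valid_keys_def)
qed

text \<open>\<open>A O\<^sub>k..O\<^bsub>s+1\<^esub> | AB O\<^sub>s..O\<^sub>1 | BA D\<^sub>1..D\<^bsub>s-1\<^esub> | B O\<^bsub>s+1\<^esub>..O\<^sub>k D\<^sub>k..D\<^sub>s | A D\<^sub>s..D\<^sub>k\<close>\<close>

lemma plus_keys_inner_odd:
  fixes k s :: nat
  assumes s: "1 \<le> s" "s \<le> k"
  defines "N \<equiv> int k"
  defines "a \<equiv> \<lambda>t. - 2*int t"
    and "a' \<equiv> \<lambda>t. if t < s then 2*int t + 1 else 30*N + int t"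
    and "b \<equiv> \<lambda>t. if t \<le> s then 1 - 2*int t else 10*N + int t"
    and "b' \<equiv> \<lambda>t. if t < s then 2*int t else 20*N - int t"
  shows "valid_keys (M,M,M,M,V,V) k a a' b b' \<and> row_pattern k (2*k-1) a a' \<and> row_pattern k (2*s-1) b b'"
proof -
  have k1: "1 \<le> k" using s by auto
  note defs = a_def a'_def b_def b'_def N_def
  have "keys_distinct k a a' b b'"
    unfolding keys_distinct_def row_distinct_def inj_on_def
    by (intro conjI ballI; auto simp: defs split: if_splits; presburger)
  moreover have "keys_precedence (M,M,M,M,V,V) k a a' b b'"
    unfolding keys_precedence_plus using s by (auto simp: defs split: if_splits)
  moreover have "keys_noncrossing k a a' b b'"
    unfolding keys_noncrossing_def
    by (intro conjI; unfold arcs_noncrossing_def cross_def, intro ballI) (use s in \<open>auto simp: defs min_def max_def split: if_splits\<close>)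
  moreover have "row_pattern k (2*k-1) a a'"
    unfolding row_pattern_def rank_odd[OF k1] by (intro conjI ballI) (auto simp: defs split: if_splits)
  moreover have "row_pattern k (2*s-1) b b'"
    unfolding row_pattern_def rank_odd[OF s(1)] by (intro conjI ballI) (auto simp: defs split: if_splits)
  ultimately show ?thesis by (simp add: valid_keys_def)
qed

text \<open>\<open>A O\<^sub>k..O\<^bsub>s+1\<^esub> | B O\<^bsub>s+1\<^esub>..O\<^sub>k D\<^sub>k..D\<^bsub>s+1\<^esub> | AB O\<^sub>s..O\<^sub>1 | BA D\<^sub>1..D\<^sub>s | A D\<^bsub>s+1\<^esub>..D\<^sub>k\<close>\<close>

lemma plus_keys_inner_even:
  fixes k s :: nat
  assumes s: "1 \<le> s" "s < k"
  defines "N \<equiv> int k"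
  defines "a \<equiv> \<lambda>t. if t \<le> s then - 2*int t else - 30*N - int t"
    and "a' \<equiv> \<lambda>t. 2*int t + 1"
    and "b \<equiv> \<lambda>t. if t \<le> s then 1 - 2*int t else int t - 20*N"
    and "b' \<equiv> \<lambda>t. if t \<le> s then 2*int t else - 10*N - int t"
  shows "valid_keys (M,M,M,M,V,V) k a a' b b' \<and> row_pattern k (2*k-1) a a' \<and> row_pattern k (2*s) b b'"
proof -
  have k1: "1 \<le> k" using s by auto
  note defs = a_def a'_def b_def b'_def N_def
  have "keys_distinct k a a' b b'"
    unfolding keys_distinct_def row_distinct_def inj_on_def
    by (intro conjI ballI; auto simp: defs split: if_splits; presburger)
  moreover have "keys_precedence (M,M,M,M,V,V) k a a' b b'"
    unfolding keys_precedence_plus using s by (auto simp: defs split: if_splits)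
  moreover have "keys_noncrossing k a a' b b'"
    unfolding keys_noncrossing_def
    by (intro conjI; unfold arcs_noncrossing_def cross_def, intro ballI) (use s in \<open>auto simp: defs min_def max_def split: if_splits\<close>)
  moreover have "row_pattern k (2*k-1) a a'"
    unfolding row_pattern_def rank_odd[OF k1] by (intro conjI ballI) (auto simp: defs split: if_splits)
  moreover have "row_pattern k (2*s) b b'"
    unfolding row_pattern_def rank_even by (intro conjI ballI) (auto simp: defs split: if_splits)
  ultimately show ?thesis by (simp add: valid_keys_def)
qed

lemma plus_keys_diagonal_odd:
  fixes k s :: nat
  assumes s: "1 \<le> s" "s \<le> k"
  defines "N \<equiv> int k"
  defines "a \<equiv> \<lambda>t. if t \<le> s then - 2*int t else 2*int t"
    and "a' \<equiv> \<lambda>t. if t < s then 2*int t + 1 else 20*N - 2*int t + 1"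
    and "b \<equiv> \<lambda>t. if t \<le> s then 1 - 2*int t else 2*int t + 1"
    and "b' \<equiv> \<lambda>t. if t < s then 2*int t else 20*N - 2*int t"
  shows "valid_keys (M,M,M,M,V,V) k a a' b b' \<and> row_pattern k (2*s-1) a a' \<and> row_pattern k (2*s-1) b b'"
proof -
  note defs = a_def a'_def b_def b'_def N_def
  have "keys_distinct k a a' b b'"
    unfolding keys_distinct_def row_distinct_def inj_on_def
    by (intro conjI ballI; auto simp: defs split: if_splits; presburger)
  moreover have "keys_precedence (M,M,M,M,V,V) k a a' b b'"
    unfolding keys_precedence_plus using s by (auto simp: defs split: if_splits)
  moreover have "keys_noncrossing k a a' b b'"
    unfolding keys_noncrossing_def
    by (intro conjI; unfold arcs_noncrossing_def cross_def, intro ballI) (use s in \<open>auto simp: defs min_def max_def split: if_splits\<close>)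
  moreover have "row_pattern k (2*s-1) a a'"
    unfolding row_pattern_def rank_odd[OF s(1)] by (intro conjI ballI) (auto simp: defs split: if_splits)
  moreover have "row_pattern k (2*s-1) b b'"
    unfolding row_pattern_def rank_odd[OF s(1)] by (intro conjI ballI) (auto simp: defs split: if_splits)
  ultimately show ?thesis by (simp add: valid_keys_def)
qed

lemma plus_keys_diagonal_even:
  fixes k s :: nat
  assumes s: "1 \<le> s" "s < k"
  defines "N \<equiv> int k"
  defines "a \<equiv> \<lambda>t. if t \<le> s then - 2*int t else 2*int t - 40*N"
    and "a' \<equiv> \<lambda>t. if t \<le> s then 2*int t + 1 else 1 - 10*N - 2*int t"
    and "b \<equiv> \<lambda>t. if t \<le> s then 1 - 2*int t else 2*int t + 1 - 40*N"
    and "b' \<equiv> \<lambda>t. if t \<le> s then 2*int t else - 10*N - 2*int t"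
  shows "valid_keys (M,M,M,M,V,V) k a a' b b' \<and> row_pattern k (2*s) a a' \<and> row_pattern k (2*s) b b'"
proof -
  note defs = a_def a'_def b_def b'_def N_def
  have "keys_distinct k a a' b b'"
    unfolding keys_distinct_def row_distinct_def inj_on_def
    by (intro conjI ballI; auto simp: defs split: if_splits; presburger)
  moreover have "keys_precedence (M,M,M,M,V,V) k a a' b b'"
    unfolding keys_precedence_plus using s by (auto simp: defs split: if_splits)
  moreover have "keys_noncrossing k a a' b b'"
    unfolding keys_noncrossing_def
    by (intro conjI; unfold arcs_noncrossing_def cross_def, intro ballI) (use s in \<open>auto simp: defs min_def max_def split: if_splits\<close>)
  moreover have "row_pattern k (2*s) a a'"
    unfolding row_pattern_def rank_even by (intro conjI ballI) (auto simp: defs split: if_splits)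
  moreover have "row_pattern k (2*s) b b'"
    unfolding row_pattern_def rank_even by (intro conjI ballI) (auto simp: defs split: if_splits)
  ultimately show ?thesis by (simp add: valid_keys_def)
qed

section \<open>Layouts for \<open>MVMMMM\<close>\<close>

lemma minus_keys_diagonal_odd:
  fixes k s :: nat
  assumes s: "1 \<le> s" "s \<le> k"
  defines "N \<equiv> int k"
  defines "a \<equiv> \<lambda>t. if t \<le> s then - int t else int t"
    and "a' \<equiv> \<lambda>t. if t < s then int t else 4*N - int t"
    and "b \<equiv> \<lambda>t. if t \<le> s then 20*N + int t else 20*N - int t"
    and "b' \<equiv> \<lambda>t. if t < s then 20*N - int t else 16*N + int t"
  shows "valid_keys (M,V,M,M,M,M) k a a' b b' \<and> row_pattern k (2*s-1) a a' \<and> row_pattern k (2*s-1) (\<lambda>t. - b t) (\<lambda>t. - b' t)"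
proof -
  \<comment> \<open>On the columns concerned, \<open>b = 20*N - a\<close> and
    \<open>b' = 20*N - a'\<close>: all H arcs have the midpoint 10N and are therefore
    nested.\<close>
  note defs = a_def a'_def b_def b'_def N_def
  have "keys_distinct k a a' b b'"
    unfolding keys_distinct_def row_distinct_def inj_on_def
    by (intro conjI ballI; auto simp: defs split: if_splits; presburger)
  moreover have "keys_precedence (M,V,M,M,M,M) k a a' b b'"
    unfolding keys_precedence_minus using s by (auto simp: defs split: if_splits)
  moreover have "keys_noncrossing k a a' b b'"
    unfolding keys_noncrossing_def
    by (intro conjI; unfold arcs_noncrossing_def cross_def, intro ballI) (use s in \<open>auto simp: defs min_def max_def split: if_splits\<close>)
  moreover have "row_pattern k (2*s-1) a a'"
    unfolding row_pattern_def rank_odd[OF s(1)] by (intro conjI ballI) (auto simp: defs split: if_splits)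
  moreover have "row_pattern k (2*s-1) (\<lambda>t. - b t) (\<lambda>t. - b' t)"
    unfolding row_pattern_def rank_odd[OF s(1)] by (intro conjI ballI) (auto simp: defs split: if_splits)
  ultimately show ?thesis by (simp add: valid_keys_def)
qed

lemma minus_keys_diagonal_even:
  fixes k s :: nat
  assumes s: "1 \<le> s" "s < k"
  defines "N \<equiv> int k"
  defines "a \<equiv> \<lambda>t. if t \<le> s then - int t else int t - 8*N"
    and "a' \<equiv> \<lambda>t. if t \<le> s then int t else - 2*N - int t"
    and "b \<equiv> \<lambda>t. if t \<le> s then 20*N + int t else 28*N - int t"
    and "b' \<equiv> \<lambda>t. if t \<le> s then 20*N - int t else 22*N + int t"
  shows "valid_keys (M,V,M,M,M,M) k a a' b b' \<and> row_pattern k (2*s) a a' \<and> row_pattern k (2*s) (\<lambda>t. - b t) (\<lambda>t. - b' t)"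
proof -
  note defs = a_def a'_def b_def b'_def N_def
  have "keys_distinct k a a' b b'"
    unfolding keys_distinct_def row_distinct_def inj_on_def
    by (intro conjI ballI; auto simp: defs split: if_splits; presburger)
  moreover have "keys_precedence (M,V,M,M,M,M) k a a' b b'"
    unfolding keys_precedence_minus using s by (auto simp: defs split: if_splits)
  moreover have "keys_noncrossing k a a' b b'"
    unfolding keys_noncrossing_def
    by (intro conjI; unfold arcs_noncrossing_def cross_def, intro ballI) (use s in \<open>auto simp: defs min_def max_def split: if_splits\<close>)
  moreover have "row_pattern k (2*s) a a'"
    unfolding row_pattern_def rank_even by (intro conjI ballI) (auto simp: defs split: if_splits)
  moreover have "row_pattern k (2*s) (\<lambda>t. - b t) (\<lambda>t. - b' t)"
    unfolding row_pattern_def rank_even by (intro conjI ballI) (auto simp: defs split: if_splits)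
  ultimately show ?thesis by (simp add: valid_keys_def)
qed

text \<open>With \<open>X = O\<^bsub>s+2\<^esub>..O\<^sub>k D\<^sub>k..D\<^bsub>s+1\<^esub>\<close> and \<open>Y = O\<^sub>s..O\<^sub>1 D\<^sub>1..D\<^sub>s\<close> the words \<open>W\<^bsub>2s\<^esub>\<close> and \<open>W\<^bsub>2s+1\<^esub>\<close> are
  \<open>O\<^bsub>s+1\<^esub> X Y\<close> and \<open>O\<^bsub>s+1\<^esub> Y X\<close>. The layout is \<open>A O\<^bsub>s+1\<^esub> | A X | B rev X | A Y | B rev Y | B O\<^bsub>s+1\<^esub>\<close> here and
  the same with \<open>X\<close> and \<open>Y\<close> exchanged in the next lemma.\<close>

lemma minus_keys_even_odd:
  fixes k s :: nat
  assumes s: "1 \<le> s" "s < k"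
  defines "N \<equiv> int k"
  defines "a \<equiv> \<lambda>t. if t \<le> s then - int t else int t - 30*N"
    and "a' \<equiv> \<lambda>t. if t \<le> s then int t else - 25*N - int t"
    and "b \<equiv> \<lambda>t. if t \<le> s then 5*N + int t else if t = s + 1 then 10*N else - 15*N - int t"
    and "b' \<equiv> \<lambda>t. if t \<le> s then 5*N - int t else int t - 20*N"
  shows "valid_keys (M,V,M,M,M,M) k a a' b b' \<and> row_pattern k (2*s) a a' \<and> row_pattern k (2*s+1) (\<lambda>t. - b t) (\<lambda>t. - b' t)"
proof -
  \<comment> \<open>The two ends of an H arc add up to -45N in the block X and to 5N in Y, so the
    arcs of each block are nested around one midpoint; the arc of O_(s+1) encloses both
    blocks.\<close>
  note defs = a_def a'_def b_def b'_def N_def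
  have "keys_distinct k a a' b b'"
    unfolding keys_distinct_def row_distinct_def inj_on_def
    by (intro conjI ballI; auto simp: defs split: if_splits; presburger)
  moreover have "keys_precedence (M,V,M,M,M,M) k a a' b b'"
    unfolding keys_precedence_minus using s by (auto simp: defs split: if_splits)
  moreover have "keys_noncrossing k a a' b b'"
    unfolding keys_noncrossing_def
    by (intro conjI; unfold arcs_noncrossing_def cross_def, intro ballI) (use s in \<open>auto simp: defs min_def max_def split: if_splits\<close>)
  moreover have "row_pattern k (2*s) a a'"
    unfolding row_pattern_def rank_even by (intro conjI ballI) (auto simp: defs split: if_splits)
  moreover have "row_pattern k (2*s+1) (\<lambda>t. - b t) (\<lambda>t. - b' t)"
    unfolding row_pattern_def rank_odd_Suc by (intro conjI ballI) (auto simp: defs split: if_splits)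
  ultimately show ?thesis by (simp add: valid_keys_def)
qed

lemma minus_keys_odd_even:
  fixes k s :: nat
  assumes s: "1 \<le> s" "s < k"
  defines "N \<equiv> int k"
  defines "a \<equiv> \<lambda>t. if t \<le> s + 1 then - int t else 10*N + int t"
    and "a' \<equiv> \<lambda>t. if t \<le> s then int t else 15*N - int t"
    and "b \<equiv> \<lambda>t. if t \<le> s then 5*N + int t else 25*N - int t"
    and "b' \<equiv> \<lambda>t. if t \<le> s then 5*N - int t else 20*N + int t"
  shows "valid_keys (M,V,M,M,M,M) k a a' b b' \<and> row_pattern k (2*s+1) a a' \<and> row_pattern k (2*s) (\<lambda>t. - b t) (\<lambda>t. - b' t)"
proof -
  \<comment> \<open>The corresponding sums are 5N in Y and 35N in X.\<close>
  note defs = a_def a'_def b_def b'_def N_def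
  have "keys_distinct k a a' b b'"
    unfolding keys_distinct_def row_distinct_def inj_on_def
    by (intro conjI ballI; auto simp: defs split: if_splits; presburger)
  moreover have "keys_precedence (M,V,M,M,M,M) k a a' b b'"
    unfolding keys_precedence_minus using s by (auto simp: defs split: if_splits)
  moreover have "keys_noncrossing k a a' b b'"
    unfolding keys_noncrossing_def
    by (intro conjI; unfold arcs_noncrossing_def cross_def, intro ballI) (use s in \<open>auto simp: defs min_def max_def split: if_splits\<close>)
  moreover have "row_pattern k (2*s+1) a a'"
    unfolding row_pattern_def rank_odd_Suc by (intro conjI ballI) (auto simp: defs split: if_splits)
  moreover have "row_pattern k (2*s) (\<lambda>t. - b t) (\<lambda>t. - b' t)"
    unfolding row_pattern_def rank_even by (intro conjI ballI) (auto simp: defs split: if_splits)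
  ultimately show ?thesis by (simp add: valid_keys_def)
qed

section \<open>Ranks and pivot words\<close>

lemma set_odd_cols: "set (odd_cols i j) = (\<lambda>t. 2*t - 1) ` {i..j}"
  and set_even_cols: "set (even_cols i j) = (\<lambda>t. 2*t) ` {i..j}"
  by (auto simp: odd_cols_def even_cols_def)

lemma sorted_odd_cols:
  assumes "\<And>t u. i \<le> t \<Longrightarrow> t < u \<Longrightarrow> u \<le> j \<Longrightarrow> R (2*t - 1) (2*u - 1)"
  shows "sorted_wrt R (odd_cols i j)"
  unfolding odd_cols_def sorted_wrt_map
  by (rule sorted_wrt_mono_rel[OF _ sorted_wrt_upt]) (use assms in auto)

lemma sorted_even_cols:
  assumes "\<And>t u. i \<le> t \<Longrightarrow> t < u \<Longrightarrow> u \<le> j \<Longrightarrow> R (2*t) (2*u)"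
  shows "sorted_wrt R (even_cols i j)"
  unfolding even_cols_def sorted_wrt_map
  by (rule sorted_wrt_mono_rel[OF _ sorted_wrt_upt]) (use assms in auto)

lemma pivot_word_odd:
  assumes "1 \<le> s"
  shows "pivot_word k (2*s - 1) =
    rev (odd_cols 1 s) @ even_cols 1 (s-1) @ odd_cols (s+1) k @ rev (even_cols s k)"
proof -
  have "odd (2*s - 1)" "(2*s - 1 + 1) div 2 = s" using assms by auto
  then show ?thesis by (simp only: pivot_word_def Let_def if_True not_False_eq_True)
qed

lemma pivot_word_even:
  "pivot_word k (2*s) =
    odd_cols (s+1) k @ rev (even_cols (s+1) k) @ rev (odd_cols 1 s) @ even_cols 1 s"
  by (simp add: pivot_word_def)

lemma pivot_cases:
  fixes p k :: nat
  assumes "p \<in> {1..2*k-1}"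
  obtains s where "1 \<le> s" "s \<le> k" "p = 2*s - 1" | s where "1 \<le> s" "s < k" "p = 2*s"
proof (cases "odd p")
  case True
  then have "p = 2 * ((p+1) div 2) - 1" by presburger
  then show ?thesis using that(1)[of "(p+1) div 2"] assms by auto
next
  case False
  then show ?thesis using that(2)[of "p div 2"] assms by auto
qed

lemma set_pivot_word:
  assumes "p \<in> {1..2*k-1}"
  shows "set (pivot_word k p) = {1..2*k}"
  using assms
proof (cases rule: pivot_cases)
  case (1 s)
  have e: "{1..k} = {1..s} \<union> {s+1..k}" "{1..k} = {1..s-1} \<union> {s..k}"
    using 1 by (simp_all add: set_eq_iff) linarith+
  have *: "(\<lambda>t. 2*t - 1) ` {1..k} = (\<lambda>t. 2*t - 1) ` {1..s} \<union> (\<lambda>t. 2*t - 1) ` {s+1..k}"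
    "(\<lambda>t. 2*t) ` {1..k} = (\<lambda>t. 2*t) ` {1..s-1} \<union> (\<lambda>t. 2*t) ` {s..k}"
    by (simp only: e(1) image_Un, simp only: e(2) image_Un)
  show ?thesis
    unfolding 1(3) pivot_word_odd[OF 1(1)] columns_eq[of k] * set_append set_rev set_odd_cols set_even_cols
    by (simp only: Un_ac)
next
  case (2 s)
  have "{1..k} = {1..s} \<union> {s+1..k}" using 2 by (simp add: set_eq_iff) linarith
  then have "(\<lambda>t. 2*t - 1) ` {1..k} = (\<lambda>t. 2*t - 1) ` {1..s} \<union> (\<lambda>t. 2*t - 1) ` {s+1..k}"
    "(\<lambda>t. 2*t) ` {1..k} = (\<lambda>t. 2*t) ` {1..s} \<union> (\<lambda>t. 2*t) ` {s+1..k}"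
    by (simp_all only: image_Un)
  note * = this
  show ?thesis
    unfolding 2(3) pivot_word_even columns_eq[of k] * set_append set_rev set_odd_cols set_even_cols
    by (simp only: Un_ac)
qed

text \<open>Here the ranks are checked against the literal blocks of W_p: each block is increasing,
  and each lies before the next.\<close>

lemma sorted_pivot_word:
  fixes g :: "nat \<Rightarrow> int"
  assumes p: "p \<in> {1..2*k-1}" and pat: "row_pattern k p x y"
    and g: "\<And>t. g (2*t - 1) = x t" "\<And>t. g (2*t) = y t"
  shows "sorted_wrt (\<lambda>c d. g c < g d) (pivot_word k p)"
  using p
proof (cases rule: pivot_cases)
  case (1 s)
  note P = row_pattern_iff(1-4)[OF p pat, unfolded 1(3) rank_odd[OF 1(1)]]
  show ?thesis
    unfolding 1(3) pivot_word_odd[OF 1(1)] sorted_wrt_append sorted_wrt_rev set_append set_rev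
      set_odd_cols set_even_cols ball_Un ball_simps(9)
    by (intro conjI ballI sorted_odd_cols sorted_even_cols; use 1 in \<open>auto simp: g P simp del: One_nat_def\<close>)
next
  case (2 s)
  note P = row_pattern_iff(1-4)[OF p pat, unfolded 2(3) rank_even]
  show ?thesis
    unfolding 2(3) pivot_word_even sorted_wrt_append sorted_wrt_rev set_append set_rev
      set_odd_cols set_even_cols ball_Un ball_simps(9)
    by (intro conjI ballI sorted_odd_cols sorted_even_cols; use 2 in \<open>auto simp: g P simp del: One_nat_def\<close>)
qed

lemma odd_cols_snoc: "1 \<le> s \<Longrightarrow> odd_cols 1 s = odd_cols 1 (s-1) @ [2*s-1]"
  and even_cols_snoc: "1 \<le> s \<Longrightarrow> even_cols 1 s = even_cols 1 (s-1) @ [2*s]"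
  by (cases s; simp add: odd_cols_def even_cols_def)+

lemma odd_cols_Cons: "s \<le> k \<Longrightarrow> odd_cols s k = (2*s-1) # odd_cols (s+1) k"
  and even_cols_Cons: "s \<le> k \<Longrightarrow> even_cols s k = (2*s) # even_cols (s+1) k"
  by (simp_all add: odd_cols_def even_cols_def upt_conv_Cons del: upt_Suc)

text \<open>The ends of \<open>W\<^sub>p\<close> are the columns \<open>p\<close> and \<open>p+1\<close>, so \<open>p\<close> can be read off \<open>W\<^sub>p\<close> and its reversal.\<close>

lemma hd_last_pivot_word:
  assumes "p \<in> {1..2*k-1}"
  shows "min (hd (pivot_word k p)) (last (pivot_word k p)) = p"
  using assms
proof (cases rule: pivot_cases)
  case (1 s)
  then show ?thesis
    unfolding 1(3) pivot_word_odd[OF 1(1)] odd_cols_snoc[OF 1(1)] even_cols_Cons[OF 1(2)] by simp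
next
  case (2 s)
  then have "s + 1 \<le> k" by simp
  then show ?thesis
    unfolding 2(3) pivot_word_even even_cols_snoc[OF 2(1)] odd_cols_Cons[OF \<open>s + 1 \<le> k\<close>] by simp
qed

lemma pivot_word_inj:
  assumes "p \<in> {1..2*k-1}" "q \<in> {1..2*k-1}"
    and "w \<in> {pivot_word k p, rev (pivot_word k p)}" "w \<in> {pivot_word k q, rev (pivot_word k q)}"
  shows "p = q"
proof -
  have "pivot_word k r \<noteq> []" if "r \<in> {1..2*k-1}" for r
    using set_pivot_word[OF that] that by force
  then have "min (hd w) (last w) = r" if "r \<in> {1..2*k-1}" "w \<in> {pivot_word k r, rev (pivot_word k r)}" for r
    using hd_last_pivot_word[OF that(1)] that by (auto simp: hd_rev last_rev min.commute)
  from this[OF assms(1,3)] this[OF assms(2,4)] show ?thesis by simp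
qed

lemma has_pivot_pair_unique:
  assumes "has_pivot_pair k xs ab" "has_pivot_pair k xs cd"
  shows "ab = cd"
  using assms unfolding has_pivot_pair_def by (metis pivot_word_inj prod.expand)

lemma row_columns_sorted:
  fixes f :: "face \<Rightarrow> int"
  assumes "sorted_wrt (\<lambda>x y. f x < f y) xs" "set xs = faces k"
  shows "sorted_wrt (\<lambda>c d. f (FaceA c) < f (FaceA d)) (map col (filter is_FaceA xs))"
    "sorted_wrt (\<lambda>c d. f (FaceB c) < f (FaceB d)) (map col (filter is_FaceB xs))"
    "set (map col (filter is_FaceA xs)) = {1..2*k}"
    "set (map col (filter is_FaceB xs)) = {1..2*k}"
proof -
  show "sorted_wrt (\<lambda>c d. f (FaceA c) < f (FaceA d)) (map col (filter is_FaceA xs))"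
    unfolding sorted_wrt_map
    by (rule sorted_wrt_mono_rel[OF _ sorted_wrt_filter[OF assms(1)]]) (auto simp: is_FaceA_def)
  show "sorted_wrt (\<lambda>c d. f (FaceB c) < f (FaceB d)) (map col (filter is_FaceB xs))"
    unfolding sorted_wrt_map
    by (rule sorted_wrt_mono_rel[OF _ sorted_wrt_filter[OF assms(1)]]) (auto simp: is_FaceB_def)
  show "set (map col (filter is_FaceA xs)) = {1..2*k}" "set (map col (filter is_FaceB xs)) = {1..2*k}"
  proof -
    have "{x \<in> faces k. is_FaceA x} = FaceA ` {1..2*k}" "{x \<in> faces k. is_FaceB x} = FaceB ` {1..2*k}"
      by (auto simp: faces_def)
    then show "set (map col (filter is_FaceA xs)) = {1..2*k}" "set (map col (filter is_FaceB xs)) = {1..2*k}"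
      by (simp_all only: set_map set_filter assms(2) image_image face.sel image_ident)
  qed
qed

lemma upper_pivot:
  fixes f :: "face \<Rightarrow> int"
  assumes xs: "sorted_wrt (\<lambda>x y. f x < f y) xs" "set xs = faces k"
    and p: "p \<in> {1..2*k-1}" and pat: "row_pattern k p (f \<circ> Ao) (f \<circ> Ae)"
  shows "map col (filter is_FaceA xs) = pivot_word k p"
proof (rule sorted_key_unique[OF row_columns_sorted(1)[OF xs]])
  show "sorted_wrt (\<lambda>c d. f (FaceA c) < f (FaceA d)) (pivot_word k p)"
    by (rule sorted_pivot_word[OF p pat]) (simp_all add: Ao_def Ae_def)
qed (simp only: row_columns_sorted(3)[OF xs] set_pivot_word[OF p])

lemma lower_pivot:
  fixes f :: "face \<Rightarrow> int"
  assumes xs: "sorted_wrt (\<lambda>x y. f x < f y) xs" "set xs = faces k"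
    and p: "p \<in> {1..2*k-1}" and pat: "row_pattern k p (f \<circ> Bo) (f \<circ> Be)"
  shows "map col (filter is_FaceB xs) = pivot_word k p"
proof (rule sorted_key_unique[OF row_columns_sorted(2)[OF xs]])
  show "sorted_wrt (\<lambda>c d. f (FaceB c) < f (FaceB d)) (pivot_word k p)"
    by (rule sorted_pivot_word[OF p pat]) (simp_all add: Bo_def Be_def)
qed (simp only: row_columns_sorted(4)[OF xs] set_pivot_word[OF p])

lemma lower_pivot_rev:
  fixes f :: "face \<Rightarrow> int"
  assumes xs: "sorted_wrt (\<lambda>x y. f x < f y) xs" "set xs = faces k"
    and p: "p \<in> {1..2*k-1}" and pat: "row_pattern k p (\<lambda>t. - (f \<circ> Bo) t) (\<lambda>t. - (f \<circ> Be) t)"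
  shows "map col (filter is_FaceB xs) = rev (pivot_word k p)"
proof (rule sorted_key_unique[OF row_columns_sorted(2)[OF xs]])
  have "sorted_wrt (\<lambda>c d. - f (FaceB c) < - f (FaceB d)) (pivot_word k p)"
    by (rule sorted_pivot_word[OF p pat]) (simp_all add: Bo_def Be_def)
  then show "sorted_wrt (\<lambda>c d. f (FaceB c) < f (FaceB d)) (rev (pivot_word k p))"
    by (simp add: sorted_wrt_rev)
qed (simp only: row_columns_sorted(4)[OF xs] set_pivot_word[OF p] set_rev)

lemma map_reflect_cols:
  assumes "1 \<le> i" "j \<le> k"
  shows "map (\<lambda>c. 2*k+1-c) (odd_cols i j) = rev (even_cols (k+1-j) (k+1-i))"
    "map (\<lambda>c. 2*k+1-c) (even_cols i j) = rev (odd_cols (k+1-j) (k+1-i))"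
  unfolding odd_cols_def even_cols_def
  by (rule nth_equalityI; use assms in \<open>auto simp: rev_nth simp del: upt_Suc\<close>)+

text \<open>The reflection exchanges O_t with D_(k+1-t), so it carries the blocks of W_p to those of
  W_(n-p) in reverse order. This is where \<open>B_L\<close> acquires its argument
  \<open>2*k - p\<close>.\<close>

lemma pivot_word_reflect:
  assumes "p \<in> {1..2*k-1}"
  shows "map (\<lambda>c. 2*k+1-c) (pivot_word k p) = rev (pivot_word k (2*k-p))"
  using assms
proof (cases rule: pivot_cases)
  case (1 s)
  have "2*k - (2*s-1) = 2*(k+1-s) - 1" "1 \<le> k+1-s" "k + 1 - (s + 1) = k+1-s - 1"
    "k + 1 - (s - 1) = k+1-s + 1"
    using 1 by auto
  then show ?thesis using 1 unfolding 1(3)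
    by (simp add: pivot_word_odd rev_map[symmetric] map_reflect_cols del: One_nat_def)
next
  case (2 s)
  have "2*k - 2*s = 2*(k-s)" "k + 1 - (s + 1) = k - s" "k+1-s = k-s+1"
    using 2 by auto
  then show ?thesis using 2 unfolding 2(3)
    by (simp add: pivot_word_even rev_map[symmetric] map_reflect_cols del: One_nat_def)
qed

section \<open>Symmetries\<close>

lemma cross_commute: "cross q p r s = cross p q r s" "cross p q s r = cross p q r s"
  by (simp_all add: cross_def min.commute max.commute)

fun flip_label :: "label \<Rightarrow> label" where
  "flip_label M = V"
| "flip_label V = M"

lemma precede_flip: "precede (flip_label l) x y \<longleftrightarrow> precede l y x"
  by (cases l) (simp_all add: precede_def)

lemma precede_neg: "precede l (- x) (- y) \<longleftrightarrow> precede l y x"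
  by (simp add: precede_def)

text \<open>The effect of reversing the order.\<close>

fun flip_word :: "label_word \<Rightarrow> label_word" where
  "flip_word (h0, h1, u0, u1, l0, l1) =
     (flip_label h0, flip_label h1, flip_label u0, flip_label u1, flip_label l0, flip_label l1)"

text \<open>The effect of \<phi>_R: exchanging the rows turns light faces into dark ones, so every
  label flips, and the labels of U and L change places.\<close>

fun swap_rows :: "label_word \<Rightarrow> label_word" where
  "swap_rows (h0, h1, u0, u1, l0, l1) =
     (flip_label h0, flip_label h1, flip_label l0, flip_label l1, flip_label u0, flip_label u1)"

text \<open>The effect of \<phi>_H: the column parity changes, so every label flips and the two H
  labels change places, whereas U_i goes to U_(2k-i), whose index has the same parity.\<close>

fun reflect_word :: "label_word \<Rightarrow> label_word" where
  "reflect_word (h0, h1, u0, u1, l0, l1) =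
     (flip_label h1, flip_label h0, flip_label u0, flip_label u1, flip_label l0, flip_label l1)"

lemma keys_noncrossing_neg:
  assumes "keys_noncrossing k a a' b b'"
  shows "keys_noncrossing k (\<lambda>t. - a t) (\<lambda>t. - a' t) (\<lambda>t. - b t) (\<lambda>t. - b' t)"
  using assms unfolding keys_noncrossing_def comp_def arcs_noncrossing_neg_iff by blast

lemma keys_precedence_neg:
  assumes "keys_precedence P k a a' b b'"
  shows "keys_precedence (flip_word P) k (\<lambda>t. - a t) (\<lambda>t. - a' t) (\<lambda>t. - b t) (\<lambda>t. - b' t)"
  using assms by (cases P) (simp add: keys_precedence_def precede_flip precede_neg)

lemma keys_noncrossing_swap:
  assumes "keys_noncrossing k a a' b b'"
  shows "keys_noncrossing k b b' a a'"
  using assms unfolding keys_noncrossing_def arcs_noncrossing_def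
  by (simp add: cross_commute)

lemma keys_precedence_swap:
  assumes "keys_precedence P k a a' b b'"
  shows "keys_precedence (swap_rows P) k b b' a a'"
  using assms by (cases P) (auto simp: keys_precedence_def precede_flip)

text \<open>Two reflections are needed: O_t goes to D_(k+1-t), but an even crease 2t goes to the
  crease 2(k-t).\<close>

lemma reflect_all:
  "(\<forall>t\<in>{1..k}. Q (k + 1 - t)) \<longleftrightarrow> (\<forall>t\<in>{1..k::nat}. Q t)"
  "(\<forall>t\<in>{1..<k}. Q (k - t)) \<longleftrightarrow> (\<forall>t\<in>{1..<k}. Q t)"
proof -
  have "bij_betw (\<lambda>t. k + 1 - t) {1..k} {1..k}"
    by (rule bij_betw_byWitness[where f' = "\<lambda>t. k + 1 - t"]) auto
  then show "(\<forall>t\<in>{1..k}. Q (k + 1 - t)) \<longleftrightarrow> (\<forall>t\<in>{1..k}. Q t)"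
    by (rule bij_betw_ball[symmetric])
  have "bij_betw (\<lambda>t. k - t) {1..<k} {1..<k}"
    by (rule bij_betw_byWitness[where f' = "\<lambda>t. k - t"]) auto
  then show "(\<forall>t\<in>{1..<k}. Q (k - t)) \<longleftrightarrow> (\<forall>t\<in>{1..<k}. Q t)"
    by (rule bij_betw_ball[symmetric])
qed

lemma arcs_noncrossing_reflect:
  "arcs_noncrossing {1..k} (\<lambda>t. x (k+1-t)) (\<lambda>t. x' (k+1-t)) (\<lambda>t. y (k+1-t)) (\<lambda>t. y' (k+1-t)) \<longleftrightarrow>
    arcs_noncrossing {1..k} x x' y y'"
  "arcs_noncrossing {1..<k} (\<lambda>t. x (k-t)) (\<lambda>t. x' (k-t)) (\<lambda>t. y (k-t)) (\<lambda>t. y' (k-t)) \<longleftrightarrow>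
    arcs_noncrossing {1..<k} x x' y y'"
  unfolding arcs_noncrossing_def
  by (subst reflect_all(1), subst reflect_all(1), rule refl)
    (subst reflect_all(2), subst reflect_all(2), rule refl)

lemma arcs_noncrossing_cong:
  "(\<And>t. t \<in> I \<Longrightarrow> x t = z t \<and> x' t = z' t \<and> y t = w t \<and> y' t = w' t) \<Longrightarrow>
    arcs_noncrossing I x x' y y' = arcs_noncrossing I z z' w w'"
  by (simp add: arcs_noncrossing_def)

lemma keys_noncrossing_reflect:
  assumes "keys_noncrossing k a a' b b'"
  shows "keys_noncrossing k (\<lambda>t. a' (k+1-t)) (\<lambda>t. a (k+1-t)) (\<lambda>t. b' (k+1-t)) (\<lambda>t. b (k+1-t))"
proof -
  have W: "arcs_noncrossing {1..<k} (\<lambda>t. x' (k + 1 - Suc t)) (\<lambda>t. x (k+1-t)) (\<lambda>t. y' (k + 1 - Suc t)) (\<lambda>t. y (k+1-t))"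
    if "arcs_noncrossing {1..<k} (x \<circ> Suc) x' (y \<circ> Suc) y'" for x x' y y'
  proof -
    have "arcs_noncrossing {1..<k} x' (x \<circ> Suc) y' (y \<circ> Suc)"
      using that by (simp add: arcs_noncrossing_def cross_commute)
    then have "arcs_noncrossing {1..<k} (\<lambda>t. x' (k-t)) (\<lambda>t. (x \<circ> Suc) (k-t)) (\<lambda>t. y' (k-t)) (\<lambda>t. (y \<circ> Suc) (k-t))"
      by (simp only: arcs_noncrossing_reflect)
    then show ?thesis
      by (rule iffD1[OF arcs_noncrossing_cong, rotated]) (simp add: Suc_diff_le)
  qed
  have E: "arcs_noncrossing {1..k} x' x y' y" if "arcs_noncrossing {1..k} x x' y y'" for x x' y y'
    using that by (simp add: arcs_noncrossing_def cross_commute)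
  note n = assms[unfolded keys_noncrossing_def]
  show ?thesis
    unfolding keys_noncrossing_def arcs_noncrossing_reflect(1) comp_def
    using n E[of a a' a a'] E[of a a' b b'] E[of b b' a a'] E[of b b' b b']
      W[of a a' a a'] W[of a a' b b'] W[of b b' a a'] W[of b b' b b'] by blast
qed

lemma keys_precedence_reflect:
  assumes "keys_precedence P k a a' b b'"
  shows "keys_precedence (reflect_word P) k
    (\<lambda>t. a' (k+1-t)) (\<lambda>t. a (k+1-t)) (\<lambda>t. b' (k+1-t)) (\<lambda>t. b (k+1-t))"
proof -
  obtain h0 h1 u0 u1 l0 l1 where P: "P = (h0, h1, u0, u1, l0, l1)" by (cases P)
  have 1: "\<forall>t\<in>{1..k}. precede h0 (a t) (b t) \<and> precede h1 (b' t) (a' t) \<and> precede u0 (a t) (a' t) \<and> precede l0 (b' t) (b t)"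
    and 2: "\<forall>t\<in>{1..<k}. precede u1 (a (Suc t)) (a' t) \<and> precede l1 (b' t) (b (Suc t))"
    using assms by (simp_all add: P keys_precedence_def)
  have s: "Suc (k - t) = k + 1 - t" if "t \<in> {1..<k}" for t using that by auto
  show ?thesis
    using iffD2[OF reflect_all(1), OF 1] iffD2[OF reflect_all(2), OF 2]
    by (simp add: P keys_precedence_def precede_flip s)
qed

section \<open>Action of the symmetry maps on valid orders\<close>

lemma face_mem_iff: "FaceA c \<in> faces k \<longleftrightarrow> 1 \<le> c \<and> c \<le> 2*k" "FaceB c \<in> faces k \<longleftrightarrow> 1 \<le> c \<and> c \<le> 2*k"
  by (auto simp: faces_def)

lemma phi_R_phi_R: "phi_R (phi_R x) = x"
  by (cases x) auto

lemma phi_H_phi_H: "x \<in> faces k \<Longrightarrow> phi_H k (phi_H k x) = x"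
  by (cases x) (auto simp: face_mem_iff)

lemma image_involution:
  assumes "\<And>x. x \<in> S \<Longrightarrow> g x \<in> S" "\<And>x. x \<in> S \<Longrightarrow> g (g x) = x"
  shows "g ` S = S"
  using assms by force

lemma phi_faces: "phi_R ` faces k = faces k" "phi_H k ` faces k = faces k"
proof -
  show "phi_R ` faces k = faces k"
  proof (rule image_involution)
    show "x \<in> faces k \<Longrightarrow> phi_R x \<in> faces k" for x by (cases x) (auto simp: face_mem_iff)
  qed (rule phi_R_phi_R)
  show "phi_H k ` faces k = faces k"
  proof (rule image_involution)
    show "x \<in> faces k \<Longrightarrow> phi_H k x \<in> faces k" for x by (cases x) (auto simp: face_mem_iff)
  qed (rule phi_H_phi_H)
qed

lemma order_valid_rev:
  assumes "order_valid P k xs"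
  shows "order_valid (flip_word P) k (rev xs)"
proof -
  obtain f :: "face \<Rightarrow> int" where f: "sorted_wrt (\<lambda>x y. f x < f y) xs" "set xs = faces k"
    "valid_keys P k (f \<circ> Ao) (f \<circ> Ae) (f \<circ> Bo) (f \<circ> Be)"
    using order_valid_keys[OF assms] by blast
  have "sorted_wrt (\<lambda>x y. - f x < - f y) (rev xs)" "set (rev xs) = faces k"
    using f by (simp_all add: sorted_wrt_rev)
  note iff = order_valid_iff_keys[OF this]
  show ?thesis unfolding iff
    using f(3) keys_noncrossing_neg keys_precedence_neg unfolding valid_keys_def comp_def by blast
qed

lemma order_valid_phi_R:
  assumes "order_valid P k xs"
  shows "order_valid (swap_rows P) k (map phi_R xs)"
proof -
  obtain f :: "face \<Rightarrow> int" where f: "sorted_wrt (\<lambda>x y. f x < f y) xs" "set xs = faces k"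
    "valid_keys P k (f \<circ> Ao) (f \<circ> Ae) (f \<circ> Bo) (f \<circ> Be)"
    using order_valid_keys[OF assms] by blast
  have "sorted_wrt (\<lambda>x y. f (phi_R x) < f (phi_R y)) (map phi_R xs)"
    using f(1) by (simp add: sorted_wrt_map phi_R_phi_R)
  moreover have "set (map phi_R xs) = faces k" by (simp add: f(2) phi_faces)
  ultimately have iff: "order_valid Q k (map phi_R xs) \<longleftrightarrow>
     keys_precedence Q k ((\<lambda>x. f (phi_R x)) \<circ> Ao) ((\<lambda>x. f (phi_R x)) \<circ> Ae) ((\<lambda>x. f (phi_R x)) \<circ> Bo) ((\<lambda>x. f (phi_R x)) \<circ> Be) \<and>
     keys_noncrossing k ((\<lambda>x. f (phi_R x)) \<circ> Ao) ((\<lambda>x. f (phi_R x)) \<circ> Ae) ((\<lambda>x. f (phi_R x)) \<circ> Bo) ((\<lambda>x. f (phi_R x)) \<circ> Be)" for Q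
    by (rule order_valid_iff_keys)
  have e: "(\<lambda>x. f (phi_R x)) \<circ> Ao = f \<circ> Bo" "(\<lambda>x. f (phi_R x)) \<circ> Ae = f \<circ> Be"
    "(\<lambda>x. f (phi_R x)) \<circ> Bo = f \<circ> Ao" "(\<lambda>x. f (phi_R x)) \<circ> Be = f \<circ> Ae"
    by (simp_all add: fun_eq_iff Ao_def Ae_def Bo_def Be_def)
  show ?thesis unfolding iff e
    using f(3) keys_noncrossing_swap keys_precedence_swap unfolding valid_keys_def by blast
qed

text \<open>Natural subtraction makes the reflected sequences agree with the intended ones only
  inside the range 1..k, so equality of functions is replaced by congruence on that range.\<close>

lemma keys_precedence_cong:
  assumes "\<And>t. t \<in> {1..k} \<Longrightarrow> a t = c t \<and> a' t = c' t \<and> b t = d t \<and> b' t = d' t"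
  shows "keys_precedence P k a a' b b' = keys_precedence P k c c' d d'"
  using assms by (simp add: keys_precedence_def)

lemma keys_noncrossing_cong:
  assumes "\<And>t. t \<in> {1..k} \<Longrightarrow> a t = c t \<and> a' t = c' t \<and> b t = d t \<and> b' t = d' t"
  shows "keys_noncrossing k a a' b b' = keys_noncrossing k c c' d d'"
  using assms by (simp add: keys_noncrossing_def arcs_noncrossing_def)

lemma order_valid_phi_H:
  assumes "order_valid P k xs"
  shows "order_valid (reflect_word P) k (map (phi_H k) xs)"
proof -
  obtain f :: "face \<Rightarrow> int" where f: "sorted_wrt (\<lambda>x y. f x < f y) xs" "set xs = faces k"
    "valid_keys P k (f \<circ> Ao) (f \<circ> Ae) (f \<circ> Bo) (f \<circ> Be)"
    using order_valid_keys[OF assms] by blast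
  define g where "g x = f (phi_H k x)" for x
  have "sorted_wrt (\<lambda>x y. g x < g y) (map (phi_H k) xs)"
    unfolding sorted_wrt_map
    by (rule sorted_wrt_mono_rel[OF _ f(1)]) (simp add: g_def f(2) phi_H_phi_H)
  moreover have "set (map (phi_H k) xs) = faces k" by (simp add: f(2) phi_faces)
  ultimately have iff: "order_valid Q k (map (phi_H k) xs) \<longleftrightarrow>
     keys_precedence Q k (g \<circ> Ao) (g \<circ> Ae) (g \<circ> Bo) (g \<circ> Be) \<and>
     keys_noncrossing k (g \<circ> Ao) (g \<circ> Ae) (g \<circ> Bo) (g \<circ> Be)" for Q
    by (rule order_valid_iff_keys)
  have e: "(g \<circ> Ao) t = (\<lambda>t. (f \<circ> Ae) (k+1-t)) t \<and> (g \<circ> Ae) t = (\<lambda>t. (f \<circ> Ao) (k+1-t)) t \<and>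
    (g \<circ> Bo) t = (\<lambda>t. (f \<circ> Be) (k+1-t)) t \<and> (g \<circ> Be) t = (\<lambda>t. (f \<circ> Bo) (k+1-t)) t" if "t \<in> {1..k}" for t
  proof -
    have "2*k+1 - (2*t-1) = 2*(k+1-t)" "2*k+1-2*t = 2*(k+1-t) - 1" using that by auto
    then show ?thesis by (simp only: comp_def g_def Ao_def Ae_def Bo_def Be_def phi_H.simps simp_thms)
  qed
  have "keys_precedence (reflect_word P) k (g \<circ> Ao) (g \<circ> Ae) (g \<circ> Bo) (g \<circ> Be) \<longleftrightarrow>
    keys_precedence (reflect_word P) k (\<lambda>t. (f \<circ> Ae) (k+1-t)) (\<lambda>t. (f \<circ> Ao) (k+1-t))
      (\<lambda>t. (f \<circ> Be) (k+1-t)) (\<lambda>t. (f \<circ> Bo) (k+1-t))"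
    by (rule keys_precedence_cong) (rule e)
  moreover have "keys_noncrossing k (g \<circ> Ao) (g \<circ> Ae) (g \<circ> Bo) (g \<circ> Be) \<longleftrightarrow>
    keys_noncrossing k (\<lambda>t. (f \<circ> Ae) (k+1-t)) (\<lambda>t. (f \<circ> Ao) (k+1-t))
      (\<lambda>t. (f \<circ> Be) (k+1-t)) (\<lambda>t. (f \<circ> Bo) (k+1-t))"
    by (rule keys_noncrossing_cong) (rule e)
  ultimately show ?thesis
    unfolding iff using f(3) keys_noncrossing_reflect keys_precedence_reflect
    unfolding valid_keys_def by blast
qed

section \<open>Local flat-foldability and transport of the state sets\<close>

lemma card_four:
  assumes "distinct [a, b, c, d]"
  shows "card {x \<in> {a, b, c, d}. Q x} = of_bool (Q a) + of_bool (Q b) + of_bool (Q c) + of_bool (Q d)"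
proof -
  have "card {x \<in> {a, b, c, d}. Q x} = (\<Sum>x\<in>{a, b, c, d}. of_bool (Q x))"
    by (simp add: Int_def)
  then show ?thesis using assms by simp
qed

text \<open>Among four labels the number of M is odd iff the number of V is, that is, iff the
  product of the signs is -1. Consecutive H creases carry both h labels, so this product at vertex c
  is \<delta> with index (c-1) mod 2.\<close>

lemma locally_flat_foldable_iff:
  assumes "k \<ge> 2"
  shows "locally_flat_foldable P k \<longleftrightarrow> delta 0 P = -1 \<and> delta 1 P = -1"
proof -
  obtain h0 h1 u0 u1 l0 l1 where P: "P = (h0, h1, u0, u1, l0, l1)" by (cases P)
  have odd4: "odd (of_bool (p = M) + of_bool (q = M) + of_bool (r = M) + of_bool (s = M) :: nat) \<longleftrightarrow>
     label_sign p * label_sign q * label_sign r * label_sign s = -1" for p q r s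
    by (cases p; cases q; cases r; cases s) simp_all
  have vertex: "odd (card {x \<in> {CrH c, CrH (c+1), CrU c, CrL c}. assigned P x = M}) \<longleftrightarrow>
    delta ((c - 1) mod 2) P = -1" if "1 \<le> c" for c
  proof -
    have "odd (card {x \<in> {CrH c, CrH (c+1), CrU c, CrL c}. assigned P x = M}) \<longleftrightarrow>
      label_sign (assigned P (CrH c)) * label_sign (assigned P (CrH (c+1))) *
      label_sign (assigned P (CrU c)) * label_sign (assigned P (CrL c)) = -1"
      by (subst card_four) (simp_all only: odd4, simp)
    moreover have "(c - 1) mod 2 = 0 \<and> c mod 2 = 1 \<or> (c - 1) mod 2 = 1 \<and> c mod 2 = 0"
      using that by presburger
    ultimately show ?thesis by (auto simp: P delta_def mult_ac)
  qed
  show ?thesis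
  proof
    assume "locally_flat_foldable P k"
    then have "\<forall>c\<in>{1..2*k-1}. delta ((c - 1) mod 2) P = -1"
      using vertex by (simp add: locally_flat_foldable_def)
    \<comment> \<open>The vertices c = 1 and c = 2 exist and yield the two indices.\<close>
    then have "delta ((1 - 1) mod 2) P = -1" "delta ((2 - 1) mod 2) P = -1"
      using assms by fastforce+
    then show "delta 0 P = -1 \<and> delta 1 P = -1" by simp
  next
    assume "delta 0 P = -1 \<and> delta 1 P = -1"
    then have "delta ((c - 1) mod 2) P = -1" for c by (cases "even (c - 1)") (simp_all add: even_iff_mod_2_eq_zero odd_iff_mod_2_eq_one)
    then show "locally_flat_foldable P k" using vertex by (simp add: locally_flat_foldable_def)
  qed
qed

lemma label_sign_flip: "label_sign (flip_label l) = - label_sign l"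
  by (cases l) simp_all

lemma delta_transform:
  "delta i (flip_word P) = delta i P" "delta i (swap_rows P) = delta i P"
  "delta i (reflect_word P) = delta i P"
  by (cases P; simp add: delta_def label_sign_flip mult_ac)+

lemma word_involutions:
  "flip_word (flip_word P) = P" "swap_rows (swap_rows P) = P" "reflect_word (reflect_word P) = P"
proof -
  have "flip_label (flip_label l) = l" for l by (cases l) simp_all
  then show "flip_word (flip_word P) = P" "swap_rows (swap_rows P) = P" "reflect_word (reflect_word P) = P"
    by (cases P; simp)+
qed

lemma F_eq:
  assumes "k \<ge> 2"
  shows "F P k = (if delta 0 P = -1 \<and> delta 1 P = -1 then {xs. order_valid P k xs} else {})"
  using assms by (simp add: F_def locally_flat_foldable_iff)

text \<open>\<open>T\<close> is required to be an involution only on lists of all faces, because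
  \<phi>_H, with its truncated subtraction, is one only there.\<close>

lemma F_image:
  assumes k: "k \<ge> 2" and d: "delta 0 P' = delta 0 P" "delta 1 P' = delta 1 P"
    and T: "\<And>xs. order_valid P k xs \<Longrightarrow> order_valid P' k (T xs)"
      "\<And>xs. order_valid P' k xs \<Longrightarrow> order_valid P k (T xs)"
      "\<And>xs. set xs = faces k \<Longrightarrow> T (T xs) = xs"
  shows "F P' k = T ` F P k"
proof -
  have "T (T xs) = xs" if "order_valid P' k xs" for xs
    using that T(3) by (simp add: order_valid_def total_order_of_faces_def)
  then have "{xs. order_valid P' k xs} = T ` {xs. order_valid P k xs}"
    using T(1,2) by force
  then show ?thesis using k d by (simp add: F_eq)
qed

lemma F_transform:
  assumes "k \<ge> 2"
  shows "F (flip_word P) k = T_C ` F P k" "F (swap_rows P) k = T_CR ` F P k"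
    "F (reflect_word P) k = T_CH k ` F P k"
proof -
  show "F (flip_word P) k = T_C ` F P k"
    using order_valid_rev[of P k] order_valid_rev[of "flip_word P" k]
    by (intro F_image[OF assms]) (simp_all add: delta_transform word_involutions T_C_def)
  show "F (swap_rows P) k = T_CR ` F P k"
    using order_valid_phi_R[of P k] order_valid_phi_R[of "swap_rows P" k]
    by (intro F_image[OF assms]) (simp_all add: delta_transform word_involutions T_CR_def phi_R_phi_R comp_def)
  show "F (reflect_word P) k = T_CH k ` F P k"
  proof (rule F_image[OF assms])
    show "T_CH k (T_CH k xs) = xs" if "set xs = faces k" for xs
      unfolding T_CH_def map_map comp_def by (rule map_idI) (simp add: that phi_H_phi_H)
  qed (use order_valid_phi_H[of P k] order_valid_phi_H[of "reflect_word P" k] in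
      \<open>simp_all add: delta_transform word_involutions T_CH_def\<close>)
qed

lemma F_transform_rev:
  assumes "k \<ge> 2"
  shows "F (flip_word (swap_rows P)) k = T_R ` F P k" "F (flip_word (reflect_word P)) k = T_H k ` F P k"
  unfolding F_transform[OF assms] image_image
  by (simp_all add: T_R_def T_H_def T_C_def T_CR_def T_CH_def)

section \<open>The pleat words\<close>

lemma Omega_plus_Suc: "Omega_plus (Suc k) = Omega_plus k @ [Ao (Suc k), Bo (Suc k), Be (Suc k), Ae (Suc k)]"
  by (simp add: Omega_plus_def Ao_def Bo_def Be_def Ae_def)

lemma set_Omega_plus: "set (Omega_plus k) = faces k"
proof -
  have "set (Omega_plus k) = (\<Union>t\<in>{1..k}. {Ao t, Bo t, Be t, Ae t})"
    by (induction k) (simp add: Omega_plus_def, auto simp: Omega_plus_Suc atLeastAtMostSuc_conv)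
  then show ?thesis unfolding faces_eq by blast
qed

lemma keys_precedence_pleat_plus:
  "keys_precedence (M,M,M,V,V,M) k a a' b b' \<longleftrightarrow>
     (\<forall>t\<in>{1..k}. a t < b t \<and> b' t < a' t \<and> a t < a' t \<and> b t < b' t) \<and>
     (\<forall>t\<in>{1..<k}. a' t < a (Suc t) \<and> b' t < b (Suc t))"
  by (simp add: keys_precedence_def precede_def)

lemma keys_precedence_pleat_minus:
  "keys_precedence (M,V,M,V,M,V) k a a' b b' \<longleftrightarrow>
     (\<forall>t\<in>{1..k}. a t < b t \<and> a' t < b' t \<and> a t < a' t \<and> b' t < b t) \<and>
     (\<forall>t\<in>{1..<k}. a' t < a (Suc t) \<and> b (Suc t) < b' t)"
  by (simp add: keys_precedence_def precede_def)

text \<open>The creases contain the path A_(2q-1), B_(2q-1), B_(2q), A_(2q), A_(2q+1), which runs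
  through all faces, and every crease on it points forward. The bound by \<open>Ae k\<close> lets
  the next block be appended.\<close>

lemma sorted_Omega_plus:
  fixes f :: "face \<Rightarrow> int"
  assumes "1 \<le> k" "keys_precedence (M,M,M,V,V,M) k (f \<circ> Ao) (f \<circ> Ae) (f \<circ> Bo) (f \<circ> Be)"
  shows "sorted_wrt (\<lambda>x y. f x < f y) (Omega_plus k) \<and> (\<forall>x\<in>set (Omega_plus k). f x \<le> f (Ae k))"
  using assms unfolding keys_precedence_pleat_plus comp_def
proof (induction k rule: nat_induct_at_least)
  case base
  then show ?case using Omega_plus_Suc[of 0] by (auto simp: Omega_plus_def)
next
  case (Suc k)
  then have IH: "sorted_wrt (\<lambda>x y. f x < f y) (Omega_plus k)" "\<And>x. x \<in> set (Omega_plus k) \<Longrightarrow> f x \<le> f (Ae k)"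
    by auto
  have "f (Ae k) < f (Ao (Suc k))" "f (Ao (Suc k)) < f (Bo (Suc k))" "f (Bo (Suc k)) < f (Be (Suc k))"
    "f (Be (Suc k)) < f (Ae (Suc k))"
    using Suc.prems Suc.hyps by auto
  with IH show ?case by (fastforce simp: Omega_plus_Suc sorted_wrt_append)
qed

lemma F_pleat_plus:
  assumes "k \<ge> 2"
  shows "F (M,M,M,V,V,M) k = {Omega_plus k}"
proof -
  let ?P = "(M,M,M,V,V,M)"
  \<comment> \<open>Gives the four faces of Q_q the values 4q, 4q+1, 4q+2, 4q+3 in their
    order.\<close>
  define f :: "face \<Rightarrow> int" where
    "f x = 2 * int (col x) + (if is_FaceA x = odd (col x) then 2 else 3)" for x
  have f: "f (Ao t) = 4 * int t" "f (Ae t) = 4 * int t + 3" "f (Bo t) = 4 * int t + 1"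
    "f (Be t) = 4 * int t + 2" if "1 \<le> t" for t
    using that by (auto simp: f_def Ao_def Ae_def Bo_def Be_def)
  have P: "keys_precedence ?P k (f \<circ> Ao) (f \<circ> Ae) (f \<circ> Bo) (f \<circ> Be)"
    unfolding keys_precedence_pleat_plus comp_def by (simp add: f)
  have N: "keys_noncrossing k (f \<circ> Ao) (f \<circ> Ae) (f \<circ> Bo) (f \<circ> Be)"
    unfolding keys_noncrossing_def
    by (intro conjI; unfold arcs_noncrossing_def cross_def comp_def, intro ballI)
      (auto simp: f min_def max_def split: if_splits)
  have "sorted_wrt (\<lambda>x y. f x < f y) (Omega_plus k)"
    using assms by (intro sorted_Omega_plus[OF _ P, THEN conjunct1]) simp
  then have "order_valid ?P k (Omega_plus k)"
    using order_valid_iff_keys[OF _ set_Omega_plus] P N by blast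
  moreover have "xs = Omega_plus k" if v: "order_valid ?P k xs" for xs
  proof -
    obtain g :: "face \<Rightarrow> int" where g: "sorted_wrt (\<lambda>x y. g x < g y) xs" "set xs = faces k"
      "valid_keys ?P k (g \<circ> Ao) (g \<circ> Ae) (g \<circ> Bo) (g \<circ> Be)"
      using order_valid_keys[OF v] by blast
    show ?thesis
      by (rule sorted_key_unique[OF g(1)])
        (use sorted_Omega_plus[of k g] g assms in \<open>auto simp: valid_keys_def set_Omega_plus\<close>)
  qed
  ultimately have "{xs. order_valid ?P k xs} = {Omega_plus k}" by blast
  then show ?thesis using assms by (simp add: F_eq delta_def)
qed

lemma step_mono:
  fixes g :: "nat \<Rightarrow> int"
  assumes "\<And>c. 1 \<le> c \<Longrightarrow> c < n \<Longrightarrow> g c < g (Suc c)" "1 \<le> c" "c < d" "d \<le> n"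
  shows "g c < g d"
  using assms(3,4)
proof (induction d)
  case (Suc d)
  then show ?case using assms(1)[of d] assms(2) by (cases "c = d") auto
qed simp

lemma set_Omega_minus: "set (Omega_minus k) = faces k"
  by (auto simp: Omega_minus_def faces_def simp del: upt_Suc)

text \<open>Again a directed path through all faces: along the upper row, down the last H crease,
  and back along the lower row.\<close>

lemma sorted_Omega_minus:
  fixes f :: "face \<Rightarrow> int"
  assumes k: "1 \<le> k" and P: "keys_precedence (M,V,M,V,M,V) k (f \<circ> Ao) (f \<circ> Ae) (f \<circ> Bo) (f \<circ> Be)"
  shows "sorted_wrt (\<lambda>x y. f x < f y) (Omega_minus k)"
proof -
  have step: "f (FaceA c) < f (FaceA (Suc c)) \<and> - f (FaceB c) < - f (FaceB (Suc c))"
    if "1 \<le> c" "c < 2*k" for c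
  proof (cases "odd c")
    case True
    then obtain t where "c = 2*t + 1" by (auto elim: oddE)
    then have "c = 2 * Suc t - 1" "Suc c = 2 * Suc t" "Suc t \<in> {1..k}" using that by auto
    then show ?thesis
      using P unfolding keys_precedence_pleat_minus comp_def Ao_def Ae_def Bo_def Be_def
      by (metis neg_less_iff_less)
  next
    case False
    then obtain t where "c = 2*t" by (auto elim: evenE)
    then have "c = 2 * t" "Suc c = 2 * Suc t - 1" "t \<in> {1..<k}" using that by auto
    then show ?thesis
      using P unfolding keys_precedence_pleat_minus comp_def Ao_def Ae_def Bo_def Be_def
      by (metis neg_less_iff_less)
  qed
  have A: "f (FaceA c) < f (FaceA d)" if "1 \<le> c" "c < d" "d \<le> 2*k" for c d
    using step_mono[of "2*k" "\<lambda>c. f (FaceA c)"] step that by blast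
  have B: "f (FaceB d) < f (FaceB c)" if "1 \<le> c" "c < d" "d \<le> 2*k" for c d
    using step_mono[of "2*k" "\<lambda>c. - f (FaceB c)" c d] step that by simp
  have top: "f (FaceA (2*k)) < f (FaceB (2*k))"
    using P k unfolding keys_precedence_pleat_minus comp_def Ae_def Be_def by auto
  have "f (FaceA c) < f (FaceB d)" if "c \<in> {1..2*k}" "d \<in> {1..2*k}" for c d
  proof -
    have "f (FaceA c) \<le> f (FaceA (2*k))" using A[of c "2*k"] that by (cases "c = 2*k") auto
    moreover have "f (FaceB (2*k)) \<le> f (FaceB d)" using B[of d "2*k"] that by (cases "d = 2*k") auto
    ultimately show ?thesis using top by linarith
  qed
  then show ?thesis
    unfolding Omega_minus_def sorted_wrt_append sorted_wrt_rev sorted_wrt_map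
    by (intro conjI sorted_wrt_mono_rel[OF _ sorted_wrt_upt]) (use A B in \<open>auto simp del: upt_Suc\<close>)
qed

lemma F_pleat_minus:
  assumes "k \<ge> 2"
  shows "F (M,V,M,V,M,V) k = {Omega_minus k}"
proof -
  let ?P = "(M,V,M,V,M,V)"
  \<comment> \<open>The keys of A_c and B_c add up to 10k, so the H arcs are nested; the factor 10
    only separates the rows.\<close>
  define f :: "face \<Rightarrow> int" where
    "f x = (if is_FaceA x then int (col x) else 10 * int k - int (col x))" for x
  have f: "f (Ao t) = 2 * int t - 1" "f (Ae t) = 2 * int t" "f (Bo t) = 10 * int k - 2 * int t + 1"
    "f (Be t) = 10 * int k - 2 * int t" if "1 \<le> t" for t
    using that by (auto simp: f_def Ao_def Ae_def Bo_def Be_def)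
  have P: "keys_precedence ?P k (f \<circ> Ao) (f \<circ> Ae) (f \<circ> Bo) (f \<circ> Be)"
    unfolding keys_precedence_pleat_minus comp_def by (simp add: f)
  have N: "keys_noncrossing k (f \<circ> Ao) (f \<circ> Ae) (f \<circ> Bo) (f \<circ> Be)"
    unfolding keys_noncrossing_def
    by (intro conjI; unfold arcs_noncrossing_def cross_def comp_def, intro ballI)
      (auto simp: f min_def max_def split: if_splits)
  have "sorted_wrt (\<lambda>x y. f x < f y) (Omega_minus k)"
    using assms by (intro sorted_Omega_minus[OF _ P]) simp
  then have "order_valid ?P k (Omega_minus k)"
    using order_valid_iff_keys[OF _ set_Omega_minus] P N by blast
  moreover have "xs = Omega_minus k" if v: "order_valid ?P k xs" for xs
  proof -
    obtain g :: "face \<Rightarrow> int" where g: "sorted_wrt (\<lambda>x y. g x < g y) xs" "set xs = faces k"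
      "valid_keys ?P k (g \<circ> Ao) (g \<circ> Ae) (g \<circ> Bo) (g \<circ> Be)"
      using order_valid_keys[OF v] by blast
    show ?thesis
      by (rule sorted_key_unique[OF g(1)])
        (use sorted_Omega_minus[of k g] g assms in \<open>auto simp: valid_keys_def set_Omega_minus\<close>)
  qed
  ultimately have "{xs. order_valid ?P k xs} = {Omega_minus k}" by blast
  then show ?thesis using assms by (simp add: F_eq delta_def)
qed

section \<open>Classification by pivot pairs\<close>

text \<open>A bijection stated through the relation \<open>has_pivot_pair\<close> instead of the
  description in \<open>pivot_pair\<close>, a form that is easily carried along the
  symmetries.\<close>

definition pivot_classified :: "nat \<Rightarrow> face list set \<Rightarrow> (nat \<times> nat) set \<Rightarrow> bool" where
  "pivot_classified k X S \<longleftrightarrow> (\<forall>xs\<in>X. \<exists>ab\<in>S. has_pivot_pair k xs ab) \<and>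
     (\<forall>xs\<in>X. \<forall>ys\<in>X. \<forall>ab. has_pivot_pair k xs ab \<longrightarrow> has_pivot_pair k ys ab \<longrightarrow> xs = ys) \<and>
     (\<forall>ab\<in>S. \<exists>xs\<in>X. has_pivot_pair k xs ab)"

lemma pivot_classified_bij:
  assumes "pivot_classified k X S"
  shows "\<forall>xs\<in>X. \<exists>!ab. has_pivot_pair k xs ab" "bij_betw (pivot_pair k) X S"
proof -
  show "\<forall>xs\<in>X. \<exists>!ab. has_pivot_pair k xs ab"
    using assms has_pivot_pair_unique unfolding pivot_classified_def by blast
  have eq: "pivot_pair k xs = ab" if "has_pivot_pair k xs ab" for xs ab
    unfolding pivot_pair_def using that has_pivot_pair_unique by blast
  have has: "has_pivot_pair k xs (pivot_pair k xs) \<and> pivot_pair k xs \<in> S" if "xs \<in> X" for xs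
    using assms that eq unfolding pivot_classified_def by metis
  show "bij_betw (pivot_pair k) X S"
  proof (rule bij_betw_imageI)
    show "inj_on (pivot_pair k) X"
      using has assms unfolding pivot_classified_def inj_on_def by metis
    show "pivot_pair k ` X = S"
    proof
      show "S \<subseteq> pivot_pair k ` X" using assms eq unfolding pivot_classified_def by (metis image_eqI subsetI)
    qed (use has in auto)
  qed
qed

lemma has_pivot_pair_rev: "has_pivot_pair k (rev xs) ab \<longleftrightarrow> has_pivot_pair k xs ab"
proof -
  have "rev w \<in> {v, rev v} \<longleftrightarrow> w \<in> {v, rev v}" for v w :: "nat list" by auto
  then show ?thesis unfolding has_pivot_pair_def rev_filter[symmetric] rev_map[symmetric] by simp
qed

lemma has_pivot_pair_phi_R:
  "has_pivot_pair k (map phi_R xs) (\<beta>, \<alpha>) \<longleftrightarrow> has_pivot_pair k xs (\<alpha>, \<beta>)"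
proof -
  have "is_FaceA (phi_R x) = is_FaceB x" "is_FaceB (phi_R x) = is_FaceA x" "col (phi_R x) = col x" for x
    by (cases x; simp)+
  then show ?thesis by (auto simp: has_pivot_pair_def filter_map comp_def)
qed

lemma has_pivot_pair_phi_H:
  assumes "has_pivot_pair k xs (\<alpha>, \<beta>)"
  shows "has_pivot_pair k (map (phi_H k) xs) (2*k-\<alpha>, 2*k-\<beta>)"
proof -
  have phi: "is_FaceA (phi_H k x) = is_FaceA x" "is_FaceB (phi_H k x) = is_FaceB x"
    "col (phi_H k x) = 2*k+1 - col x" for x
    by (cases x; simp)+
  have w: "map (\<lambda>c. 2*k+1-c) v \<in> {pivot_word k (2*k-p), rev (pivot_word k (2*k-p))}"
    if "p \<in> {1..2*k-1}" "v \<in> {pivot_word k p, rev (pivot_word k p)}" for p v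
    using that(2) pivot_word_reflect[OF that(1)] by (auto simp: rev_map[symmetric])
  have "map col (filter R (map (phi_H k) xs)) = map (\<lambda>c. 2*k+1-c) (map col (filter R xs))"
    if "R = is_FaceA \<or> R = is_FaceB" for R
    using that phi by (auto simp: filter_map comp_def)
  note row = this[of is_FaceA, OF disjI1[OF refl]] this[of is_FaceB, OF disjI2[OF refl]]
  have r: "\<alpha> \<in> {1..2*k-1}" "\<beta> \<in> {1..2*k-1}"
    "map col (filter is_FaceA xs) \<in> {pivot_word k \<alpha>, rev (pivot_word k \<alpha>)}"
    "map col (filter is_FaceB xs) \<in> {pivot_word k \<beta>, rev (pivot_word k \<beta>)}"
    using assms unfolding has_pivot_pair_def fst_conv snd_conv by blast+
  have "2*k-\<alpha> \<in> {1..2*k-1}" "2*k-\<beta> \<in> {1..2*k-1}" using r(1,2) by auto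
  then show ?thesis
    unfolding has_pivot_pair_def fst_conv snd_conv row using w r by blast
qed

lemma pivot_classified_rev:
  assumes "pivot_classified k X S"
  shows "pivot_classified k (T_C ` X) S"
  using assms unfolding pivot_classified_def T_C_def ball_simps(9) bex_simps(7) has_pivot_pair_rev by blast

lemma pivot_classified_swap:
  assumes "pivot_classified k X S"
  shows "pivot_classified k (T_CR ` X) (prod.swap ` S)"
proof -
  have h: "has_pivot_pair k (map phi_R xs) ab \<longleftrightarrow> has_pivot_pair k xs (prod.swap ab)" for xs ab
    by (cases ab) (simp add: has_pivot_pair_phi_R)
  show ?thesis
    using assms unfolding pivot_classified_def T_CR_def ball_simps(9) bex_simps(7) h swap_swap by blast
qed

text \<open>\<open>has_pivot_pair_phi_H\<close> goes only from a list to its image; the converse is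
  the same step applied to the image, since reflecting a list of all faces twice restores
  it.\<close>

lemma pivot_classified_reflect:
  assumes c: "pivot_classified k X S" and X: "\<And>xs. xs \<in> X \<Longrightarrow> set xs = faces k"
  shows "pivot_classified k (T_CH k ` X) ((\<lambda>(\<alpha>, \<beta>). (2*k-\<alpha>, 2*k-\<beta>)) ` S)"
proof -
  define g :: "nat \<times> nat \<Rightarrow> nat \<times> nat" where "g = (\<lambda>(\<alpha>, \<beta>). (2*k-\<alpha>, 2*k-\<beta>))"
  have fw: "has_pivot_pair k (map (phi_H k) xs) (g ab)" if "has_pivot_pair k xs ab" for xs ab
    using has_pivot_pair_phi_H that by (cases ab) (simp add: g_def)
  have gg: "g (g ab) = ab" if "has_pivot_pair k xs ab" for xs ab
    using that by (cases ab) (auto simp: g_def has_pivot_pair_def)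
  have id: "map (phi_H k) (map (phi_H k) xs) = xs" if "xs \<in> X" for xs
    unfolding map_map comp_def by (rule map_idI) (simp add: X[OF that] phi_H_phi_H)
  have h: "has_pivot_pair k xs (g ab)" if "xs \<in> X" "has_pivot_pair k (map (phi_H k) xs) ab" for xs ab
    using fw[OF that(2)] id[OF that(1)] by simp
  show ?thesis
    unfolding pivot_classified_def T_CH_def ball_simps(9) bex_simps(7) g_def[symmetric]
  proof (intro conjI ballI allI impI)
    fix xs assume "xs \<in> X"
    then show "\<exists>ab\<in>S. has_pivot_pair k (map (phi_H k) xs) (g ab)"
      using c fw unfolding pivot_classified_def by blast
  next
    fix xs ys ab assume "xs \<in> X" "ys \<in> X" "has_pivot_pair k (map (phi_H k) xs) ab"
      "has_pivot_pair k (map (phi_H k) ys) ab"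
    then show "map (phi_H k) xs = map (phi_H k) ys"
      using c h unfolding pivot_classified_def by metis
  next
    fix ab assume "ab \<in> S"
    then show "\<exists>xs\<in>X. has_pivot_pair k (map (phi_H k) xs) (g ab)"
      using c fw unfolding pivot_classified_def by blast
  qed
qed

section \<open>The base words \<open>MMMMVV\<close> and \<open>MVMMMM\<close>\<close>

abbreviation valid_key :: "label_word \<Rightarrow> nat \<Rightarrow> (face \<Rightarrow> int) \<Rightarrow> bool" where
  "valid_key P k f \<equiv> valid_keys P k (f \<circ> Ao) (f \<circ> Ae) (f \<circ> Bo) (f \<circ> Be)"

lemma plus_has_pivot_pair:
  fixes f :: "face \<Rightarrow> int"
  assumes "sorted_wrt (\<lambda>x y. f x < f y) xs" "set xs = faces k"
    and "\<alpha> \<in> {1..2*k-1}" "row_pattern k \<alpha> (f \<circ> Ao) (f \<circ> Ae)"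
    and "\<beta> \<in> {1..2*k-1}" "row_pattern k \<beta> (f \<circ> Bo) (f \<circ> Be)"
  shows "has_pivot_pair k xs (\<alpha>, \<beta>)"
  using upper_pivot[OF assms(1-4)] lower_pivot[OF assms(1,2,5,6)] assms(3,5)
  by (simp add: has_pivot_pair_def)

lemma minus_has_pivot_pair:
  fixes f :: "face \<Rightarrow> int"
  assumes "sorted_wrt (\<lambda>x y. f x < f y) xs" "set xs = faces k"
    and "\<alpha> \<in> {1..2*k-1}" "row_pattern k \<alpha> (f \<circ> Ao) (f \<circ> Ae)"
    and "\<beta> \<in> {1..2*k-1}" "row_pattern k \<beta> (\<lambda>t. - (f \<circ> Bo) t) (\<lambda>t. - (f \<circ> Be) t)"
  shows "has_pivot_pair k xs (\<alpha>, \<beta>)"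
  using upper_pivot[OF assms(1-4)] lower_pivot_rev[OF assms(1,2,5,6)] assms(3,5)
  by (simp add: has_pivot_pair_def)

text \<open>\<open>Ao 0\<close> and \<open>Ae 0\<close> are the same face, and so are
  \<open>Bo 0\<close> and \<open>Be 0\<close>; hence the sequences of the odd columns are prescribed
  only from t = 1 on.\<close>

lemma face_key_of_sequences:
  obtains f :: "face \<Rightarrow> int" where "\<And>t. t \<in> {1..k} \<Longrightarrow> f (Ao t) = a t" "\<And>t. f (Ae t) = a' t"
    "\<And>t. t \<in> {1..k} \<Longrightarrow> f (Bo t) = b t" "\<And>t. f (Be t) = b' t"
proof
  define f :: "face \<Rightarrow> int" where
    "f = rec_face (\<lambda>c. if odd c then a ((c+1) div 2) else a' (c div 2)) (\<lambda>c. if odd c then b ((c+1) div 2) else b' (c div 2))"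
  show "f (Ao t) = a t" "f (Bo t) = b t" if "t \<in> {1..k}" for t
    using that by (cases t; simp add: f_def Ao_def Bo_def)+
  show "f (Ae t) = a' t" "f (Be t) = b' t" for t
    by (simp_all add: f_def Ae_def Be_def)
qed

lemma row_pattern_cong:
  assumes "\<And>t. t \<in> {1..k} \<Longrightarrow> x t = z t \<and> y t = w t"
  shows "row_pattern k p x y = row_pattern k p z w"
  using assms by (simp add: row_pattern_def)

lemma valid_key_of_sequences:
  assumes "valid_keys P k a a' b b'"
  obtains f :: "face \<Rightarrow> int" where "valid_key P k f"
    "\<And>p. row_pattern k p (f \<circ> Ao) (f \<circ> Ae) = row_pattern k p a a'"
    "\<And>p. row_pattern k p (f \<circ> Bo) (f \<circ> Be) = row_pattern k p b b'"
    "\<And>p. row_pattern k p (\<lambda>t. - (f \<circ> Bo) t) (\<lambda>t. - (f \<circ> Be) t) =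
       row_pattern k p (\<lambda>t. - b t) (\<lambda>t. - b' t)"
proof -
  obtain f :: "face \<Rightarrow> int" where f: "\<And>t. t \<in> {1..k} \<Longrightarrow> f (Ao t) = a t" "\<And>t. f (Ae t) = a' t"
    "\<And>t. t \<in> {1..k} \<Longrightarrow> f (Bo t) = b t" "\<And>t. f (Be t) = b' t"
    using face_key_of_sequences[of k a a' b b'] by blast
  have e: "(f \<circ> Ao) t = a t \<and> (f \<circ> Ae) t = a' t \<and> (f \<circ> Bo) t = b t \<and> (f \<circ> Be) t = b' t" if "t \<in> {1..k}" for t
    using f that by simp
  have "keys_precedence P k (f \<circ> Ao) (f \<circ> Ae) (f \<circ> Bo) (f \<circ> Be) = keys_precedence P k a a' b b'"
    by (rule keys_precedence_cong) (rule e)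
  moreover have "keys_noncrossing k (f \<circ> Ao) (f \<circ> Ae) (f \<circ> Bo) (f \<circ> Be) = keys_noncrossing k a a' b b'"
    by (rule keys_noncrossing_cong) (rule e)
  moreover have "keys_distinct k (f \<circ> Ao) (f \<circ> Ae) (f \<circ> Bo) (f \<circ> Be) = keys_distinct k a a' b b'"
    unfolding keys_distinct_def row_distinct_def inj_on_def using e by simp
  ultimately have "valid_key P k f" using assms by (simp add: valid_keys_def)
  moreover have "row_pattern k p (f \<circ> Ao) (f \<circ> Ae) = row_pattern k p a a'"
    "row_pattern k p (f \<circ> Bo) (f \<circ> Be) = row_pattern k p b b'"
    "row_pattern k p (\<lambda>t. - (f \<circ> Bo) t) (\<lambda>t. - (f \<circ> Be) t) =
       row_pattern k p (\<lambda>t. - b t) (\<lambda>t. - b' t)" for p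
    by (rule row_pattern_cong; simp add: f)+
  ultimately show ?thesis using that by blast
qed

definition plus_pairs :: "nat \<Rightarrow> (nat \<times> nat) set" where
  "plus_pairs k = {(\<alpha>, \<beta>). \<alpha> \<in> {1..2*k-1} \<and> \<beta> \<in> {1..2*k-1} \<and> (\<alpha> = 1 \<or> \<alpha> = 2*k-1 \<or> \<alpha> = \<beta>)}"

text \<open>Equality of the halves says that W_\<alpha> and W_\<beta> begin with the same
  column.\<close>

definition minus_pairs :: "nat \<Rightarrow> (nat \<times> nat) set" where
  "minus_pairs k = {(\<alpha>, \<beta>). \<alpha> \<in> {1..2*k-1} \<and> \<beta> \<in> {1..2*k-1} \<and> \<alpha> div 2 = \<beta> div 2}"

lemma plus_keys_exist:
  assumes "(\<alpha>, \<beta>) \<in> plus_pairs k"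
  shows "\<exists>a a' b b'. valid_keys (M,M,M,M,V,V) k a a' b b' \<and> row_pattern k \<alpha> a a' \<and> row_pattern k \<beta> b b'"
proof -
  have \<beta>: "\<beta> \<in> {1..2*k-1}" and "\<alpha> = 1 \<or> \<alpha> = 2*k-1 \<or> \<alpha> = \<beta>"
    using assms by (auto simp: plus_pairs_def)
  then consider "\<alpha> = 1" | "\<alpha> = 2*k-1" | "\<alpha> = \<beta>" by blast
  then show ?thesis
  proof cases
    case 1
    from \<beta> show ?thesis
      by (cases rule: pivot_cases) (use 1 plus_keys_outer_odd plus_keys_outer_even in blast)+
  next
    case 2
    from \<beta> show ?thesis
      by (cases rule: pivot_cases) (use 2 plus_keys_inner_odd plus_keys_inner_even in blast)+
  next
    case 3
    from \<beta> show ?thesis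
      by (cases rule: pivot_cases) (use 3 plus_keys_diagonal_odd plus_keys_diagonal_even in blast)+
  qed
qed

lemma minus_keys_exist:
  assumes "(\<alpha>, \<beta>) \<in> minus_pairs k"
  shows "\<exists>a a' b b'. valid_keys (M,V,M,M,M,M) k a a' b b' \<and> row_pattern k \<alpha> a a' \<and>
    row_pattern k \<beta> (\<lambda>t. - b t) (\<lambda>t. - b' t)"
proof -
  define s where "s = \<alpha> div 2"
  have r: "\<alpha> \<in> {1..2*k-1}" "\<beta> \<in> {1..2*k-1}" and e: "\<alpha> div 2 = s" "\<beta> div 2 = s"
    using assms by (auto simp: minus_pairs_def s_def)
  show ?thesis
  proof (cases "\<alpha> = \<beta>")
    case True
    from r(2) show ?thesis
      by (cases rule: pivot_cases) (use True minus_keys_diagonal_odd minus_keys_diagonal_even in blast)+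
  next
    case False
    \<comment> \<open>Distinct pivots with equal halves are 2s and 2s+1, and s \<ge> 1 because
      pivots start at 1.\<close>
    then consider "\<alpha> = 2*s" "\<beta> = 2*s+1" | "\<alpha> = 2*s+1" "\<beta> = 2*s" using e by linarith
    then show ?thesis
    proof cases
      case 1
      then have "1 \<le> s" "s < k" using r by auto
      then show ?thesis using minus_keys_even_odd 1 by blast
    next
      case 2
      then have "1 \<le> s" "s < k" using r by auto
      then show ?thesis using minus_keys_odd_even 2 by blast
    qed
  qed
qed

text \<open>\<open>G f \<alpha> \<beta>\<close> stands for: the rows of \<open>f\<close> follow
  W_\<alpha> and W_\<beta>, the lower one being read forwards for \<open>MMMMVV\<close> and
  backwards for \<open>MVMMMM\<close>. Both words then share one argument.\<close>

lemma pivot_classifiedI: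
  fixes G :: "(face \<Rightarrow> int) \<Rightarrow> nat \<Rightarrow> nat \<Rightarrow> bool"
  assumes pat: "\<And>f. valid_key P k f \<Longrightarrow> \<exists>\<alpha> \<beta>. G f \<alpha> \<beta>"
    and pairs: "\<And>f \<alpha> \<beta>. valid_key P k f \<Longrightarrow> G f \<alpha> \<beta> \<Longrightarrow> (\<alpha>, \<beta>) \<in> S"
    and has: "\<And>xs f \<alpha> \<beta>. sorted_wrt (\<lambda>x y. f x < f y) xs \<Longrightarrow> set xs = faces k \<Longrightarrow> G f \<alpha> \<beta> \<Longrightarrow>
      has_pivot_pair k xs (\<alpha>, \<beta>)"
    and uniq: "\<And>f g \<alpha> \<beta> x y. valid_key P k f \<Longrightarrow> valid_key P k g \<Longrightarrow> G f \<alpha> \<beta> \<Longrightarrow> G g \<alpha> \<beta> \<Longrightarrow>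
      x \<in> faces k \<Longrightarrow> y \<in> faces k \<Longrightarrow> g x < g y \<Longrightarrow> f x < f y"
    and ex: "\<And>\<alpha> \<beta>. (\<alpha>, \<beta>) \<in> S \<Longrightarrow> \<exists>f. valid_key P k f \<and> G f \<alpha> \<beta>"
  shows "pivot_classified k {xs. order_valid P k xs} S"
  unfolding pivot_classified_def
proof (intro conjI ballI allI impI)
  have key: "\<exists>f \<alpha> \<beta>. sorted_wrt (\<lambda>x y. f x < f y) xs \<and> set xs = faces k \<and> valid_key P k f \<and>
      G f \<alpha> \<beta> \<and> (\<alpha>, \<beta>) \<in> S \<and> has_pivot_pair k xs (\<alpha>, \<beta>)" if v: "order_valid P k xs" for xs
  proof -
    obtain f :: "face \<Rightarrow> int" where f: "sorted_wrt (\<lambda>x y. f x < f y) xs" "set xs = faces k" "valid_key P k f"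
      using order_valid_keys[OF v] by blast
    obtain \<alpha> \<beta> where "G f \<alpha> \<beta>" using pat[OF f(3)] by blast
    then show ?thesis using f pairs[OF f(3)] has[OF f(1,2)] by blast
  qed
  fix xs assume "xs \<in> {xs. order_valid P k xs}"
  then have vx: "order_valid P k xs" by simp
  show "\<exists>ab\<in>S. has_pivot_pair k xs ab" using key[OF vx] by blast
  fix ys ab assume "ys \<in> {xs. order_valid P k xs}"
  then have vy: "order_valid P k ys" by simp
  assume hx: "has_pivot_pair k xs ab" and hy: "has_pivot_pair k ys ab"
  obtain f \<alpha> \<beta> where f: "sorted_wrt (\<lambda>x y. f x < f y) xs" "set xs = faces k" "valid_key P k f"
    "G f \<alpha> \<beta>" "has_pivot_pair k xs (\<alpha>, \<beta>)"
    using key[OF vx] by blast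
  obtain g \<gamma> \<delta> where g: "sorted_wrt (\<lambda>x y. g x < g y) ys" "set ys = faces k" "valid_key P k g"
    "G g \<gamma> \<delta>" "has_pivot_pair k ys (\<gamma>, \<delta>)"
    using key[OF vy] by blast
  have "(\<gamma>, \<delta>) = (\<alpha>, \<beta>)"
    using has_pivot_pair_unique[OF hx f(5)] has_pivot_pair_unique[OF hy g(5)] by simp
  then have g4: "G g \<alpha> \<beta>" using g(4) by simp
  show "xs = ys"
    by (rule sorted_same_comparisons[OF f(1) g(1) f(2) g(2)]) (rule uniq[OF f(3) g(3) f(4) g4])
next
  fix ab assume "ab \<in> S"
  moreover obtain \<alpha> \<beta> where ab: "ab = (\<alpha>, \<beta>)" by (cases ab)
  ultimately obtain f where f: "valid_key P k f" "G f \<alpha> \<beta>" using ex by blast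
  obtain xs where "sorted_wrt (\<lambda>x y. f x < f y) xs" "set xs = faces k" "order_valid P k xs"
    using valid_keys_order[OF f(1)] by blast
  then show "\<exists>xs\<in>{xs. order_valid P k xs}. has_pivot_pair k xs ab" using has f(2) ab by blast
qed

lemma plus_classified:
  assumes k: "k \<ge> 2"
  shows "pivot_classified k {xs. order_valid (M,M,M,M,V,V) k xs} (plus_pairs k)"
proof (rule pivot_classifiedI[where G = "\<lambda>f \<alpha> \<beta>. \<alpha> \<in> {1..2*k-1} \<and> \<beta> \<in> {1..2*k-1} \<and>
      row_pattern k \<alpha> (f \<circ> Ao) (f \<circ> Ae) \<and> row_pattern k \<beta> (f \<circ> Bo) (f \<circ> Be)"]; (elim conjE)?)
  fix f :: "face \<Rightarrow> int" assume f: "valid_key (M,M,M,M,V,V) k f"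
  have k1: "1 \<le> k" using k by simp
  show "\<exists>\<alpha> \<beta>. \<alpha> \<in> {1..2*k-1} \<and> \<beta> \<in> {1..2*k-1} \<and>
      row_pattern k \<alpha> (f \<circ> Ao) (f \<circ> Ae) \<and> row_pattern k \<beta> (f \<circ> Bo) (f \<circ> Be)"
    using plus_patterns[OF k1 f] by blast
  fix \<alpha> \<beta> assume r: "\<alpha> \<in> {1..2*k-1}" "\<beta> \<in> {1..2*k-1}"
    and p: "row_pattern k \<alpha> (f \<circ> Ao) (f \<circ> Ae)" "row_pattern k \<beta> (f \<circ> Bo) (f \<circ> Be)"
  show "(\<alpha>, \<beta>) \<in> plus_pairs k"
    using r plus_pivot_condition[OF k f r(1) p(1) r(2) p(2)] by (simp add: plus_pairs_def)
  fix g :: "face \<Rightarrow> int" and x y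
  assume "valid_key (M,M,M,M,V,V) k g" "row_pattern k \<alpha> (g \<circ> Ao) (g \<circ> Ae)" "row_pattern k \<beta> (g \<circ> Bo) (g \<circ> Be)"
    "x \<in> faces k" "y \<in> faces k" "g x < g y"
  then show "f x < f y" using plus_unique[OF k] f p r by blast
next
  fix xs \<alpha> \<beta> and f :: "face \<Rightarrow> int"
  assume "sorted_wrt (\<lambda>x y. f x < f y) xs" "set xs = faces k" "\<alpha> \<in> {1..2*k-1}" "\<beta> \<in> {1..2*k-1}"
    "row_pattern k \<alpha> (f \<circ> Ao) (f \<circ> Ae)" "row_pattern k \<beta> (f \<circ> Bo) (f \<circ> Be)"
  then show "has_pivot_pair k xs (\<alpha>, \<beta>)" using plus_has_pivot_pair by blast
next
  fix \<alpha> \<beta> assume S: "(\<alpha>, \<beta>) \<in> plus_pairs k"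
  then have r: "\<alpha> \<in> {1..2*k-1}" "\<beta> \<in> {1..2*k-1}" by (auto simp: plus_pairs_def)
  obtain a a' b b' where keys: "valid_keys (M,M,M,M,V,V) k a a' b b'"
    "row_pattern k \<alpha> a a'" "row_pattern k \<beta> b b'"
    using plus_keys_exist[OF S] by blast
  from keys(1) obtain f :: "face \<Rightarrow> int" where "valid_key (M,M,M,M,V,V) k f"
    "row_pattern k \<alpha> (f \<circ> Ao) (f \<circ> Ae)" "row_pattern k \<beta> (f \<circ> Bo) (f \<circ> Be)"
    by (rule valid_key_of_sequences) (use keys(2,3) in blast)
  then show "\<exists>f. valid_key (M,M,M,M,V,V) k f \<and> \<alpha> \<in> {1..2*k-1} \<and> \<beta> \<in> {1..2*k-1} \<and>
      row_pattern k \<alpha> (f \<circ> Ao) (f \<circ> Ae) \<and> row_pattern k \<beta> (f \<circ> Bo) (f \<circ> Be)"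
    using r by blast
qed

lemma minus_classified:
  assumes k: "k \<ge> 2"
  shows "pivot_classified k {xs. order_valid (M,V,M,M,M,M) k xs} (minus_pairs k)"
proof (rule pivot_classifiedI[where G = "\<lambda>f \<alpha> \<beta>. \<alpha> \<in> {1..2*k-1} \<and> \<beta> \<in> {1..2*k-1} \<and>
      row_pattern k \<alpha> (f \<circ> Ao) (f \<circ> Ae) \<and> row_pattern k \<beta> (\<lambda>t. - (f \<circ> Bo) t) (\<lambda>t. - (f \<circ> Be) t)"]; (elim conjE)?)
  fix f :: "face \<Rightarrow> int" assume f: "valid_key (M,V,M,M,M,M) k f"
  have k1: "1 \<le> k" using k by simp
  show "\<exists>\<alpha> \<beta>. \<alpha> \<in> {1..2*k-1} \<and> \<beta> \<in> {1..2*k-1} \<and>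
      row_pattern k \<alpha> (f \<circ> Ao) (f \<circ> Ae) \<and> row_pattern k \<beta> (\<lambda>t. - (f \<circ> Bo) t) (\<lambda>t. - (f \<circ> Be) t)"
    using minus_patterns[OF k1 f] by blast
  fix \<alpha> \<beta> assume r: "\<alpha> \<in> {1..2*k-1}" "\<beta> \<in> {1..2*k-1}"
    and p: "row_pattern k \<alpha> (f \<circ> Ao) (f \<circ> Ae)" "row_pattern k \<beta> (\<lambda>t. - (f \<circ> Bo) t) (\<lambda>t. - (f \<circ> Be) t)"
  show "(\<alpha>, \<beta>) \<in> minus_pairs k"
    using r minus_pivot_condition[OF f r(1) p(1) r(2) p(2)] by (simp add: minus_pairs_def)
  fix g :: "face \<Rightarrow> int" and x y
  assume "valid_key (M,V,M,M,M,M) k g" "row_pattern k \<alpha> (g \<circ> Ao) (g \<circ> Ae)" "row_pattern k \<beta> (\<lambda>t. - (g \<circ> Bo) t) (\<lambda>t. - (g \<circ> Be) t)"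
    "x \<in> faces k" "y \<in> faces k" "g x < g y"
  then show "f x < f y" using minus_unique f p r by blast
next
  fix xs \<alpha> \<beta> and f :: "face \<Rightarrow> int"
  assume "sorted_wrt (\<lambda>x y. f x < f y) xs" "set xs = faces k" "\<alpha> \<in> {1..2*k-1}" "\<beta> \<in> {1..2*k-1}"
    "row_pattern k \<alpha> (f \<circ> Ao) (f \<circ> Ae)" "row_pattern k \<beta> (\<lambda>t. - (f \<circ> Bo) t) (\<lambda>t. - (f \<circ> Be) t)"
  then show "has_pivot_pair k xs (\<alpha>, \<beta>)" using minus_has_pivot_pair by blast
next
  fix \<alpha> \<beta> assume S: "(\<alpha>, \<beta>) \<in> minus_pairs k"
  then have r: "\<alpha> \<in> {1..2*k-1}" "\<beta> \<in> {1..2*k-1}" by (auto simp: minus_pairs_def)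
  obtain a a' b b' where keys: "valid_keys (M,V,M,M,M,M) k a a' b b'"
    "row_pattern k \<alpha> a a'" "row_pattern k \<beta> (\<lambda>t. - b t) (\<lambda>t. - b' t)"
    using minus_keys_exist[OF S] by blast
  from keys(1) obtain f :: "face \<Rightarrow> int" where "valid_key (M,V,M,M,M,M) k f"
    "row_pattern k \<alpha> (f \<circ> Ao) (f \<circ> Ae)" "row_pattern k \<beta> (\<lambda>t. - (f \<circ> Bo) t) (\<lambda>t. - (f \<circ> Be) t)"
    by (rule valid_key_of_sequences) (use keys(2,3) in blast)
  then show "\<exists>f. valid_key (M,V,M,M,M,M) k f \<and> \<alpha> \<in> {1..2*k-1} \<and> \<beta> \<in> {1..2*k-1} \<and>
      row_pattern k \<alpha> (f \<circ> Ao) (f \<circ> Ae) \<and> row_pattern k \<beta> (\<lambda>t. - (f \<circ> Bo) t) (\<lambda>t. - (f \<circ> Be) t)"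
    using r by blast
qed

section \<open>The four regimes and the symmetry classes of words\<close>

lemma regime_unique: "\<exists>!r. in_regime r P"
proof -
  have sq: "label_sign p * label_sign q = 1 \<or> label_sign p * label_sign q = -1" for p q
    by (cases p; cases q) simp_all
  then have t: "tau P = 1 \<or> tau P = -1" and r: "rho P = 1 \<or> rho P = -1"
    unfolding tau_def rho_def by blast+
  define r0 where "r0 = (if delta 0 P \<noteq> -1 \<or> delta 1 P \<noteq> -1 then Zero else if tau P = -1 then Pleat
    else if rho P = 1 then Row_Plus else Row_Minus)"
  have "in_regime r P \<longleftrightarrow> r = r0" for r
    using t r by (cases r) (auto simp: r0_def)
  then show ?thesis by auto
qed

lemma regime_words:
  "in_regime Pleat P \<Longrightarrow> P \<in> {(M,M,M,V,V,M), (M,M,V,M,M,V), (V,V,M,V,V,M), (V,V,V,M,M,V),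
     (M,V,M,V,M,V), (V,M,M,V,M,V), (V,M,V,M,V,M), (M,V,V,M,V,M)}"
  "in_regime Row_Plus P \<Longrightarrow> P \<in> {(M,M,M,M,V,V), (M,M,V,V,M,M), (V,V,M,M,V,V), (V,V,V,V,M,M)}"
  "in_regime Row_Minus P \<Longrightarrow> P \<in> {(M,V,M,M,M,M), (V,M,M,M,M,M), (V,M,V,V,V,V), (M,V,V,V,V,V)}"
proof -
  obtain h0 h1 u0 u1 l0 l1 where P: "P = (h0, h1, u0, u1, l0, l1)" by (cases P)
  show "in_regime Pleat P \<Longrightarrow> P \<in> {(M,M,M,V,V,M), (M,M,V,M,M,V), (V,V,M,V,V,M), (V,V,V,M,M,V),
     (M,V,M,V,M,V), (V,M,M,V,M,V), (V,M,V,M,V,M), (M,V,V,M,V,M)}"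
  "in_regime Row_Plus P \<Longrightarrow> P \<in> {(M,M,M,M,V,V), (M,M,V,V,M,M), (V,V,M,M,V,V), (V,V,V,V,M,M)}"
  "in_regime Row_Minus P \<Longrightarrow> P \<in> {(M,V,M,M,M,M), (V,M,M,M,M,M), (V,M,V,V,V,V), (M,V,V,V,V,V)}"
    unfolding P
    by (cases h0; cases h1; cases u0; cases u1; cases l0; cases l1; simp add: delta_def tau_def rho_def)+
qed

lemma F_words:
  assumes "k \<ge> 2"
  shows "F (M,M,V,M,M,V) k = T_R ` F (M,M,M,V,V,M) k" "F (V,V,M,V,V,M) k = T_CR ` F (M,M,M,V,V,M) k"
    "F (V,V,V,M,M,V) k = T_C ` F (M,M,M,V,V,M) k"
    "F (V,M,M,V,M,V) k = T_H k ` F (M,V,M,V,M,V) k" "F (V,M,V,M,V,M) k = T_C ` F (M,V,M,V,M,V) k"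
    "F (M,V,V,M,V,M) k = T_CH k ` F (M,V,M,V,M,V) k"
    "F (M,M,V,V,M,M) k = T_R ` F (M,M,M,M,V,V) k" "F (V,V,M,M,V,V) k = T_CR ` F (M,M,M,M,V,V) k"
    "F (V,V,V,V,M,M) k = T_C ` F (M,M,M,M,V,V) k"
    "F (V,M,M,M,M,M) k = T_H k ` F (M,V,M,M,M,M) k" "F (V,M,V,V,V,V) k = T_C ` F (M,V,M,M,M,M) k"
    "F (M,V,V,V,V,V) k = T_CH k ` F (M,V,M,M,M,M) k"
  using F_transform[OF assms, of "(M,M,M,V,V,M)"] F_transform_rev[OF assms, of "(M,M,M,V,V,M)"]
    F_transform[OF assms, of "(M,V,M,V,M,V)"] F_transform_rev[OF assms, of "(M,V,M,V,M,V)"]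
    F_transform[OF assms, of "(M,M,M,M,V,V)"] F_transform_rev[OF assms, of "(M,M,M,M,V,V)"]
    F_transform[OF assms, of "(M,V,M,M,M,M)"] F_transform_rev[OF assms, of "(M,V,M,M,M,M)"]
  by (simp_all only: flip_word.simps swap_rows.simps reflect_word.simps flip_label.simps)

lemma swap_plus_pairs:
  "prod.swap ` plus_pairs k =
    {(\<alpha>, \<beta>). \<alpha> \<in> {1..2*k-1} \<and> \<beta> \<in> {1..2*k-1} \<and> (\<beta> = 1 \<or> \<beta> = 2*k-1 \<or> \<alpha> = \<beta>)}" (is "_ = ?S")
proof
  show "?S \<subseteq> prod.swap ` plus_pairs k"
  proof
    fix x assume "x \<in> ?S"
    then have "prod.swap x \<in> plus_pairs k" by (auto simp: plus_pairs_def)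
    then show "x \<in> prod.swap ` plus_pairs k" by (rule rev_image_eqI) simp
  qed
qed (auto simp: plus_pairs_def)

lemma B_R_eq: "B_R p = p div 2"
  by (simp add: B_R_def)

lemma minus_pairs_B_R:
  "minus_pairs k = {(\<alpha>, \<beta>). \<alpha> \<in> {1..2*k-1} \<and> \<beta> \<in> {1..2*k-1} \<and> B_R \<alpha> = B_R \<beta>}"
  by (simp only: minus_pairs_def B_R_eq)

lemma reflect_minus_pairs:
  "(\<lambda>(\<alpha>, \<beta>). (2*k-\<alpha>, 2*k-\<beta>)) ` minus_pairs k =
    {(\<alpha>, \<beta>). \<alpha> \<in> {1..2*k-1} \<and> \<beta> \<in> {1..2*k-1} \<and> B_L k \<alpha> = B_L k \<beta>}" (is "?g ` _ = ?S")
proof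
  show "?g ` minus_pairs k \<subseteq> ?S"
    by (auto simp: minus_pairs_def B_L_def B_R_eq)
  show "?S \<subseteq> ?g ` minus_pairs k"
  proof
    fix x assume x: "x \<in> ?S"
    then have "?g x \<in> minus_pairs k" by (auto simp: minus_pairs_def B_L_def B_R_eq)
    then show "x \<in> ?g ` minus_pairs k" by (rule rev_image_eqI) (use x in auto)
  qed
qed

lemma plus_words_classified:
  assumes "k \<ge> 2"
  shows "pivot_classified k (F (M,M,M,M,V,V) k) (plus_pairs k)"
    "pivot_classified k (F (V,V,V,V,M,M) k) (plus_pairs k)"
    "pivot_classified k (F (M,M,V,V,M,M) k) (prod.swap ` plus_pairs k)"
    "pivot_classified k (F (V,V,M,M,V,V) k) (prod.swap ` plus_pairs k)"
proof -
  show P: "pivot_classified k (F (M,M,M,M,V,V) k) (plus_pairs k)"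
    using plus_classified[OF assms] assms by (simp add: F_eq delta_def)
  show "pivot_classified k (F (V,V,V,V,M,M) k) (plus_pairs k)"
    unfolding F_words[OF assms] by (rule pivot_classified_rev[OF P])
  have "T_R = T_C \<circ> T_CR" by (simp add: fun_eq_iff T_R_def T_C_def T_CR_def)
  then show "pivot_classified k (F (M,M,V,V,M,M) k) (prod.swap ` plus_pairs k)"
    unfolding F_words[OF assms] using pivot_classified_rev[OF pivot_classified_swap[OF P]]
    by (simp only: image_comp)
  show "pivot_classified k (F (V,V,M,M,V,V) k) (prod.swap ` plus_pairs k)"
    unfolding F_words[OF assms] by (rule pivot_classified_swap[OF P])
qed

lemma minus_words_classified:
  assumes "k \<ge> 2"
  shows "pivot_classified k (F (M,V,M,M,M,M) k) (minus_pairs k)"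
    "pivot_classified k (F (V,M,V,V,V,V) k) (minus_pairs k)"
    "pivot_classified k (F (V,M,M,M,M,M) k) ((\<lambda>(\<alpha>, \<beta>). (2*k-\<alpha>, 2*k-\<beta>)) ` minus_pairs k)"
    "pivot_classified k (F (M,V,V,V,V,V) k) ((\<lambda>(\<alpha>, \<beta>). (2*k-\<alpha>, 2*k-\<beta>)) ` minus_pairs k)"
proof -
  show P: "pivot_classified k (F (M,V,M,M,M,M) k) (minus_pairs k)"
    using minus_classified[OF assms] assms by (simp add: F_eq delta_def)
  have set: "set xs = faces k" if "xs \<in> F (M,V,M,M,M,M) k" for xs
    using that by (simp add: F_def order_valid_def total_order_of_faces_def split: if_splits)
  show "pivot_classified k (F (V,M,V,V,V,V) k) (minus_pairs k)"
    unfolding F_words[OF assms] by (rule pivot_classified_rev[OF P])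
  have "T_H k = T_C \<circ> T_CH k" by (simp add: fun_eq_iff T_H_def T_C_def T_CH_def)
  then show "pivot_classified k (F (V,M,M,M,M,M) k) ((\<lambda>(\<alpha>, \<beta>). (2*k-\<alpha>, 2*k-\<beta>)) ` minus_pairs k)"
    unfolding F_words[OF assms] using pivot_classified_rev[OF pivot_classified_reflect[OF P set]]
    by (simp only: image_comp)
  show "pivot_classified k (F (M,V,V,V,V,V) k) ((\<lambda>(\<alpha>, \<beta>). (2*k-\<alpha>, 2*k-\<beta>)) ` minus_pairs k)"
    unfolding F_words[OF assms] by (rule pivot_classified_reflect[OF P set])
qed

theorem theorem8p2:
  fixes P :: label_word and k n m :: nat
  assumes "k \<ge> 2" and "n = 2 * k" and "m = 2 * k - 1"
  shows
    "(\<exists>!r. in_regime r P) \<and>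
     (in_regime Zero P \<longrightarrow> F P k = {}) \<and>
     (in_regime Pleat P \<longrightarrow>
        P \<in> {(M,M,M,V,V,M), (M,M,V,M,M,V), (V,V,M,V,V,M), (V,V,V,M,M,V),
             (M,V,M,V,M,V), (V,M,M,V,M,V), (V,M,V,M,V,M), (M,V,V,M,V,M)} \<and>
        is_singleton (F P k) \<and>
        F (M,M,M,V,V,M) k = {Omega_plus k} \<and>
        F (M,M,V,M,M,V) k = {T_R (Omega_plus k)} \<and>
        F (V,V,M,V,V,M) k = {T_CR (Omega_plus k)} \<and>
        F (V,V,V,M,M,V) k = {T_C (Omega_plus k)} \<and>
        F (M,V,M,V,M,V) k = {Omega_minus k} \<and>
        F (V,M,M,V,M,V) k = {T_H k (Omega_minus k)} \<and>
        F (V,M,V,M,V,M) k = {T_C (Omega_minus k)} \<and>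
        F (M,V,V,M,V,M) k = {T_CH k (Omega_minus k)}) \<and>
     (in_regime Row_Plus P \<longrightarrow>
        P \<in> {(M,M,M,M,V,V), (M,M,V,V,M,M), (V,V,M,M,V,V), (V,V,V,V,M,M)} \<and>
        F (M,M,V,V,M,M) k = T_R ` F (M,M,M,M,V,V) k \<and>
        F (V,V,M,M,V,V) k = T_CR ` F (M,M,M,M,V,V) k \<and>
        F (V,V,V,V,M,M) k = T_C ` F (M,M,M,M,V,V) k \<and>
        (\<forall>\<Pi>\<in>F P k. \<exists>!ab. has_pivot_pair k \<Pi> ab) \<and>
        (P \<in> {(M,M,M,M,V,V), (V,V,V,V,M,M)} \<longrightarrow>
           bij_betw (pivot_pair k) (F P k)
             {(\<alpha>, \<beta>). \<alpha> \<in> {1..m} \<and> \<beta> \<in> {1..m} \<and> (\<alpha> = 1 \<or> \<alpha> = m \<or> \<alpha> = \<beta>)}) \<and>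
        (P \<in> {(M,M,V,V,M,M), (V,V,M,M,V,V)} \<longrightarrow>
           bij_betw (pivot_pair k) (F P k)
             {(\<alpha>, \<beta>). \<alpha> \<in> {1..m} \<and> \<beta> \<in> {1..m} \<and> (\<beta> = 1 \<or> \<beta> = m \<or> \<alpha> = \<beta>)})) \<and>
     (in_regime Row_Minus P \<longrightarrow>
        P \<in> {(M,V,M,M,M,M), (V,M,M,M,M,M), (V,M,V,V,V,V), (M,V,V,V,V,V)} \<and>
        F (V,M,M,M,M,M) k = T_H k ` F (M,V,M,M,M,M) k \<and>
        F (V,M,V,V,V,V) k = T_C ` F (M,V,M,M,M,M) k \<and>
        F (M,V,V,V,V,V) k = T_CH k ` F (M,V,M,M,M,M) k \<and>
        (\<forall>\<Pi>\<in>F P k. \<exists>!ab. has_pivot_pair k \<Pi> ab) \<and>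
        (P \<in> {(M,V,M,M,M,M), (V,M,V,V,V,V)} \<longrightarrow>
           bij_betw (pivot_pair k) (F P k)
             {(\<alpha>, \<beta>). \<alpha> \<in> {1..m} \<and> \<beta> \<in> {1..m} \<and> B_R \<alpha> = B_R \<beta>}) \<and>
        (P \<in> {(V,M,M,M,M,M), (M,V,V,V,V,V)} \<longrightarrow>
           bij_betw (pivot_pair k) (F P k)
             {(\<alpha>, \<beta>). \<alpha> \<in> {1..m} \<and> \<beta> \<in> {1..m} \<and> B_L k \<alpha> = B_L k \<beta>}))"
proof -
  note k = assms(1)
  have zero: "F P k = {}" if "in_regime Zero P"
    using that k by (auto simp: F_eq)
  note pleat = F_pleat_plus[OF k] F_pleat_minus[OF k]
  have words: "F (M,M,V,M,M,V) k = {T_R (Omega_plus k)}" "F (V,V,M,V,V,M) k = {T_CR (Omega_plus k)}"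
    "F (V,V,V,M,M,V) k = {T_C (Omega_plus k)}" "F (V,M,M,V,M,V) k = {T_H k (Omega_minus k)}"
    "F (V,M,V,M,V,M) k = {T_C (Omega_minus k)}" "F (M,V,V,M,V,M) k = {T_CH k (Omega_minus k)}"
    unfolding F_words[OF k] pleat by simp_all
  have singleton: "is_singleton (F P k)" if "in_regime Pleat P"
    using regime_words(1)[OF that] by (elim insertE emptyE) (simp_all only: pleat words is_singletonI)
  note plus = plus_words_classified[OF k, THEN pivot_classified_bij(1)]
    plus_words_classified[OF k, THEN pivot_classified_bij(2), unfolded swap_plus_pairs, unfolded plus_pairs_def]
  note minus = minus_words_classified[OF k, THEN pivot_classified_bij(1)]
    minus_words_classified[OF k, THEN pivot_classified_bij(2), unfolded reflect_minus_pairs, unfolded minus_pairs_B_R]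
  have row_plus: "\<forall>\<Pi>\<in>F P k. \<exists>!ab. has_pivot_pair k \<Pi> ab" if "in_regime Row_Plus P"
    using regime_words(2)[OF that] plus by (elim insertE emptyE) simp_all
  have row_minus: "\<forall>\<Pi>\<in>F P k. \<exists>!ab. has_pivot_pair k \<Pi> ab" if "in_regime Row_Minus P"
    using regime_words(3)[OF that] minus by (elim insertE emptyE) simp_all
  have plus_bij: "bij_betw (pivot_pair k) (F P k)
      {(\<alpha>, \<beta>). \<alpha> \<in> {1..2*k-1} \<and> \<beta> \<in> {1..2*k-1} \<and> (\<alpha> = 1 \<or> \<alpha> = 2*k-1 \<or> \<alpha> = \<beta>)}"
    if "P \<in> {(M,M,M,M,V,V), (V,V,V,V,M,M)}"
    using that by (elim insertE emptyE) (simp_all only: plus)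
  have plus_bij_swapped: "bij_betw (pivot_pair k) (F P k)
      {(\<alpha>, \<beta>). \<alpha> \<in> {1..2*k-1} \<and> \<beta> \<in> {1..2*k-1} \<and> (\<beta> = 1 \<or> \<beta> = 2*k-1 \<or> \<alpha> = \<beta>)}"
    if "P \<in> {(M,M,V,V,M,M), (V,V,M,M,V,V)}"
    using that by (elim insertE emptyE) (simp_all only: plus)
  have minus_bij: "bij_betw (pivot_pair k) (F P k)
      {(\<alpha>, \<beta>). \<alpha> \<in> {1..2*k-1} \<and> \<beta> \<in> {1..2*k-1} \<and> B_R \<alpha> = B_R \<beta>}"
    if "P \<in> {(M,V,M,M,M,M), (V,M,V,V,V,V)}"
    using that by (elim insertE emptyE) (simp_all only: minus)
  have minus_bij_reflected: "bij_betw (pivot_pair k) (F P k)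
      {(\<alpha>, \<beta>). \<alpha> \<in> {1..2*k-1} \<and> \<beta> \<in> {1..2*k-1} \<and> B_L k \<alpha> = B_L k \<beta>}"
    if "P \<in> {(V,M,M,M,M,M), (M,V,V,V,V,V)}"
    using that by (elim insertE emptyE) (simp_all only: minus)
  show ?thesis
    unfolding assms(3)
    by (intro conjI impI;
        (rule regime_unique pleat words F_words[OF k] |
         (rule zero regime_words singleton row_plus row_minus plus_bij plus_bij_swapped minus_bij
           minus_bij_reflected, assumption)))
qed

end
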